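(* Let $\Omega$ be either the triangle $\mathcal{D}$ or a box $\mathcal{B}^{(n)}$ ($n\ge2$). Let $\lambda^{(0)}\in\sigma_{\mathrm{odd}}(\Omega)$. Then the nodal deficiency of the Neumann eigenvalue $\lambda^{(0)}$ satisfies $$\delta(\lambda^{(0)})\ \ge\ \left|\underrightarrow{\partial}\mathcal{Q}(\lambda^{(0)})\cap\mathcal{E}\right|-1.$$
   Context: $\mathbb{N}_0=\mathbb{N}\cup\{0\}$. All eigenvalues are those of the Neumann Laplacian $-\Delta$ on $\Omega$. Triangle: $\mathcal{D}=\{(x,y)\in[0,\pi]^2 : y\le x\}$; quantum numbers $\mathcal{Q}=\{(m,n)\in\mathbb{N}_0\times\mathbb{N}_0:m\ge n\}$; eigenvalues (with multiplicity) $\lambda_{m,n}=m^2+n^2$, with eigenfunctions $\cos(mx)\cos(ny)+\cos(my)\cos(nx)$, $(m,n)\in\mathcal{Q}$; $\mathcal{O}=\{(m,n)\in\mathcal{Q}:m\not\equiv n\pmod2\}$, $\mathcal{E}=\{(m,n)\in\mathcal{Q}:m\equiv n\pmod2\}$. Box: $\gamma_n=2^{1/n}$, $\mathcal{B}^{(n)}=\prod_{j=1}^n[0,\pi\gamma_n^{-(j-1)}]$; $\mathcal{Q}=\mathbb{N}_0^n$; eigenvalues (with multiplicity) $\lambda_{\vec m}=\sum_{j=1}^n(\gamma_n^{j-1}m_j)^2$, with eigenfunctions $\prod_{j=1}^n\cos(\gamma_n^{j-1}m_jx_j)$, $\vec m\in\mathcal{Q}$; $\mathcal{O}=\{\vec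 m\in\mathcal{Q}:m_1\text{ odd}\}$, $\mathcal{E}=\{\vec m\in\mathcal{Q}:m_1\text{ even}\}$. In both cases $\sigma_{\mathrm{odd}}(\Omega)=\{\lambda_{\vec m}:\vec m\in\mathcal{O}\}$ and $\mathcal{Q}(\lambda)=\{\vec m\in\mathcal{Q}:\lambda_{\vec m}<\lambda\}$. For $A\subseteq\mathcal{Q}$, $\underrightarrow{\partial}A$ is the set of points of $A$ whose right neighbor is outside $A$: $\underrightarrow{\partial}A=\{(m_1,m_2,\dots,m_n)\in A:(m_1+1,m_2,\dots,m_n)\notin A\}$ (with $n=2$ for the triangle). Nodal deficiency: list the eigenvalues with multiplicity as $0=\lambda_1<\lambda_2\le\cdots$ and put $N(\lambda)=|\{j:\lambda_j<\lambda\}|+1$ for an eigenvalue $\lambda$. For an eigenfunction $\varphi$ of $\lambda$, $\nu(\varphi)$ is the number of connected components of $\Omega^\circ\setminus\varphi^{-1}(0)$ ($\Omega^\circ$ the interior) and $\delta(\varphi)=N(\lambda)-\nu(\varphi)$; $\delta(\lambda)$ is the minimum of $\delta(\varphi)$ over all eigenfunctions $\varphi$ of $\lambda$. *)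

theory Defs
  imports "HOL-Analysis.Analysis" "HOL-Library.Function_Algebras"
begin

section \<open>Neumann eigenfunctions of the Laplacian on a closed convex domain\<close>

definition outward_normal_cone :: "'a::euclidean_space set \<Rightarrow> 'a \<Rightarrow> 'a set" where
  "outward_normal_cone \<Omega> x = {v. \<forall>y\<in>\<Omega>. v \<bullet> (y - x) \<le> 0}"

text \<open>Classical solutions of \<open>-\<Delta> u = \<mu> u\<close> in the interior with vanishing normal derivative on
  the boundary, where \<open>u\<close> is continuously differentiable up to the boundary and twice continuously
  differentiable in the interior. Here \<open>G\<close> is the gradient of \<open>u\<close> and \<open>H x\<close> its Hessian at \<open>x\<close>,
  so that the sum is the trace of the Hessian, i.e. the Laplacian. On a face of a polytope the
  normal cone is the ray spanned by the outward unit normal; at a corner it is generated by the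
  normals of the adjacent faces, so nothing beyond the conditions on these faces is required there.
  A function on \<open>\<Omega>\<close> is represented by its extension by zero, so that functions which agree on \<open>\<Omega>\<close>
  are not counted twice.\<close>

definition neumann_eigenspace ::
    "'a::euclidean_space set \<Rightarrow> real \<Rightarrow> ('a \<Rightarrow> real) set" where
  "neumann_eigenspace \<Omega> \<mu> = {u. (\<forall>x. x \<notin> \<Omega> \<longrightarrow> u x = 0) \<and>
     (\<exists>G H.
        (\<forall>x\<in>\<Omega>. (u has_derivative (\<lambda>h. G x \<bullet> h)) (at x within \<Omega>)) \<and>
        continuous_on \<Omega> G \<and>
        (\<forall>x\<in>interior \<Omega>. (G has_derivative H x) (at x)) \<and>
        (\<forall>h. continuous_on (interior \<Omega>) (\<lambda>x. H x h)) \<and>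
        (\<forall>x\<in>interior \<Omega>. - (\<Sum>b\<in>Basis. H x b \<bullet> b) = \<mu> * u x) \<and>
        (\<forall>x\<in>frontier \<Omega>. \<forall>v\<in>outward_normal_cone \<Omega> x. G x \<bullet> v = 0))}"

definition neumann_eigenfunctions ::
    "'a::euclidean_space set \<Rightarrow> real \<Rightarrow> ('a \<Rightarrow> real) set" where
  "neumann_eigenfunctions \<Omega> \<mu> = neumann_eigenspace \<Omega> \<mu> - {0}"

text \<open>The multiplicity is \<open>0\<close> when \<open>\<mu>\<close> is not an eigenvalue.\<close>

definition multiplicity_of :: "'a::euclidean_space set \<Rightarrow> real \<Rightarrow> nat" where
  "multiplicity_of \<Omega> \<mu> = vector_space.dim (\<lambda>c u x. c * u x) (neumann_eigenspace \<Omega> \<mu>)"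

text \<open>The list of eigenvalues with multiplicity is indexed by the pairs \<open>(\<mu>, i)\<close> with
  \<open>i < multiplicity_of \<Omega> \<mu>\<close>.\<close>

definition spectral_position :: "'a::euclidean_space set \<Rightarrow> real \<Rightarrow> nat" where
  "spectral_position \<Omega> l = card {(\<mu>, i). i < multiplicity_of \<Omega> \<mu> \<and> \<mu> < l} + 1"

section \<open>Nodal count and nodal deficiency\<close>

definition nodal_domains :: "'a::euclidean_space set \<Rightarrow> ('a \<Rightarrow> real) \<Rightarrow> 'a set set" where
  "nodal_domains \<Omega> u = components (interior \<Omega> - u -` {0})"

text \<open>Extended reals avoid the convention \<open>card A = 0\<close> for infinite \<open>A\<close>; the infimum below is
  a minimum, since all values of \<open>deficiency_of\<close> are integers or \<open>-\<infinity>\<close>, unless they are unbounded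
  below.\<close>

definition nodal_count :: "'a::euclidean_space set \<Rightarrow> ('a \<Rightarrow> real) \<Rightarrow> ereal" where
  "nodal_count \<Omega> u =
     (if finite (nodal_domains \<Omega> u) then ereal (real (card (nodal_domains \<Omega> u))) else \<infinity>)"

definition deficiency_of :: "'a::euclidean_space set \<Rightarrow> real \<Rightarrow> ('a \<Rightarrow> real) \<Rightarrow> ereal" where
  "deficiency_of \<Omega> l u = ereal (real (spectral_position \<Omega> l)) - nodal_count \<Omega> u"

definition nodal_deficiency :: "'a::euclidean_space set \<Rightarrow> real \<Rightarrow> ereal" where
  "nodal_deficiency \<Omega> l = (INF u\<in>neumann_eigenfunctions \<Omega> l. deficiency_of \<Omega> l u)"

section \<open>The triangle\<close>

definition triangle_domain :: "(real \<times> real) set" where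
  "triangle_domain = {(x, y). 0 \<le> x \<and> x \<le> pi \<and> 0 \<le> y \<and> y \<le> pi \<and> y \<le> x}"

definition tri_Q :: "(nat \<times> nat) set" where
  "tri_Q = {(m, n). m \<ge> n}"

definition tri_lambda :: "nat \<times> nat \<Rightarrow> real" where
  "tri_lambda = (\<lambda>(m, n). (real m)\<^sup>2 + (real n)\<^sup>2)"

definition tri_odd :: "(nat \<times> nat) set" where
  "tri_odd = {(m, n) \<in> tri_Q. m mod 2 \<noteq> n mod 2}"

definition tri_even :: "(nat \<times> nat) set" where
  "tri_even = {(m, n) \<in> tri_Q. m mod 2 = n mod 2}"

definition tri_sigma_odd :: "real set" where
  "tri_sigma_odd = tri_lambda ` tri_odd"

definition tri_Q_below :: "real \<Rightarrow> (nat \<times> nat) set" where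
  "tri_Q_below l = {m \<in> tri_Q. tri_lambda m < l}"

definition tri_right_boundary :: "(nat \<times> nat) set \<Rightarrow> (nat \<times> nat) set" where
  "tri_right_boundary A = {(m, n) \<in> A. (m + 1, n) \<notin> A}"

section \<open>The boxes\<close>

text \<open>Coordinates of \<open>\<real>\<^sup>n\<close> are indexed by a finite linearly ordered type \<open>'n\<close> with \<open>n\<close> elements;
  \<open>position j\<close> is the position of \<open>j\<close> counted from \<open>0\<close>, i.e. the exponent \<open>j - 1\<close> of \<open>\<gamma>\<^sub>n\<close>.\<close>

definition position :: "'n::{finite,linorder} \<Rightarrow> nat" where
  "position j = card {i. i < j}"

text \<open>The quantum numbers of the box are all functions of type \<open>'n \<Rightarrow> nat\<close>.\<close>

definition first_index :: "'n::{finite,linorder}" where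
  "first_index = Min UNIV"

definition box_gamma :: "nat \<Rightarrow> real" where
  "box_gamma n = 2 powr (1 / real n)"

definition box_domain :: "(real ^ 'n::{finite,linorder}) set" where
  "box_domain = {x. \<forall>j. 0 \<le> x $ j \<and> x $ j \<le> pi / box_gamma CARD('n) ^ position j}"

definition box_lambda :: "('n::{finite,linorder} \<Rightarrow> nat) \<Rightarrow> real" where
  "box_lambda m = (\<Sum>j\<in>UNIV. (box_gamma CARD('n) ^ position j * real (m j))\<^sup>2)"

definition box_odd :: "('n::{finite,linorder} \<Rightarrow> nat) set" where
  "box_odd = {m. odd (m first_index)}"

definition box_even :: "('n::{finite,linorder} \<Rightarrow> nat) set" where
  "box_even = {m. even (m first_index)}"

definition box_sigma_odd :: "'n::{finite,linorder} itself \<Rightarrow> real set" where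
  "box_sigma_odd _ = box_lambda ` (box_odd :: ('n \<Rightarrow> nat) set)"

definition box_Q_below :: "real \<Rightarrow> ('n::{finite,linorder} \<Rightarrow> nat) set" where
  "box_Q_below l = {m. box_lambda m < l}"

definition box_right_boundary ::
    "('n::{finite,linorder} \<Rightarrow> nat) set \<Rightarrow> ('n \<Rightarrow> nat) set" where
  "box_right_boundary A = {m \<in> A. m(first_index := m first_index + 1) \<notin> A}"

end

(* Reflecting across the symmetry that negates the eigenfunctions of odd quantum numbers, half of the
   nodal domains of an eigenfunction phi of l0 are positive. If there were more than one plus the
   number of odd quantum numbers below l0 of them, a non-zero combination u = kappa phi of the
   (antisymmetrized) restrictions of phi to all but one of them would be orthogonal to all
   eigenfunctions with eigenvalue below l0. By Courant's argument u would then be an eigenfunction,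
   hence analytic, although it vanishes on an open set. Decreasing the first quantum number
   matches the odd quantum numbers below l0 with the even ones that are not on the right boundary,
   which turns this count into the lower bound for the deficiency.

   Courant's argument needs neither gradients on nodal domains nor Sobolev spaces: the Dirichlet form is
   replaced by that of a reflected random walk of step h, which is diagonal in the cosine basis, and
   the ground state representation of u = kappa phi bounds its limit as h tends to 0 by l0 |u|^2.

   The eigenspaces are determined by Green's formula, tested with a cutoff near the faces, and by the
   density of trigonometric polynomials (Stone-Weierstrass); functions on the triangle are unfolded to
   the square. *)
theory Submission
  imports Defs "HOL-Complex_Analysis.Complex_Analysis"
begin

text \<open>The arithmetic: let o and e be the numbers of odd and even quantum numbers below l0 and
  c the size of the even right boundary. Then N(l0) = o + e + 1 and e = o + c, while there are at
  most 2 (o + 1) nodal domains; the difference is c - 1. Antisymmetrized functions are orthogonal to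
  all even modes for free, so only o linear conditions remain. Leaving out one of o + 2 positive
  domains still leaves o + 1 unknowns and makes the combination vanish on an open set. All this
  requires every eigenfunction of l0 to be odd, i.e. that an odd and an even quantum number never
  share an eigenvalue. For the triangle m^2 + n^2 has the parity of m + n. For the boxes this is
  where the n-th root of 2 enters: modulo the relation gamma_n^n = 2 the parity of m_1^2 can be read
  off the eigenvalue. As \<open>multiplicity_of\<close> is the dimension of a space of classical
  solutions, N(l0) is not simply a count of cosines: every classical solution must first be shown to
  be a finite combination of them.\<close>

section \<open>Integration by parts on convex polytopes\<close>

text \<open>By translation invariance the difference quotients of \<open>f\<close> along
  \<open>v\<close> have integral zero. The mean value theorem bounds them uniformly, so dominated
  convergence carries this over to the derivative.\<close>

lemma has_integral_partial_derivative_zero: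
  fixes f :: "'a::euclidean_space \<Rightarrow> real" and v :: 'a
  assumes der: "\<And>x. (f has_derivative f' x) (at x)"
    and cont: "continuous_on UNIV (\<lambda>x. f' x v)"
    and supp: "\<And>x. x \<notin> cbox l u \<Longrightarrow> f x = 0"
  shows "((\<lambda>x. f' x v) has_integral 0) UNIV"
proof -
  \<comment> \<open>Enlarged so as to contain every translate of the support by t v with |t| at most
    1; all difference quotients are then integrated over one fixed box.\<close>
  define A where "A = cbox (l - (\<Sum>b\<in>Basis. \<bar>v \<bullet> b\<bar> *\<^sub>R b)) (u + (\<Sum>b\<in>Basis. \<bar>v \<bullet> b\<bar> *\<^sub>R b))"
  have fcont: "continuous_on S f" for S
    by (intro continuous_at_imp_continuous_on ballI has_derivative_continuous[OF der])
  have out: "f' x v = 0" if "x \<notin> cbox l u" for x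
  proof -
    have "eventually (\<lambda>y. y \<in> - cbox l u) (nhds x)"
      using that closed_cbox by (intro eventually_nhds_in_open) auto
    then have "((\<lambda>y. 0) has_derivative f' x) (at x)"
      by (intro has_derivative_transform_eventually[OF der])
         (auto simp: supp that eventually_at_filter elim: eventually_mono)
    then have "f' x = (\<lambda>h. 0)"
      using has_derivative_unique has_derivative_const by blast
    then show ?thesis by simp
  qed
  have inA: "x + t *\<^sub>R v \<in> A" if "x \<in> cbox l u" "\<bar>t\<bar> \<le> 1" for x t
  proof -
    have "\<bar>t * (v \<bullet> b)\<bar> \<le> \<bar>v \<bullet> b\<bar>" for b
      using that(2) by (simp add: abs_mult mult_left_le_one_le)
    moreover have "(\<Sum>b\<in>Basis. \<bar>v \<bullet> b\<bar> *\<^sub>R b) \<bullet> b = \<bar>v \<bullet> b\<bar>" if "b \<in> Basis" for b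
      using that by simp
    ultimately have "l \<bullet> b - (\<Sum>b\<in>Basis. \<bar>v \<bullet> b\<bar> *\<^sub>R b) \<bullet> b \<le> x \<bullet> b + t * (v \<bullet> b) \<and>
        x \<bullet> b + t * (v \<bullet> b) \<le> u \<bullet> b + (\<Sum>b\<in>Basis. \<bar>v \<bullet> b\<bar> *\<^sub>R b) \<bullet> b" if b: "b \<in> Basis" for b
    proof -
      have "l \<bullet> b \<le> x \<bullet> b" "x \<bullet> b \<le> u \<bullet> b" using \<open>x \<in> cbox l u\<close> b by (auto simp: mem_box)
      with \<open>\<And>b. \<bar>t * (v \<bullet> b)\<bar> \<le> \<bar>v \<bullet> b\<bar>\<close>[of b] show ?thesis using b by (auto simp: abs_le_iff)
    qed
    then show ?thesis
      unfolding A_def mem_box inner_diff_left inner_add_left inner_scaleR_left by blast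
  qed
  obtain K where K: "\<And>x. x \<in> cbox l u \<Longrightarrow> \<bar>f' x v\<bar> \<le> K" "K \<ge> 0"
  proof -
    have "bounded ((\<lambda>x. f' x v) ` cbox l u)"
      by (intro compact_imp_bounded compact_continuous_image continuous_on_subset[OF cont]) auto
    then obtain K where "\<forall>x\<in>cbox l u. norm (f' x v) \<le> K"
      by (auto simp: bounded_iff)
    then have "\<bar>f' x v\<bar> \<le> max K 0" if "x \<in> cbox l u" for x
      using that by (simp add: le_max_iff_disj)
    then show ?thesis by (rule that) auto
  qed
  have K': "\<bar>f' x v\<bar> \<le> K" for x
    using K out[of x] by (cases "x \<in> cbox l u") auto
  define q where "q n x = (f (x + (1 / real (Suc n)) *\<^sub>R v) - f x) / (1 / real (Suc n))" for n x
  have line: "((\<lambda>t. f (x + t *\<^sub>R v)) has_real_derivative f' (x + t *\<^sub>R v) v) (at t)" for x t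
  proof -
    have "((\<lambda>t. f (x + t *\<^sub>R v)) has_derivative (\<lambda>s. f' (x + t *\<^sub>R v) (s *\<^sub>R v))) (at t)"
      by (rule has_derivative_compose[OF _ der, unfolded o_def]) (auto intro!: derivative_eq_intros)
    moreover have "(\<lambda>s. f' y (s *\<^sub>R v)) = (*) (f' y v)" for y
      using linear_cmul[OF has_derivative_linear[OF der[of y]]] by (simp add: fun_eq_iff)
    ultimately show ?thesis
      unfolding has_field_derivative_def by simp
  qed
  have qb: "\<bar>q n x\<bar> \<le> K" for n x
  proof -
    have "\<exists>z>0. z < 1 / real (Suc n) \<and> f (x + (1 / real (Suc n)) *\<^sub>R v) - f (x + 0 *\<^sub>R v)
        = (1 / real (Suc n) - 0) * f' (x + z *\<^sub>R v) v"
      by (rule MVT2) (auto intro: line)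
    then obtain z where "f (x + (1 / real (Suc n)) *\<^sub>R v) - f x = (1 / real (Suc n)) * f' (x + z *\<^sub>R v) v"
      by auto
    then have "q n x = f' (x + z *\<^sub>R v) v" unfolding q_def by simp
    then show ?thesis using K' by simp
  qed
  have lim: "(\<lambda>n. q n x) \<longlonglongrightarrow> f' x v" for x
  proof -
    have "((\<lambda>h. (f (x + (0 + h) *\<^sub>R v) - f (x + 0 *\<^sub>R v)) / h) \<longlongrightarrow> f' (x + 0 *\<^sub>R v) v) (at 0)"
      using line[of x 0] unfolding DERIV_def .
    moreover have "filterlim (\<lambda>n. 1 / real (Suc n)) (at 0) sequentially"
      using LIMSEQ_inverse_real_of_nat by (simp add: filterlim_at inverse_eq_divide)
    ultimately have "(\<lambda>n. (f (x + (0 + 1 / real (Suc n)) *\<^sub>R v) - f (x + 0 *\<^sub>R v)) / (1 / real (Suc n)))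
        \<longlonglongrightarrow> f' (x + 0 *\<^sub>R v) v"
      by (rule filterlim_compose)
    then show ?thesis unfolding q_def by simp
  qed
  have shiftint: "integral A (\<lambda>x. f (x + t *\<^sub>R v)) = integral (cbox l u) f" if "\<bar>t\<bar> \<le> 1" for t
  proof -
    have "((\<lambda>x. f (x + t *\<^sub>R v)) has_integral integral (cbox l u) f) (cbox (l - t *\<^sub>R v) (u - t *\<^sub>R v))"
      by (intro has_integral_shift_cbox integrable_integral integrable_continuous fcont)
    then have "((\<lambda>x. f (x + t *\<^sub>R v)) has_integral integral (cbox l u) f) A"
    proof (rule has_integral_on_superset)
      show "f (x + t *\<^sub>R v) = 0" if "x \<notin> cbox (l - t *\<^sub>R v) (u - t *\<^sub>R v)" for x
        using that by (intro supp) (auto simp: mem_box algebra_simps inner_diff_left inner_add_left)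
      show "cbox (l - t *\<^sub>R v) (u - t *\<^sub>R v) \<subseteq> A"
      proof
        fix x assume "x \<in> cbox (l - t *\<^sub>R v) (u - t *\<^sub>R v)"
        then have "x + t *\<^sub>R v \<in> cbox l u"
          by (auto simp: mem_box algebra_simps inner_diff_left inner_add_left)
        from inA[OF this, of "-t"] that show "x \<in> A" by simp
      qed
    qed
    then show ?thesis by (rule integral_unique)
  qed
  have "(\<lambda>n. integral A (q n)) \<longlonglongrightarrow> integral A (\<lambda>x. f' x v)"
  proof (rule dominated_convergence(2))
    show "q n integrable_on A" for n
      unfolding q_def A_def
      by (intro integrable_continuous continuous_intros continuous_on_compose2[OF fcont[of UNIV]]) auto
    show "(\<lambda>x. K) integrable_on A" unfolding A_def by auto
  qed (use qb lim in auto)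
  moreover have "integral A (q n) = 0" for n
  proof -
    have "f integrable_on A" "(\<lambda>x. f (x + (1 / real (Suc n)) *\<^sub>R v)) integrable_on A"
      unfolding A_def
      by (intro integrable_continuous fcont, intro integrable_continuous continuous_intros continuous_on_compose2[OF fcont[of UNIV]]) auto
    then have "integral A (\<lambda>x. f (x + (1 / real (Suc n)) *\<^sub>R v) - f x)
       = integral A (\<lambda>x. f (x + (1 / real (Suc n)) *\<^sub>R v)) - integral A f"
      by (rule integral_diff[rotated])
    also have "\<dots> = 0"
      using shiftint[of 0] shiftint[of "1 / real (Suc n)"] by simp
    finally show ?thesis unfolding q_def by simp
  qed
  ultimately have "integral A (\<lambda>x. f' x v) = 0"
    by (simp add: LIMSEQ_const_iff)
  moreover have "(\<lambda>x. f' x v) integrable_on A"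
    unfolding A_def by (intro integrable_continuous continuous_on_subset[OF cont]) auto
  ultimately have "((\<lambda>x. f' x v) has_integral 0) A"
    by (metis integrable_integral)
  then show ?thesis
  proof (rule has_integral_on_superset)
    show "f' x v = 0" if "x \<notin> A" for x
      using that inA[of x 0] out[of x] by auto
  qed auto
qed

text \<open>A C^1 transition from 0 to 1 built from squared positive parts. It stays 0 up to t = 1
  instead of t = 0, so that cutoffs made from it vanish on a whole neighbourhood of the
  faces.\<close>

definition smooth_step :: "real \<Rightarrow> real" where
  "smooth_step t = 1 - (max 0 (1 - (max 0 (t - 1))\<^sup>2))\<^sup>2"

definition smooth_step' :: "real \<Rightarrow> real" where
  "smooth_step' t = 4 * max 0 (1 - (max 0 (t - 1))\<^sup>2) * max 0 (t - 1)"

lemma has_real_derivative_pos_part_power2: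
  "((\<lambda>t::real. (max 0 t)\<^sup>2) has_real_derivative 2 * max 0 t) (at t)"
proof -
  consider "t < 0" | "t = 0" | "t > 0" by linarith
  then show ?thesis
  proof cases
    case 1
    have "((\<lambda>t::real. 0) has_real_derivative 0) (at t)" by simp
    then have "((\<lambda>t::real. (max 0 t)\<^sup>2) has_real_derivative 0) (at t)"
      by (rule has_field_derivative_transform_within_open[where S="{..<0}"]) (use 1 in auto)
    then show ?thesis using 1 by simp
  next
    case 3
    have "((\<lambda>t::real. t\<^sup>2) has_real_derivative 2 * t) (at t)"
      by (auto intro!: derivative_eq_intros)
    then have "((\<lambda>t::real. (max 0 t)\<^sup>2) has_real_derivative 2 * t) (at t)"
      by (rule has_field_derivative_transform_within_open[where S="{0<..}"]) (use 3 in auto)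
    then show ?thesis using 3 by simp
  next
    case 2
    have "((\<lambda>h::real. (max 0 h)\<^sup>2 / h) \<longlongrightarrow> 0) (at 0)"
    proof (rule Lim_null_comparison)
      show "\<forall>\<^sub>F h in at 0. norm ((max 0 h)\<^sup>2 / h) \<le> \<bar>h::real\<bar>"
        by (auto simp: max_def power2_eq_square intro!: always_eventually)
      show "((\<lambda>h::real. \<bar>h\<bar>) \<longlongrightarrow> 0) (at 0)"
        by (auto intro!: tendsto_eq_intros)
    qed
    then show ?thesis unfolding 2 DERIV_def by simp
  qed
qed

lemma smooth_step_has_derivative:
  "(smooth_step has_real_derivative smooth_step' t) (at t)"
proof -
  let ?r = "\<lambda>t::real. (max 0 t)\<^sup>2"
  have "((\<lambda>t. 1 - ?r (t - 1)) has_real_derivative - (2 * max 0 (t - 1))) (at t)"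
  proof -
    have "((\<lambda>t. t - 1) has_real_derivative 1) (at t)"
      by (auto intro!: derivative_eq_intros)
    from DERIV_chain2[where f="?r" and g="\<lambda>t. t - 1" and x=t and s=UNIV,
        OF has_real_derivative_pos_part_power2 this]
    have "((\<lambda>t. ?r (t - 1)) has_real_derivative 2 * max 0 (t - 1)) (at t)" by simp
    from DERIV_diff[OF DERIV_const[of 1] this] show ?thesis by simp
  qed
  from DERIV_chain2[where f="?r" and g="\<lambda>t. 1 - ?r (t - 1)" and x=t and s=UNIV,
      OF has_real_derivative_pos_part_power2 this]
  have *: "((\<lambda>t. ?r (1 - ?r (t - 1))) has_real_derivative - smooth_step' t) (at t)"
    unfolding smooth_step'_def by (simp add: mult.assoc)
  have "((\<lambda>t. 1 - ?r (1 - ?r (t - 1))) has_real_derivative smooth_step' t) (at t)"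
    using DERIV_diff[OF DERIV_const[of 1] *] by simp
  then show ?thesis
    unfolding smooth_step_def[abs_def] .
qed

lemma smooth_step_eq_0: "t \<le> 1 \<Longrightarrow> smooth_step t = 0"
  and smooth_step_eq_1: "t \<ge> 2 \<Longrightarrow> smooth_step t = 1"
  and smooth_step'_eq_0: "t \<le> 1 \<or> t \<ge> 2 \<Longrightarrow> smooth_step' t = 0"
  and smooth_step'_nonneg: "smooth_step' t \<ge> 0"
  and smooth_step_nonneg: "smooth_step t \<ge> 0"
  and smooth_step_le_1: "smooth_step t \<le> 1"
proof -
  have sq: "1 - (max 0 (t - 1))\<^sup>2 \<le> 0" if "t \<ge> 2"
    using that by (auto simp: max_def)
  show "t \<le> 1 \<Longrightarrow> smooth_step t = 0"
    by (simp add: smooth_step_def)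
  show "t \<ge> 2 \<Longrightarrow> smooth_step t = 1"
    by (simp add: smooth_step_def max_absorb1[OF sq])
  show "t \<le> 1 \<or> t \<ge> 2 \<Longrightarrow> smooth_step' t = 0"
  proof (elim disjE)
    assume "t \<le> 1"
    then have "max 0 (t - 1) = 0" by (intro max_absorb1) simp
    then show ?thesis unfolding smooth_step'_def by (simp only: mult_zero_right)
  next
    assume "t \<ge> 2"
    show ?thesis
      unfolding smooth_step'_def max_absorb1[OF sq[OF \<open>t \<ge> 2\<close>]]
      by (simp only: mult_zero_right mult_zero_left)
  qed
  show "smooth_step' t \<ge> 0"
    by (simp add: smooth_step'_def)
  have "(max 0 (1 - (max 0 (t - 1))\<^sup>2))\<^sup>2 \<le> 1"
    by (intro power_le_one) auto
  then show "smooth_step t \<ge> 0"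
    unfolding smooth_step_def by simp
  show "smooth_step t \<le> 1"
    unfolding smooth_step_def by simp
qed

lemma continuous_on_smooth_step [continuous_intros]:
  "continuous_on S f \<Longrightarrow> continuous_on S (\<lambda>x. smooth_step (f x))"
  "continuous_on S f \<Longrightarrow> continuous_on S (\<lambda>x. smooth_step' (f x))"
  unfolding smooth_step_def smooth_step'_def by (auto intro!: continuous_intros)

text \<open>The \<open>a i\<close> are outward normals of arbitrary length. The strictly interior
  point \<open>c\<close> is the centre of the radial field that controls the boundary weights, and
  it excludes degenerate constraints with \<open>a i = 0\<close> and \<open>d i = 0\<close>.\<close>

locale polytope =
  fixes I :: "'i set" and a :: "'i \<Rightarrow> 'a::euclidean_space" and d :: "'i \<Rightarrow> real"
    and c :: 'a and \<Omega> :: "'a set"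
  assumes finite_I: "finite I"
    and Omega_eq: "\<Omega> = {x. \<forall>i\<in>I. a i \<bullet> x \<le> d i}"
    and bounded_Omega: "bounded \<Omega>"
    and strict_c: "i \<in> I \<Longrightarrow> a i \<bullet> c < d i"
begin

definition U :: "'a set" where "U = {x. \<forall>i\<in>I. a i \<bullet> x < d i}"

definition gap :: "'i \<Rightarrow> 'a \<Rightarrow> real" where "gap i x = d i - a i \<bullet> x"

definition cut :: "real \<Rightarrow> 'a \<Rightarrow> real" where
  "cut \<epsilon> x = (\<Prod>i\<in>I. smooth_step (gap i x / \<epsilon>))"

text \<open>The gradient of the cutoff is minus the sum of these weights times the normals
  \<open>a i\<close>. The weight of face i lives where the gap lies between \<epsilon> and 2
  \<epsilon>, and acts as an approximate surface measure on that face.\<close>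

definition wt :: "real \<Rightarrow> 'i \<Rightarrow> 'a \<Rightarrow> real" where
  "wt \<epsilon> i x = smooth_step' (gap i x / \<epsilon>) / \<epsilon> * (\<Prod>j\<in>I - {i}. smooth_step (gap j x / \<epsilon>))"

lemma U_subset_Omega: "U \<subseteq> \<Omega>"
  unfolding U_def Omega_eq by (auto intro: less_imp_le)

lemma open_U: "open U"
proof -
  have "U = (\<Inter>i\<in>I. {x. a i \<bullet> x < d i})" by (auto simp: U_def)
  then show ?thesis using finite_I by (auto intro!: open_INT open_halfspace_lt)
qed

lemma closed_Omega: "closed \<Omega>"
proof -
  have "\<Omega> = (\<Inter>i\<in>I. {x. a i \<bullet> x \<le> d i})" by (auto simp: Omega_eq)
  then show ?thesis by (auto intro!: closed_INT closed_halfspace_le)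
qed

lemma compact_Omega: "compact \<Omega>"
  using closed_Omega bounded_Omega compact_eq_bounded_closed by blast

lemma convex_Omega: "convex \<Omega>"
proof -
  have "\<Omega> = (\<Inter>i\<in>I. {x. a i \<bullet> x \<le> d i})" by (auto simp: Omega_eq)
  then show ?thesis by (auto intro!: convex_INT convex_halfspace_le)
qed

lemma interior_nonempty: "interior \<Omega> \<noteq> {}"
proof -
  have "c \<in> U" using strict_c by (auto simp: U_def)
  then show ?thesis using interior_maximal[OF U_subset_Omega open_U] by blast
qed

lemma Omega_subset_cbox: obtains l u where "\<Omega> \<subseteq> cbox l u"
proof -
  from bounded_subset_cbox_symmetric[OF bounded_Omega] obtain v where "\<Omega> \<subseteq> cbox (- v) v" .
  then show thesis by (rule that)
qed

lemma U_eq_gap: "U = {x. \<forall>i\<in>I. gap i x > 0}"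
  unfolding U_def gap_def by auto

lemma continuous_on_gap [continuous_intros]: "continuous_on S (gap i)"
  unfolding gap_def[abs_def] by (intro continuous_intros)

lemma continuous_on_cut: "continuous_on S (cut \<epsilon>)"
  unfolding cut_def[abs_def] divide_inverse by (intro continuous_intros)

lemma continuous_on_wt: "continuous_on S (wt \<epsilon> i)"
  unfolding wt_def[abs_def] divide_inverse by (intro continuous_intros)

lemma cut_bounds: "0 \<le> cut \<epsilon> x" "cut \<epsilon> x \<le> 1"
  unfolding cut_def by (auto intro!: prod_nonneg prod_le_1 smooth_step_nonneg smooth_step_le_1)

lemma wt_nonneg: "\<epsilon> > 0 \<Longrightarrow> wt \<epsilon> i x \<ge> 0"
  unfolding wt_def by (auto intro!: mult_nonneg_nonneg divide_nonneg_pos prod_nonneg smooth_step_nonneg smooth_step'_nonneg)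

lemma cut_eq_0: "\<epsilon> > 0 \<Longrightarrow> i \<in> I \<Longrightarrow> gap i x \<le> \<epsilon> \<Longrightarrow> cut \<epsilon> x = 0"
  unfolding cut_def using finite_I by (auto intro!: prod_zero bexI[of _ i] smooth_step_eq_0)

lemma wt_eq_0: "\<epsilon> > 0 \<Longrightarrow> i \<in> I \<Longrightarrow> k \<in> I \<Longrightarrow> gap k x \<le> \<epsilon> \<Longrightarrow> wt \<epsilon> i x = 0"
  by (cases "k = i") (use finite_I in \<open>auto simp: wt_def smooth_step'_eq_0 intro!: prod_zero bexI[of _ k] smooth_step_eq_0\<close>)

lemma wt_eq_0': "\<epsilon> > 0 \<Longrightarrow> gap i x \<ge> 2 * \<epsilon> \<Longrightarrow> wt \<epsilon> i x = 0"
  using smooth_step'_eq_0[of "gap i x / \<epsilon>"] by (simp add: wt_def pos_le_divide_eq)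

lemma cut_has_derivative:
  assumes "\<epsilon> > 0"
  shows "(cut \<epsilon> has_derivative (\<lambda>h. - (\<Sum>i\<in>I. wt \<epsilon> i x * (a i \<bullet> h)))) (at x)"
proof -
  have "((\<lambda>x. smooth_step (gap i x / \<epsilon>)) has_derivative (\<lambda>h. smooth_step' (gap i x / \<epsilon>) * (- (a i \<bullet> h) / \<epsilon>))) (at x)" for i
  proof -
    have "((\<lambda>x. gap i x / \<epsilon>) has_derivative (\<lambda>h. - (a i \<bullet> h) / \<epsilon>)) (at x)"
      unfolding gap_def using assms by (auto intro!: derivative_eq_intros)
    from has_derivative_compose[OF this smooth_step_has_derivative[unfolded has_field_derivative_def]]
    show ?thesis by simp
  qed
  from has_derivative_prod[where I=I, OF this]
  have "(cut \<epsilon> has_derivative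
      (\<lambda>y. \<Sum>i\<in>I. smooth_step' (gap i x / \<epsilon>) * (- (a i \<bullet> y) / \<epsilon>) * (\<Prod>j\<in>I - {i}. smooth_step (gap j x / \<epsilon>)))) (at x)"
    unfolding cut_def[abs_def] .
  then show ?thesis
    by (rule has_derivative_eq_rhs) (auto simp: wt_def sum_negf[symmetric] intro!: ext sum.cong)
qed

text \<open>The cutoff times \<open>F\<close> extends by zero to a C^1 field on the whole space, so
  its divergence integrates to zero. The weights take the place of the boundary integral in Gauss's
  theorem.\<close>

lemma weak_divergence:
  assumes eps: "\<epsilon> > 0"
    and der: "\<And>x. x \<in> U \<Longrightarrow> (F has_derivative DF x) (at x)"
    and cont: "\<And>h. continuous_on U (\<lambda>x. DF x h)"
  shows "((\<lambda>x. if x \<in> U then cut \<epsilon> x * (\<Sum>b\<in>Basis. DF x b \<bullet> b) - (\<Sum>i\<in>I. wt \<epsilon> i x * (a i \<bullet> F x)) else 0)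
           has_integral 0) UNIV"
proof -
  obtain l u where lu: "\<Omega> \<subseteq> cbox l u"
    by (rule Omega_subset_cbox)
  have Fcont: "continuous_on U F"
    by (intro continuous_at_imp_continuous_on ballI has_derivative_continuous[OF der])
  \<comment> \<open>\<open>U\<close> and \<open>V\<close> are open and cover the space; since the
    cutoff is 0 on \<open>V\<close>, differentiability of the extension can be checked on each of
    them separately.\<close>
  define V where "V = (\<Union>i\<in>I. {x. gap i x < \<epsilon>})"
  have "open V"
    unfolding V_def by (auto intro!: open_UN open_Collect_less continuous_intros)
  have UV: "U \<union> V = UNIV"
    unfolding V_def U_eq_gap using eps by force
  have V0: "cut \<epsilon> x = 0" "i \<in> I \<Longrightarrow> wt \<epsilon> i x = 0" if "x \<in> V" for x i
    using that cut_eq_0[OF eps] wt_eq_0[OF eps] unfolding V_def by force+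
  define f' where "f' b x h = (if x \<in> U then
      - (\<Sum>i\<in>I. wt \<epsilon> i x * (a i \<bullet> h)) * (F x \<bullet> b) + cut \<epsilon> x * (DF x h \<bullet> b) else 0)" for b x h
  have part: "((\<lambda>x. f' b x b) has_integral 0) UNIV" if b: "b \<in> Basis" for b
  proof (rule has_integral_partial_derivative_zero[where f'="f' b"])
    show "((\<lambda>x. cut \<epsilon> x * (F x \<bullet> b)) has_derivative f' b x) (at x)" for x
    proof (cases "x \<in> U")
      case True
      have "((\<lambda>x. F x \<bullet> b) has_derivative (\<lambda>h. DF x h \<bullet> b)) (at x)"
        using der[OF True] by (auto intro!: derivative_eq_intros)
      from has_derivative_mult[OF cut_has_derivative[OF eps] this] True
      show ?thesis
        unfolding f'_def by (auto simp: algebra_simps elim!: has_derivative_eq_rhs)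
    next
      case False
      then have "x \<in> V" using UV by auto
      have "((\<lambda>x. 0) has_derivative (\<lambda>h. 0)) (at x)" by simp
      then have "((\<lambda>x. cut \<epsilon> x * (F x \<bullet> b)) has_derivative (\<lambda>h. 0)) (at x)"
        by (rule has_derivative_transform_within_open[OF _ \<open>open V\<close> \<open>x \<in> V\<close>]) (simp add: V0)
      moreover have "f' b x = (\<lambda>h. 0)" using False by (simp add: f'_def fun_eq_iff)
      ultimately show ?thesis by simp
    qed
    show "continuous_on UNIV (\<lambda>x. f' b x b)"
      unfolding UV[symmetric]
    proof (rule continuous_on_open_Un[OF open_U \<open>open V\<close>])
      have "continuous_on U (\<lambda>x. - (\<Sum>i\<in>I. wt \<epsilon> i x * (a i \<bullet> b)) * (F x \<bullet> b) + cut \<epsilon> x * (DF x b \<bullet> b))"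
        by (intro continuous_intros continuous_on_wt continuous_on_cut Fcont cont)
      then show "continuous_on U (\<lambda>x. f' b x b)"
        by (rule continuous_on_eq) (simp add: f'_def)
      have "continuous_on V (\<lambda>x. 0::real)" by simp
      then show "continuous_on V (\<lambda>x. f' b x b)"
        by (rule continuous_on_eq) (simp add: f'_def V0)
    qed
    show "cut \<epsilon> x * (F x \<bullet> b) = 0" if "x \<notin> cbox l u" for x
    proof -
      have "x \<notin> U" using that lu U_subset_Omega by blast
      then show ?thesis using UV V0 by auto
    qed
  qed
  have "((\<lambda>x. \<Sum>b\<in>Basis. f' b x b) has_integral (\<Sum>b\<in>(Basis::'a set). 0)) UNIV"
    by (rule has_integral_sum) (auto intro: part)
  moreover have "(\<Sum>b\<in>Basis. f' b x b) =
     (if x \<in> U then cut \<epsilon> x * (\<Sum>b\<in>Basis. DF x b \<bullet> b) - (\<Sum>i\<in>I. wt \<epsilon> i x * (a i \<bullet> F x)) else 0)" for x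
  proof (cases "x \<in> U")
    case True
    have "(\<Sum>b\<in>Basis. (\<Sum>i\<in>I. wt \<epsilon> i x * (a i \<bullet> b)) * (F x \<bullet> b))
        = (\<Sum>i\<in>I. wt \<epsilon> i x * (\<Sum>b\<in>Basis. (a i \<bullet> b) * (F x \<bullet> b)))"
      unfolding sum_distrib_right sum_distrib_left by (subst sum.swap) (simp add: mult.assoc)
    then show ?thesis
      using True by (simp add: f'_def sum.distrib sum_subtractf sum_distrib_left euclidean_inner[symmetric] sum_negf)
  qed (simp add: f'_def)
  ultimately show ?thesis by simp
qed

lemma integral_extension_eq:
  fixes g :: "'a \<Rightarrow> real"
  assumes A: "\<Omega> \<subseteq> cbox l u" and "g integrable_on cbox l u" and "\<And>x. x \<in> cbox l u \<Longrightarrow> x \<notin> U \<Longrightarrow> g x = 0"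
  shows "((\<lambda>x. if x \<in> U then g x else 0) has_integral integral (cbox l u) g) UNIV"
proof (rule has_integral_on_superset)
  show "((\<lambda>x. if x \<in> U then g x else 0) has_integral integral (cbox l u) g) (cbox l u)"
    by (rule has_integral_eq[OF _ integrable_integral[OF assms(2)]]) (use assms(3) in auto)
qed (use A U_subset_Omega in auto)

lemma cut_outside: "\<epsilon> > 0 \<Longrightarrow> x \<notin> U \<Longrightarrow> cut \<epsilon> x = 0"
  unfolding U_eq_gap using cut_eq_0 by force

lemma wt_outside: "\<epsilon> > 0 \<Longrightarrow> i \<in> I \<Longrightarrow> x \<notin> U \<Longrightarrow> wt \<epsilon> i x = 0"
  unfolding U_eq_gap using wt_eq_0 by force

text \<open>Test with the radial field \<open>x - c\<close>, whose inner product with each face normal is bounded below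
  near that face.\<close>

lemma wt_mass_bounded:
  assumes A: "\<Omega> \<subseteq> cbox l u"
  obtains C \<epsilon>\<^sub>0 where "\<epsilon>\<^sub>0 > 0" "C \<ge> 0"
    "\<And>\<epsilon>. 0 < \<epsilon> \<Longrightarrow> \<epsilon> < \<epsilon>\<^sub>0 \<Longrightarrow> integral (cbox l u) (\<lambda>x. \<Sum>i\<in>I. wt \<epsilon> i x) \<le> C"
proof -
  obtain \<delta> where \<delta>: "\<delta> > 0" "\<And>i. i \<in> I \<Longrightarrow> \<delta> \<le> gap i c"
  proof
    \<comment> \<open>The inserted 1 keeps the minimum defined for an empty set of faces.\<close>
    show "Min (insert 1 ((\<lambda>i. gap i c) ` I)) > 0"
      using finite_I strict_c by (auto simp: gap_def)
    show "Min (insert 1 ((\<lambda>i. gap i c) ` I)) \<le> gap i c" if "i \<in> I" for i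
      using finite_I that by (intro Min_le) auto
  qed
  define C where "C = 2 / \<delta> * (DIM('a) * integral (cbox l u) (\<lambda>_. 1::real))"
  show ?thesis
  proof
    show "\<delta> / 4 > 0" "C \<ge> 0"
      using \<delta> unfolding C_def by (auto intro!: mult_nonneg_nonneg integral_nonneg)
  next
    fix \<epsilon> :: real assume eps: "0 < \<epsilon>" "\<epsilon> < \<delta> / 4"
    let ?A = "cbox l u"
    have sumB: "(\<Sum>b\<in>(Basis::'a set). b \<bullet> b) = real DIM('a)"
      by (simp add: inner_same_Basis)
    have "((\<lambda>x. if x \<in> U then cut \<epsilon> x * (\<Sum>b\<in>(Basis::'a set). b \<bullet> b) - (\<Sum>i\<in>I. wt \<epsilon> i x * (a i \<bullet> (x - c))) else 0)
           has_integral 0) UNIV"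
      by (rule weak_divergence[OF eps(1), of "\<lambda>x. x - c" "\<lambda>x h. h"])
         (auto intro!: derivative_eq_intros)
    moreover have int: "(\<lambda>x. cut \<epsilon> x * (\<Sum>b\<in>(Basis::'a set). b \<bullet> b)) integrable_on ?A"
      "(\<lambda>x. \<Sum>i\<in>I. wt \<epsilon> i x * (a i \<bullet> (x - c))) integrable_on ?A"
      by (intro integrable_continuous continuous_intros continuous_on_cut continuous_on_wt)+
    have "((\<lambda>x. if x \<in> U then cut \<epsilon> x * (\<Sum>b\<in>(Basis::'a set). b \<bullet> b) - (\<Sum>i\<in>I. wt \<epsilon> i x * (a i \<bullet> (x - c))) else 0)
       has_integral integral ?A (\<lambda>x. cut \<epsilon> x * (\<Sum>b\<in>(Basis::'a set). b \<bullet> b) - (\<Sum>i\<in>I. wt \<epsilon> i x * (a i \<bullet> (x - c))))) UNIV"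
      by (intro integral_extension_eq[OF A] integrable_diff int) (simp add: cut_outside wt_outside eps)
    ultimately have "integral ?A (\<lambda>x. cut \<epsilon> x * (\<Sum>b\<in>(Basis::'a set). b \<bullet> b) - (\<Sum>i\<in>I. wt \<epsilon> i x * (a i \<bullet> (x - c)))) = 0"
      by (rule has_integral_unique[THEN sym])
    then have eq: "integral ?A (\<lambda>x. \<Sum>i\<in>I. wt \<epsilon> i x * (a i \<bullet> (x - c))) = integral ?A (\<lambda>x. cut \<epsilon> x * DIM('a))"
      using integral_diff[OF int] by (simp add: sumB)
    have "\<delta> / 2 * integral ?A (\<lambda>x. \<Sum>i\<in>I. wt \<epsilon> i x) = integral ?A (\<lambda>x. \<Sum>i\<in>I. wt \<epsilon> i x * (\<delta> / 2))"
      by (subst integral_mult_right[symmetric]) (simp add: sum_distrib_left mult.commute)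
    also have "\<dots> \<le> integral ?A (\<lambda>x. \<Sum>i\<in>I. wt \<epsilon> i x * (a i \<bullet> (x - c)))"
    proof (intro integral_le sum_mono)
      show "(\<lambda>x. \<Sum>i\<in>I. wt \<epsilon> i x * (\<delta> / 2)) integrable_on ?A"
        by (intro integrable_continuous continuous_intros continuous_on_wt)
      fix x i assume i: "i \<in> I"
      show "wt \<epsilon> i x * (\<delta> / 2) \<le> wt \<epsilon> i x * (a i \<bullet> (x - c))"
      proof (cases "gap i x \<ge> 2 * \<epsilon>")
        case False
        \<comment> \<open>Where the weight of face i is not zero, the gap is below 2 \<epsilon> <
          \<delta> / 2, whereas the gap at \<open>c\<close> is at least \<delta>.\<close>
        have "a i \<bullet> (x - c) = gap i c - gap i x"
          by (simp add: gap_def inner_diff_right)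
        then have "\<delta> / 2 \<le> a i \<bullet> (x - c)"
          using False eps \<delta>(2)[OF i] by linarith
        then show ?thesis using wt_nonneg[OF eps(1)] by (intro mult_left_mono) auto
      qed (simp add: wt_eq_0' eps)
    qed (rule int)
    also have "\<dots> \<le> integral ?A (\<lambda>x. 1 * DIM('a))"
      unfolding eq
      by (intro integral_le integrable_continuous continuous_intros continuous_on_cut mult_right_mono) (auto simp: cut_bounds)
    also have "\<dots> = DIM('a) * integral ?A (\<lambda>_. 1::real)" by simp
    finally show "integral ?A (\<lambda>x. \<Sum>i\<in>I. wt \<epsilon> i x) \<le> C"
      unfolding C_def using \<delta>(1) by (simp add: field_simps)
  qed
qed

text \<open>In \<open>weak_divergence\<close> let \<epsilon> tend to 0: near face i the normal
  component of \<open>F\<close> is uniformly small, while the total mass of the weights stays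
  bounded. The divergence enters through a continuous extension \<open>g\<close>, because single
  second derivatives of an eigenfunction need not be bounded near the boundary although its
  Laplacian is.\<close>

theorem integral_divergence_zero:
  assumes der: "\<And>x. x \<in> U \<Longrightarrow> (F has_derivative DF x) (at x)"
    and cont: "\<And>h. continuous_on U (\<lambda>x. DF x h)"
    and Fcont: "continuous_on \<Omega> F"
    and bd: "\<And>x i. x \<in> \<Omega> \<Longrightarrow> i \<in> I \<Longrightarrow> a i \<bullet> x = d i \<Longrightarrow> a i \<bullet> F x = 0"
    and gcont: "continuous_on \<Omega> g"
    and g: "\<And>x. x \<in> U \<Longrightarrow> g x = (\<Sum>b\<in>Basis. DF x b \<bullet> b)"
  shows "integral \<Omega> g = 0"
proof -
  obtain l u where A: "\<Omega> \<subseteq> cbox l u"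
    by (rule Omega_subset_cbox)
  let ?A = "cbox l u"
  obtain C \<epsilon>\<^sub>0 where C: "\<epsilon>\<^sub>0 > 0" "C \<ge> 0"
    "\<And>\<epsilon>. 0 < \<epsilon> \<Longrightarrow> \<epsilon> < \<epsilon>\<^sub>0 \<Longrightarrow> integral ?A (\<lambda>x. \<Sum>i\<in>I. wt \<epsilon> i x) \<le> C"
    using wt_mass_bounded[OF A] by metis
  define E where "E n = 1 / real (Suc n)" for n
  have E: "E n > 0" "E \<longlonglongrightarrow> 0" for n
    using LIMSEQ_inverse_real_of_nat unfolding E_def by (auto simp: inverse_eq_divide)
  define G where "G x = (if x \<in> U then g x else 0)" for x
  define J where "J n x = (if x \<in> U then cut (E n) x * g x else 0)" for n x
  define R where "R n x = (if x \<in> U then (\<Sum>i\<in>I. wt (E n) i x * (a i \<bullet> F x)) else 0)" for n x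
  have UV: "U \<union> (\<Union>i\<in>I. {x. gap i x < E n}) = UNIV" for n
    unfolding U_eq_gap using E(1)[of n] by force
  have opV: "open (\<Union>i\<in>I. {x. gap i x < E n})" for n
    by (auto intro!: open_UN open_Collect_less continuous_intros)
  have glue: "continuous_on UNIV (\<lambda>x. if x \<in> U then h x else 0)"
    if "continuous_on U h" "\<And>x i. i \<in> I \<Longrightarrow> gap i x < E n \<Longrightarrow> h x = 0" for h :: "'a \<Rightarrow> real" and n
    unfolding UV[of n, symmetric]
  proof (rule continuous_on_open_Un[OF open_U opV])
    show "continuous_on U (\<lambda>x. if x \<in> U then h x else 0)"
      by (rule continuous_on_eq[OF that(1)]) simp
    have "continuous_on (\<Union>i\<in>I. {x. gap i x < E n}) (\<lambda>x. 0::real)" by simp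
    then show "continuous_on (\<Union>i\<in>I. {x. gap i x < E n}) (\<lambda>x. if x \<in> U then h x else 0)"
      by (rule continuous_on_eq) (use that(2) in auto)
  qed
  have Jcont: "continuous_on UNIV (J n)" for n
    unfolding J_def
    by (intro glue[of _ n] continuous_intros continuous_on_cut continuous_on_subset[OF gcont U_subset_Omega])
       (auto simp: cut_eq_0[OF E(1)])
  have Rcont: "continuous_on UNIV (R n)" for n
    unfolding R_def
    by (intro glue[of _ n] continuous_intros continuous_on_wt continuous_on_subset[OF Fcont U_subset_Omega])
       (auto simp: wt_eq_0[OF E(1)])
  have JR: "integral ?A (J n) = integral ?A (R n)" for n
  proof -
    have "((\<lambda>x. J n x - R n x) has_integral 0) UNIV"
      using weak_divergence[OF E(1)[of n] der cont]
      by (rule has_integral_eq[rotated]) (auto simp: J_def R_def g)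
    moreover have "((\<lambda>x. J n x - R n x) has_integral integral ?A (\<lambda>x. J n x - R n x)) UNIV"
      by (rule has_integral_on_superset[of _ _ ?A])
         (use A U_subset_Omega in \<open>auto simp: J_def R_def intro!: integrable_integral integrable_continuous
             continuous_intros continuous_on_subset[OF Jcont[unfolded J_def]] continuous_on_subset[OF Rcont[unfolded R_def]]\<close>)
    ultimately have "integral ?A (\<lambda>x. J n x - R n x) = 0" by (rule has_integral_unique[THEN sym])
    moreover have "integral ?A (\<lambda>x. J n x - R n x) = integral ?A (J n) - integral ?A (R n)"
      by (intro integral_diff integrable_continuous continuous_on_subset[OF Jcont] continuous_on_subset[OF Rcont]) auto
    ultimately show ?thesis by simp
  qed
  have Rlim: "(\<lambda>n. integral ?A (R n)) \<longlonglongrightarrow> 0"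
  proof (rule LIMSEQ_I)
    fix r :: real assume "r > 0"
    \<comment> \<open>If the normal components are at most \<omega> where the weights live, the
      boundary term is at most \<omega> C < r; the 1 guards against \<open>C = 0\<close>.\<close>
    define \<omega> where "\<omega> = r / (C + 1)"
    have \<omega>: "\<omega> > 0" "\<omega> * C < r"
      using \<open>r > 0\<close> C(2) unfolding \<omega>_def by (auto simp: field_simps)
    \<comment> \<open>The points where the normal component is at least \<omega> form a compact set
      that misses face i, so the gap has a positive minimum on it.\<close>
    have "\<exists>t>0. \<forall>x\<in>\<Omega>. gap i x \<le> t \<longrightarrow> \<bar>a i \<bullet> F x\<bar> \<le> \<omega>" if i: "i \<in> I" for i
    proof -
      define K where "K = {x\<in>\<Omega>. \<omega> \<le> \<bar>a i \<bullet> F x\<bar>}"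
      have "compact K"
      proof -
        have "closedin (top_of_set \<Omega>) (\<Omega> \<inter> (\<lambda>x. \<bar>a i \<bullet> F x\<bar>) -` {\<omega>..})"
          by (intro continuous_closedin_preimage continuous_intros Fcont closed_atLeast)
        moreover have "\<Omega> \<inter> (\<lambda>x. \<bar>a i \<bullet> F x\<bar>) -` {\<omega>..} = K" by (auto simp: K_def)
        ultimately show ?thesis
          using closedin_compact[OF compact_Omega] by simp
      qed
      have pos: "gap i x > 0" if "x \<in> K" for x
      proof -
        have "a i \<bullet> x \<noteq> d i" using bd[of x i] that i \<omega> by (auto simp: K_def)
        moreover have "a i \<bullet> x \<le> d i" using that i by (auto simp: K_def Omega_eq)
        ultimately show ?thesis by (simp add: gap_def)
      qed
      show ?thesis
      proof (cases "K = {}")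
        case True
        then show ?thesis by (intro exI[of _ 1]) (auto simp: K_def not_le intro: less_imp_le)
      next
        case False
        obtain y where y: "y \<in> K" "\<And>x. x \<in> K \<Longrightarrow> gap i y \<le> gap i x"
          using continuous_attains_inf[OF \<open>compact K\<close> False continuous_on_gap] by blast
        show ?thesis
        proof (intro exI[of _ "gap i y / 2"] conjI ballI impI)
          show "gap i y / 2 > 0" using pos[OF y(1)] by simp
          fix x assume x: "x \<in> \<Omega>" "gap i x \<le> gap i y / 2"
          then have "gap i x < gap i y" using pos[OF y(1)] by simp
          then have "x \<notin> K" using y(2)[of x] by auto
          then show "\<bar>a i \<bullet> F x\<bar> \<le> \<omega>" using x by (auto simp: K_def)
        qed
      qed
    qed
    then obtain t where t: "\<And>i. i \<in> I \<Longrightarrow> t i > 0" "\<And>i x. i \<in> I \<Longrightarrow> x \<in> \<Omega> \<Longrightarrow> gap i x \<le> t i \<Longrightarrow> \<bar>a i \<bullet> F x\<bar> \<le> \<omega>"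
      by metis
    define \<tau> where "\<tau> = Min (insert \<epsilon>\<^sub>0 ((\<lambda>i. t i / 2) ` I))"
    have "\<tau> > 0" unfolding \<tau>_def using finite_I t(1) C(1) by auto
    then have "\<forall>\<^sub>F n in sequentially. E n < \<tau>"
      using E(2) by (auto dest: order_tendstoD)
    then obtain N where N: "\<And>n. n \<ge> N \<Longrightarrow> E n < \<tau>"
      by (auto simp: eventually_sequentially)
    have "norm (integral ?A (R n) - 0) < r" if "n \<ge> N" for n
    proof -
      have small: "E n < \<epsilon>\<^sub>0" "i \<in> I \<Longrightarrow> 2 * E n < t i" for i
        using N[OF that] finite_I unfolding \<tau>_def by (auto simp: field_simps)
      have "norm (integral ?A (R n)) \<le> integral ?A (\<lambda>x. \<omega> * (\<Sum>i\<in>I. wt (E n) i x))"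
      proof (rule integral_norm_bound_integral)
        show "R n integrable_on ?A" by (intro integrable_continuous continuous_on_subset[OF Rcont]) auto
        show "(\<lambda>x. \<omega> * (\<Sum>i\<in>I. wt (E n) i x)) integrable_on ?A"
          by (intro integrable_continuous continuous_intros continuous_on_wt)
        fix x
        have "\<bar>R n x\<bar> \<le> (\<Sum>i\<in>I. \<omega> * wt (E n) i x)"
        proof (cases "x \<in> U")
          case True
          then have "\<bar>R n x\<bar> \<le> (\<Sum>i\<in>I. \<bar>wt (E n) i x * (a i \<bullet> F x)\<bar>)"
            unfolding R_def by simp
          also have "\<dots> \<le> (\<Sum>i\<in>I. \<omega> * wt (E n) i x)"
          proof (rule sum_mono)
            fix i assume i: "i \<in> I"
            show "\<bar>wt (E n) i x * (a i \<bullet> F x)\<bar> \<le> \<omega> * wt (E n) i x"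
            proof (cases "gap i x \<ge> 2 * E n")
              case True
              then show ?thesis using wt_eq_0'[OF E(1)] by simp
            next
              case False
              then have "\<bar>a i \<bullet> F x\<bar> \<le> \<omega>"
                using small(2)[OF i] t(2)[OF i] \<open>x \<in> U\<close> U_subset_Omega by force
              then show ?thesis
                using wt_nonneg[OF E(1), of n i x] by (simp add: abs_mult mult.commute mult_right_mono)
            qed
          qed
          finally show ?thesis .
        next
          case False
          then show ?thesis using wt_nonneg[OF E(1)] \<omega>(1) by (auto simp: R_def intro!: sum_nonneg)
        qed
        then show "norm (R n x) \<le> \<omega> * (\<Sum>i\<in>I. wt (E n) i x)"
          by (simp add: sum_distrib_left)
      qed
      also have "\<dots> = \<omega> * integral ?A (\<lambda>x. \<Sum>i\<in>I. wt (E n) i x)" by simp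
      also have "\<dots> \<le> \<omega> * C"
        using C(3)[OF E(1) small(1)] \<omega>(1) by (intro mult_left_mono) auto
      finally show ?thesis using \<omega>(2) by simp
    qed
    then show "\<exists>N. \<forall>n\<ge>N. norm (integral ?A (R n) - 0) < r" by blast
  qed
  obtain B where B: "\<And>x. x \<in> \<Omega> \<Longrightarrow> \<bar>g x\<bar> \<le> B"
  proof -
    have "bounded (g ` \<Omega>)" by (intro compact_imp_bounded compact_continuous_image gcont compact_Omega)
    then show ?thesis using that by (auto simp: bounded_iff)
  qed
  have "c \<in> \<Omega>" using strict_c by (auto simp: Omega_eq intro: less_imp_le)
  then have "B \<ge> 0" using B[of c] by auto
  have "J n integrable_on ?A" for n
    by (intro integrable_continuous continuous_on_subset[OF Jcont]) auto
  moreover have "norm (J n x) \<le> B" for n x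
    proof (cases "x \<in> U")
      case True
      then have "\<bar>cut (E n) x\<bar> * \<bar>g x\<bar> \<le> 1 * B"
        using cut_bounds[of "E n" x] B[of x] U_subset_Omega by (intro mult_mono) auto
      then show ?thesis using True by (simp add: J_def abs_mult)
    qed (use \<open>B \<ge> 0\<close> in \<open>simp add: J_def\<close>)
  moreover have "(\<lambda>n. J n x) \<longlonglongrightarrow> G x" for x
    proof (cases "x \<in> U")
      case True
      have "\<forall>\<^sub>F n in sequentially. \<forall>i\<in>I. E n < gap i x / 2"
        using finite_I True order_tendstoD(2)[OF E(2), of "gap i x / 2" for i] unfolding U_eq_gap
        by (intro eventually_ball_finite) (simp_all del: less_divide_eq_numeral1)
      then have "\<forall>\<^sub>F n in sequentially. J n x = G x"
      proof (rule eventually_mono)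
        fix n assume *: "\<forall>i\<in>I. E n < gap i x / 2"
        have "cut (E n) x = 1"
          unfolding cut_def using * E(1)[of n]
          by (intro prod.neutral ballI smooth_step_eq_1) (auto simp: field_simps)
        then show "J n x = G x" by (simp add: J_def G_def)
      qed
      then show ?thesis by (simp add: tendsto_eventually)
    qed (simp add: J_def G_def)
  ultimately have Gint: "G integrable_on ?A" "(\<lambda>n. integral ?A (J n)) \<longlonglongrightarrow> integral ?A G"
    using dominated_convergence[of J ?A "\<lambda>x. B" G] by auto
  have "integral ?A G = 0"
    using LIMSEQ_unique[OF Gint(2)[unfolded JR] Rlim] .
  then have "(G has_integral 0) ?A" using Gint(1) by (metis integrable_integral)
  then have "(G has_integral 0) \<Omega>"
    unfolding has_integral_restrict[OF A, symmetric]
    by (rule has_integral_eq[rotated]) (use U_subset_Omega in \<open>auto simp: G_def\<close>)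
  moreover have "negligible (\<Omega> - U)"
  proof (rule negligible_subset)
    show "negligible (\<Union>i\<in>I. {x. a i \<bullet> x = d i})"
    proof (intro negligible_Union finite_imageI finite_I)
      fix T assume "T \<in> (\<lambda>i. {x. a i \<bullet> x = d i}) ` I"
      then obtain i where i: "i \<in> I" "T = {x. a i \<bullet> x = d i}" by auto
      have "a i \<noteq> 0 \<or> d i \<noteq> 0" using strict_c[OF i(1)] by auto
      then show "negligible T" unfolding i by (rule negligible_hyperplane)
    qed
    show "\<Omega> - U \<subseteq> (\<Union>i\<in>I. {x. a i \<bullet> x = d i})"
      by (force simp: Omega_eq U_def)
  qed
  ultimately have "(g has_integral 0) \<Omega>"
    by (rule has_integral_spike[rotated 2]) (auto simp: G_def)
  then show ?thesis by (rule integral_unique)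
qed

end

section \<open>Cosine functions on a box\<close>

definition reflect_coords :: "'a::euclidean_space set \<Rightarrow> 'a \<Rightarrow> 'a \<Rightarrow> 'a \<Rightarrow> 'a" where
  "reflect_coords J l u x = (\<Sum>k\<in>Basis. (if k \<in> J then l \<bullet> k + u \<bullet> k - x \<bullet> k else x \<bullet> k) *\<^sub>R k)"

lemma inner_reflect_coords:
  "k \<in> Basis \<Longrightarrow> reflect_coords J l u x \<bullet> k = (if k \<in> J then l \<bullet> k + u \<bullet> k - x \<bullet> k else x \<bullet> k)"
  by (simp add: reflect_coords_def)

lemma reflect_coords_in_cbox: "x \<in> cbox l u \<Longrightarrow> reflect_coords J l u x \<in> cbox l u"
  by (auto simp: mem_box inner_reflect_coords)

lemma continuous_on_reflect_coords: "continuous_on S (reflect_coords J l u)"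
proof -
  have "continuous_on S (\<lambda>x. if k \<in> J then l \<bullet> k + u \<bullet> k - x \<bullet> k else x \<bullet> k)" for k
    by (cases "k \<in> J") (auto intro!: continuous_intros)
  then show ?thesis
    unfolding reflect_coords_def[abs_def] by (intro continuous_intros)
qed

text \<open>A stretch by factors 1 and -1, which preserves volume, composed with a
  translation.\<close>

lemma has_integral_reflect_coords:
  fixes f :: "'a::euclidean_space \<Rightarrow> real"
  assumes "(f has_integral i) (cbox l u)"
  shows "((\<lambda>x. f (reflect_coords J l u x)) has_integral i) (cbox l u)"
proof (cases "cbox l u = {}")
  case True
  then show ?thesis using assms by simp
next
  case False
  define m :: "'a \<Rightarrow> real" where "m k = (if k \<in> J then -1 else 1)" for k
  define c where "c = (\<Sum>k\<in>Basis. (if k \<in> J then - (l \<bullet> k + u \<bullet> k) else 0) *\<^sub>R k)"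
  have ck: "c \<bullet> k = (if k \<in> J then - (l \<bullet> k + u \<bullet> k) else 0)" if "k \<in> Basis" for k
    using that by (simp add: c_def)
  have prodm: "\<bar>prod m Basis\<bar> = 1"
    unfolding abs_prod by (rule prod.neutral) (simp add: m_def)
  have inv: "1 / m k = m k" for k by (simp add: m_def)
  have "((\<lambda>x. f (\<Sum>k\<in>Basis. (m k * (x \<bullet> k)) *\<^sub>R k)) has_integral i)
     ((\<lambda>x. \<Sum>k\<in>Basis. (m k * (x \<bullet> k)) *\<^sub>R k) ` cbox l u)"
    using has_integral_stretch[OF assms, of m] by (simp add: prodm inv) (simp add: m_def)
  from has_integral_shift_cbox[OF this[unfolded image_stretch_interval if_not_P[OF False]], of c]
  have *: "((\<lambda>x. f (\<Sum>k\<in>Basis. (m k * ((x + c) \<bullet> k)) *\<^sub>R k)) has_integral i)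
    (cbox ((\<Sum>k\<in>Basis. min (m k * (l \<bullet> k)) (m k * (u \<bullet> k)) *\<^sub>R k) - c)
          ((\<Sum>k\<in>Basis. max (m k * (l \<bullet> k)) (m k * (u \<bullet> k)) *\<^sub>R k) - c))" .
  have le: "l \<bullet> k \<le> u \<bullet> k" if "k \<in> Basis" for k
    using False that by (auto simp: box_ne_empty)
  have "(\<Sum>k\<in>Basis. (m k * ((x + c) \<bullet> k)) *\<^sub>R k) = reflect_coords J l u x" for x
    unfolding reflect_coords_def
    by (intro sum.cong refl arg_cong2[where f=scaleR]) (simp add: m_def ck inner_add_left)
  moreover have "(\<Sum>k\<in>Basis. min (m k * (l \<bullet> k)) (m k * (u \<bullet> k)) *\<^sub>R k) - c = l"
  proof (rule euclidean_eqI)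
    fix k :: 'a assume k: "k \<in> Basis"
    have "(\<Sum>k\<in>Basis. min (m k * (l \<bullet> k)) (m k * (u \<bullet> k)) *\<^sub>R k) \<bullet> k = min (m k * (l \<bullet> k)) (m k * (u \<bullet> k))"
      using k by simp
    then show "((\<Sum>k\<in>Basis. min (m k * (l \<bullet> k)) (m k * (u \<bullet> k)) *\<^sub>R k) - c) \<bullet> k = l \<bullet> k"
      using le[OF k] unfolding inner_diff_left ck[OF k] m_def by (cases "k \<in> J") simp_all
  qed
  moreover have "(\<Sum>k\<in>Basis. max (m k * (l \<bullet> k)) (m k * (u \<bullet> k)) *\<^sub>R k) - c = u"
  proof (rule euclidean_eqI)
    fix k :: 'a assume k: "k \<in> Basis"
    have "(\<Sum>k\<in>Basis. max (m k * (l \<bullet> k)) (m k * (u \<bullet> k)) *\<^sub>R k) \<bullet> k = max (m k * (l \<bullet> k)) (m k * (u \<bullet> k))"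
      using k by simp
    then show "((\<Sum>k\<in>Basis. max (m k * (l \<bullet> k)) (m k * (u \<bullet> k)) *\<^sub>R k) - c) \<bullet> k = u \<bullet> k"
      using le[OF k] unfolding inner_diff_left ck[OF k] m_def by (cases "k \<in> J") simp_all
  qed
  ultimately show ?thesis using * by simp
qed

text \<open>The side length along \<open>b\<close> will be pi / \<omega> b, so that cos (\<omega> b
  k t) has zero derivative at both ends. One locale covers the boxes, with powers of gamma_n as
  \<omega>, and the square containing the triangle, with \<omega> = 1.\<close>

locale cos_box =
  fixes \<omega> :: "'a::euclidean_space \<Rightarrow> real"
  assumes \<omega>_pos: "b \<in> Basis \<Longrightarrow> \<omega> b > 0"
begin

definition top_corner :: 'a where "top_corner = (\<Sum>b\<in>Basis. (pi / \<omega> b) *\<^sub>R b)"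

definition Box :: "'a set" where "Box = cbox 0 top_corner"

text \<open>Multi-indices are functions on the whole space; fixing the value 0 off
  \<open>Basis\<close> makes each of them occur once, which matters for counting.\<close>

definition Idx :: "('a \<Rightarrow> nat) set" where "Idx = {k. \<forall>b. b \<notin> Basis \<longrightarrow> k b = 0}"

definition e :: "('a \<Rightarrow> nat) \<Rightarrow> 'a \<Rightarrow> real" where
  "e k x = (\<Prod>b\<in>Basis. cos (\<omega> b * real (k b) * (x \<bullet> b)))"

definition lam :: "('a \<Rightarrow> nat) \<Rightarrow> real" where "lam k = (\<Sum>b\<in>Basis. (\<omega> b * real (k b))\<^sup>2)"

definition ip :: "('a \<Rightarrow> real) \<Rightarrow> ('a \<Rightarrow> real) \<Rightarrow> real" where
  "ip f g = integral Box (\<lambda>x. f x * g x)"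

text \<open>One step of length \<open>h\<close> of the walk in direction \<open>\<plusminus>b\<close>, reflected at the two faces orthogonal to \<open>b\<close>.\<close>

definition up :: "'a \<Rightarrow> real \<Rightarrow> 'a \<Rightarrow> 'a" where
  "up b h x = x + (min (x \<bullet> b + h) (2 * pi / \<omega> b - h - x \<bullet> b) - x \<bullet> b) *\<^sub>R b"

definition down :: "'a \<Rightarrow> real \<Rightarrow> 'a \<Rightarrow> 'a" where
  "down b h x = x + (\<bar>x \<bullet> b - h\<bar> - x \<bullet> b) *\<^sub>R b"

lemma top_corner_inner: "b \<in> Basis \<Longrightarrow> top_corner \<bullet> b = pi / \<omega> b"
  by (simp add: top_corner_def)

lemma mem_Box: "x \<in> Box \<longleftrightarrow> (\<forall>b\<in>Basis. 0 \<le> x \<bullet> b \<and> x \<bullet> b \<le> pi / \<omega> b)"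
  by (auto simp: Box_def mem_box top_corner_inner)

lemma compact_Box: "compact Box" and convex_Box: "convex Box"
  by (auto simp: Box_def)

lemma integrable_Box: "continuous_on Box f \<Longrightarrow> (f :: 'a \<Rightarrow> real) integrable_on Box"
  unfolding Box_def by (rule integrable_continuous)

lemma continuous_on_e [continuous_intros]: "continuous_on S (e k)"
  unfolding e_def[abs_def] by (intro continuous_intros)

lemma continuous_on_up: "continuous_on S (up b h)"
  unfolding up_def[abs_def] by (intro continuous_intros)

lemma continuous_on_down: "continuous_on S (down b h)"
  unfolding down_def[abs_def] by (intro continuous_intros)

lemma up_in_Box: "b \<in> Basis \<Longrightarrow> 0 \<le> h \<Longrightarrow> h \<le> pi / \<omega> b \<Longrightarrow> x \<in> Box \<Longrightarrow> up b h x \<in> Box"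
  by (auto simp: mem_Box up_def inner_add_left inner_Basis)

lemma down_in_Box: "b \<in> Basis \<Longrightarrow> 0 \<le> h \<Longrightarrow> h \<le> pi / \<omega> b \<Longrightarrow> x \<in> Box \<Longrightarrow> down b h x \<in> Box"
  by (auto simp: mem_Box down_def inner_add_left inner_Basis abs_le_iff)

lemma dist_up: "b \<in> Basis \<Longrightarrow> 0 \<le> h \<Longrightarrow> x \<in> Box \<Longrightarrow> dist x (up b h x) \<le> h"
  by (auto simp: mem_Box up_def dist_norm)

lemma dist_down: "b \<in> Basis \<Longrightarrow> 0 \<le> h \<Longrightarrow> x \<in> Box \<Longrightarrow> dist x (down b h x) \<le> h"
  by (auto simp: mem_Box down_def dist_norm)

lemma e_shift:
  assumes b: "b \<in> Basis"
  shows "e k (x + t *\<^sub>R b) = cos (\<omega> b * real (k b) * (x \<bullet> b + t)) * (\<Prod>b'\<in>Basis - {b}. cos (\<omega> b' * real (k b') * (x \<bullet> b')))"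
proof -
  have "e k (x + t *\<^sub>R b) = cos (\<omega> b * real (k b) * ((x + t *\<^sub>R b) \<bullet> b)) *
      (\<Prod>b'\<in>Basis - {b}. cos (\<omega> b' * real (k b') * ((x + t *\<^sub>R b) \<bullet> b')))"
    unfolding e_def by (rule prod.remove) (use b in auto)
  also have "(\<Prod>b'\<in>Basis - {b}. cos (\<omega> b' * real (k b') * ((x + t *\<^sub>R b) \<bullet> b')))
     = (\<Prod>b'\<in>Basis - {b}. cos (\<omega> b' * real (k b') * (x \<bullet> b')))"
    by (rule prod.cong) (use b in \<open>auto simp: inner_add_left inner_Basis\<close>)
  finally show ?thesis using b by (simp add: inner_add_left)
qed

text \<open>The cosines are even about both faces, so reflecting a step at a face does not change
  their values. The addition theorem then makes \<open>e k\<close> an eigenfunction of the reflected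
  walk.\<close>

lemma e_up_down:
  assumes b: "b \<in> Basis"
  shows "e k (up b h x) + e k (down b h x) = 2 * cos (\<omega> b * real (k b) * h) * e k x"
proof -
  let ?w = "\<omega> b * real (k b)" and ?t = "x \<bullet> b"
  have "?w * (2 * pi / \<omega> b - h - ?t) = - (?w * (?t + h)) + real (k b) * (2 * pi)"
    using \<omega>_pos[OF b] by (simp add: field_simps)
  then have "cos (?w * (2 * pi / \<omega> b - h - ?t)) = cos (?w * (?t + h))"
    using cos.plus_of_nat[of "- (?w * (?t + h))" "k b"] by (simp only: cos_minus of_real_eq_id id_apply)
  then have 1: "cos (?w * (min (?t + h) (2 * pi / \<omega> b - h - ?t))) = cos (?w * (?t + h))"
    unfolding min_def by (simp split: if_split)
  have "\<bar>?t - h\<bar> = ?t - h \<or> \<bar>?t - h\<bar> = - (?t - h)" by linarith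
  then have 2: "cos (?w * \<bar>?t - h\<bar>) = cos (?w * (?t - h))"
    by (elim disjE) (simp_all only: mult_minus_right cos_minus)
  have 3: "cos (?w * (?t + h)) + cos (?w * (?t - h)) = 2 * cos (?w * h) * cos (?w * ?t)"
    by (simp add: distrib_left right_diff_distrib cos_add cos_diff)
  have "e k (up b h x) + e k (down b h x) = (cos (?w * (?t + h)) + cos (?w * (?t - h))) *
      (\<Prod>b'\<in>Basis - {b}. cos (\<omega> b' * real (k b') * (x \<bullet> b')))"
    unfolding up_def down_def e_shift[OF b] by (simp add: 1 2 distrib_right)
  also have "\<dots> = 2 * cos (?w * h) * e k (x + 0 *\<^sub>R b)"
    unfolding 3 e_shift[OF b] by simp
  finally show ?thesis by simp
qed

section \<open>Symmetry of the reflected walk\<close>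

definition slab :: "'a \<Rightarrow> real \<Rightarrow> real \<Rightarrow> 'a set" where
  "slab b s t = cbox (s *\<^sub>R b) (top_corner + (t - pi / \<omega> b) *\<^sub>R b)"

lemma mem_slab:
  assumes "b \<in> Basis"
  shows "x \<in> slab b s t \<longleftrightarrow> (\<forall>b'\<in>Basis - {b}. 0 \<le> x \<bullet> b' \<and> x \<bullet> b' \<le> pi / \<omega> b') \<and> s \<le> x \<bullet> b \<and> x \<bullet> b \<le> t"
  using assms by (auto simp: slab_def mem_box inner_add_left top_corner_inner inner_Basis)

lemma slab_split:
  assumes b: "b \<in> Basis" and c: "0 \<le> c" "c \<le> pi / \<omega> b" and f: "continuous_on Box (f :: 'a \<Rightarrow> real)"
  shows "integral Box f = integral (slab b 0 c) f + integral (slab b c (pi / \<omega> b)) f"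
proof -
  have "integral Box f = integral (Box \<inter> {x. x \<bullet> b \<le> c}) f + integral (Box \<inter> {x. x \<bullet> b \<ge> c}) f"
    unfolding Box_def by (rule integral_split[OF integrable_Box[OF f, unfolded Box_def] b])
  also have "Box \<inter> {x. x \<bullet> b \<le> c} = slab b 0 c"
    using b c by (force simp: mem_Box mem_slab)
  also have "Box \<inter> {x. x \<bullet> b \<ge> c} = slab b c (pi / \<omega> b)"
    using b c by (force simp: mem_Box mem_slab)
  finally show ?thesis .
qed

lemma slab_subset: "b \<in> Basis \<Longrightarrow> 0 \<le> s \<Longrightarrow> t \<le> pi / \<omega> b \<Longrightarrow> slab b s t \<subseteq> Box"
  by (force simp: mem_Box mem_slab)

lemma slab_shift:
  assumes b: "b \<in> Basis" and f: "continuous_on (slab b s t) (f :: 'a \<Rightarrow> real)"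
  shows "integral (slab b (s - h) (t - h)) (\<lambda>x. f (x + h *\<^sub>R b)) = integral (slab b s t) f"
proof -
  have "(f has_integral integral (slab b s t) f) (slab b s t)"
    using f unfolding slab_def by (intro integrable_integral integrable_continuous)
  from has_integral_shift_cbox[OF this[unfolded slab_def], of "h *\<^sub>R b"]
  show ?thesis
    unfolding slab_def by (intro integral_unique) (simp add: algebra_simps)
qed

lemma slab_reflect:
  assumes b: "b \<in> Basis" and f: "continuous_on (slab b s t) (f :: 'a \<Rightarrow> real)"
  shows "integral (slab b s t) (\<lambda>x. f (x + (s + t - 2 * (x \<bullet> b)) *\<^sub>R b)) = integral (slab b s t) f"
proof -
  let ?l = "s *\<^sub>R b" and ?u = "top_corner + (t - pi / \<omega> b) *\<^sub>R b"
  have "(f has_integral integral (slab b s t) f) (slab b s t)"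
    using f unfolding slab_def by (intro integrable_integral integrable_continuous)
  from has_integral_reflect_coords[OF this[unfolded slab_def], of "{b}"]
  have "((\<lambda>x. f (reflect_coords {b} ?l ?u x)) has_integral integral (slab b s t) f) (slab b s t)"
    unfolding slab_def .
  moreover have "reflect_coords {b} ?l ?u x = x + (s + t - 2 * (x \<bullet> b)) *\<^sub>R b" for x
  proof (rule euclidean_eqI)
    fix k :: 'a assume k: "k \<in> Basis"
    show "reflect_coords {b} ?l ?u x \<bullet> k = (x + (s + t - 2 * (x \<bullet> b)) *\<^sub>R b) \<bullet> k"
      unfolding inner_reflect_coords[OF k] inner_add_left inner_scaleR_left
      using b k by (cases "k = b") (simp_all add: top_corner_inner inner_not_same_Basis)
  qed
  ultimately show ?thesis by (simp add: integral_unique)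
qed

text \<open>Away from the faces \<open>up\<close> and \<open>down\<close> are mutually inverse
  translations. In the layer of width h at a face, the step towards that face reflects the layer in
  its middle, an involution. All these maps preserve volume, so each piece of one integral equals a
  piece of the other.\<close>

lemma walk_symmetric:
  fixes f g :: "'a \<Rightarrow> real"
  assumes b: "b \<in> Basis" and h: "0 \<le> h" "h \<le> pi / \<omega> b"
    and f: "continuous_on Box f" and g: "continuous_on Box g"
  shows "integral Box (\<lambda>x. f x * (g (up b h x) + g (down b h x)))
       = integral Box (\<lambda>x. g x * (f (up b h x) + f (down b h x)))"
proof -
  let ?L = "pi / \<omega> b"
  have cu: "continuous_on Box (\<lambda>x. f (up b h x))" if "continuous_on Box f" for f :: "'a \<Rightarrow> real"
    by (rule continuous_on_compose2[OF that continuous_on_up]) (use up_in_Box[OF b h] in auto)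
  have cd: "continuous_on Box (\<lambda>x. f (down b h x))" if "continuous_on Box f" for f :: "'a \<Rightarrow> real"
    by (rule continuous_on_compose2[OF that continuous_on_down]) (use down_in_Box[OF b h] in auto)
  have split: "integral Box (\<lambda>x. f x * (g (up b h x) + g (down b h x))) =
      integral (slab b 0 (?L - h)) (\<lambda>x. f x * g (up b h x)) + integral (slab b (?L - h) ?L) (\<lambda>x. f x * g (up b h x))
    + (integral (slab b 0 h) (\<lambda>x. f x * g (down b h x)) + integral (slab b h ?L) (\<lambda>x. f x * g (down b h x)))"
    if f: "continuous_on Box f" and g: "continuous_on Box g" for f g :: "'a \<Rightarrow> real"
  proof -
    have "integral Box (\<lambda>x. f x * (g (up b h x) + g (down b h x))) =
        integral Box (\<lambda>x. f x * g (up b h x)) + integral Box (\<lambda>x. f x * g (down b h x))"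
      unfolding distrib_left
      by (intro integral_add integrable_Box continuous_intros f cu cd g)
    then show ?thesis
      using slab_split[OF b, of "?L - h" "\<lambda>x. f x * g (up b h x)"] slab_split[OF b h, of "\<lambda>x. f x * g (down b h x)"] h
      by (simp add: continuous_intros f cu cd g)
  qed
  have tr: "integral (slab b 0 (?L - h)) (\<lambda>x. f x * g (up b h x)) = integral (slab b h ?L) (\<lambda>x. g x * f (down b h x))"
    if f: "continuous_on Box f" and g: "continuous_on Box g" for f g :: "'a \<Rightarrow> real"
  proof -
    have A: "integral (slab b (h - h) (?L - h)) (\<lambda>x. g (x + h *\<^sub>R b) * f (down b h (x + h *\<^sub>R b)))
        = integral (slab b h ?L) (\<lambda>x. g x * f (down b h x))"
      by (rule slab_shift[OF b]) (use h slab_subset[OF b] in \<open>auto intro!: continuous_intros continuous_on_subset[OF cd[OF f]] continuous_on_subset[OF g]\<close>)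
    have eq: "g (x + h *\<^sub>R b) * f (down b h (x + h *\<^sub>R b)) = f x * g (up b h x)" if "x \<in> slab b (h - h) (?L - h)" for x
    proof -
      have "min (x \<bullet> b + h) (2 * pi / \<omega> b - h - x \<bullet> b) = x \<bullet> b + h"
        using that b by (auto simp: mem_slab)
      then have "up b h x = x + h *\<^sub>R b" by (simp add: up_def)
      moreover have "down b h (x + h *\<^sub>R b) = x"
        using that b by (simp add: down_def mem_slab inner_add_left algebra_simps)
      ultimately show ?thesis by (simp add: mult.commute)
    qed
    have "integral (slab b 0 (?L - h)) (\<lambda>x. f x * g (up b h x)) =
        integral (slab b 0 (?L - h)) (\<lambda>x. g (x + h *\<^sub>R b) * f (down b h (x + h *\<^sub>R b)))"
      by (rule integral_cong) (rule eq[symmetric], simp)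
    then show ?thesis using A by simp
  qed
  have r1: "integral (slab b (?L - h) ?L) (\<lambda>x. f x * g (up b h x)) = integral (slab b (?L - h) ?L) (\<lambda>x. g x * f (up b h x))"
  proof -
    let ?S = "slab b (?L - h) ?L" and ?r = "\<lambda>x. x + (?L - h + ?L - 2 * (x \<bullet> b)) *\<^sub>R b"
    have A: "integral ?S (\<lambda>x. g (?r x) * f (up b h (?r x))) = integral ?S (\<lambda>x. g x * f (up b h x))"
      by (rule slab_reflect[OF b, of "?L - h" ?L "\<lambda>x. g x * f (up b h x)"])
         (use h slab_subset[OF b, of "?L - h" ?L] in \<open>auto intro!: continuous_intros continuous_on_subset[OF cu[OF f]] continuous_on_subset[OF g]\<close>)
    have eq: "g (?r x) * f (up b h (?r x)) = f x * g (up b h x)" if "x \<in> ?S" for x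
    proof -
      have "min (x \<bullet> b + h) (2 * pi / \<omega> b - h - x \<bullet> b) = 2 * pi / \<omega> b - h - x \<bullet> b"
        using that b by (auto simp: mem_slab)
      then have 1: "up b h x = ?r x" by (simp add: up_def algebra_simps)
      have rb: "?r x \<bullet> b = 2 * pi / \<omega> b - h - x \<bullet> b"
        using b by (simp add: inner_add_left)
      have "min (?r x \<bullet> b + h) (2 * pi / \<omega> b - h - ?r x \<bullet> b) = x \<bullet> b"
        unfolding rb using that b by (auto simp: mem_slab)
      then have "up b h (?r x) = x"
        unfolding up_def rb unfolding add.assoc scaleR_left_distrib[symmetric] by simp
      then show ?thesis using 1 by (simp add: mult.commute)
    qed
    have "integral ?S (\<lambda>x. f x * g (up b h x)) = integral ?S (\<lambda>x. g (?r x) * f (up b h (?r x)))"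
      by (rule integral_cong) (rule eq[symmetric])
    then show ?thesis using A by (rule trans)
  qed
  have r2: "integral (slab b 0 h) (\<lambda>x. f x * g (down b h x)) = integral (slab b 0 h) (\<lambda>x. g x * f (down b h x))"
  proof -
    let ?S = "slab b 0 h" and ?r = "\<lambda>x. x + (0 + h - 2 * (x \<bullet> b)) *\<^sub>R b"
    have A: "integral ?S (\<lambda>x. g (?r x) * f (down b h (?r x))) = integral ?S (\<lambda>x. g x * f (down b h x))"
      by (rule slab_reflect[OF b, of 0 h "\<lambda>x. g x * f (down b h x)"])
         (use h slab_subset[OF b] in \<open>auto intro!: continuous_intros continuous_on_subset[OF cd[OF f]] continuous_on_subset[OF g]\<close>)
    have eq: "g (?r x) * f (down b h (?r x)) = f x * g (down b h x)" if "x \<in> ?S" for x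
    proof -
      have xb: "0 \<le> x \<bullet> b" "x \<bullet> b \<le> h" using that b by (auto simp: mem_slab)
      then have 1: "down b h x = ?r x" by (simp add: down_def algebra_simps)
      have rb: "?r x \<bullet> b = h - x \<bullet> b"
        using b by (simp add: inner_add_left)
      have "down b h (?r x) = x"
        unfolding down_def rb using xb unfolding add.assoc scaleR_left_distrib[symmetric] by simp
      then show ?thesis using 1 by (simp add: mult.commute)
    qed
    have "integral ?S (\<lambda>x. f x * g (down b h x)) = integral ?S (\<lambda>x. g (?r x) * f (down b h (?r x)))"
      by (rule integral_cong) (rule eq[symmetric])
    then show ?thesis using A by (rule trans)
  qed
  show ?thesis
    unfolding split[OF f g] split[OF g f] using tr[OF f g] tr[OF g f] r1 r2 by linarith
qed

section \<open>The inner product and orthogonality of the cosine products\<close>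

lemma ip_commute: "ip f g = ip g f"
  by (simp add: ip_def mult.commute)

lemma ip_cong: "(\<And>x. x \<in> Box \<Longrightarrow> f x = f' x) \<Longrightarrow> (\<And>x. x \<in> Box \<Longrightarrow> g x = g' x) \<Longrightarrow> ip f g = ip f' g'"
  unfolding ip_def by (rule integral_cong) auto

lemma ip_add_right:
  assumes "continuous_on Box f" "continuous_on Box g" "continuous_on Box h"
  shows "ip f (\<lambda>x. g x + h x) = ip f g + ip f h"
  unfolding ip_def distrib_left
  by (intro integral_add integrable_Box continuous_intros assms)

lemma ip_diff_right:
  assumes "continuous_on Box f" "continuous_on Box g" "continuous_on Box h"
  shows "ip f (\<lambda>x. g x - h x) = ip f g - ip f h"
  unfolding ip_def right_diff_distrib
  by (intro integral_diff integrable_Box continuous_intros assms)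

lemma ip_scale_right: "ip f (\<lambda>x. c * g x) = c * ip f g"
  unfolding ip_def by (subst integral_mult_right[symmetric]) (simp add: mult.left_commute)

lemma ip_sum_right:
  assumes "finite K" "continuous_on Box f" "\<And>k. k \<in> K \<Longrightarrow> continuous_on Box (g k)"
  shows "ip f (\<lambda>x. \<Sum>k\<in>K. c k * g k x) = (\<Sum>k\<in>K. c k * ip f (g k))"
  using assms(1,3)
proof (induction K)
  case (insert k K)
  have "ip f (\<lambda>x. c k * g k x + (\<Sum>k\<in>K. c k * g k x)) = ip f (\<lambda>x. c k * g k x) + ip f (\<lambda>x. \<Sum>k\<in>K. c k * g k x)"
    by (intro ip_add_right continuous_intros assms(2) insert.prems) auto
  then show ?case using insert by (simp add: ip_scale_right)
qed (simp add: ip_def)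

lemma ip_self_nonneg: "continuous_on Box f \<Longrightarrow> ip f f \<ge> 0"
  unfolding ip_def by (intro integral_nonneg integrable_Box continuous_intros) auto

lemma box_nonempty: "box 0 top_corner \<noteq> {}"
  using \<omega>_pos by (auto simp: box_ne_empty top_corner_inner)

lemma ip_self_eq_0:
  assumes f: "continuous_on Box f" and "ip f f = 0" and "x \<in> Box"
  shows "f x = 0"
proof -
  have "integral (cbox 0 top_corner) (\<lambda>x. f x * f x) = 0 \<longleftrightarrow> (\<forall>x\<in>cbox 0 top_corner. f x * f x = 0)"
    by (rule integral_cbox_eq_0_iff)
       (use box_nonempty f in \<open>auto simp: Box_def intro!: continuous_intros\<close>)
  then show ?thesis using assms by (auto simp: ip_def Box_def)
qed

lemma zero_in_Box: "0 \<in> Box"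
  using \<omega>_pos by (auto simp: mem_Box intro: less_imp_le)

lemma ip_e_self_pos: "ip (e k) (e k) > 0"
proof -
  have "ip (e k) (e k) \<noteq> 0"
    using ip_self_eq_0[of "e k" 0] zero_in_Box by (auto simp: continuous_on_e) (simp add: e_def)
  then show ?thesis using ip_self_nonneg[of "e k"] by (simp add: continuous_on_e order_less_le)
qed

lemma ip_walk_e:
  assumes b: "b \<in> Basis"
  shows "ip f (\<lambda>x. e k (up b h x) + e k (down b h x)) = 2 * cos (\<omega> b * real (k b) * h) * ip f (e k)"
  unfolding e_up_down[OF b] by (rule ip_scale_right)

text \<open>Eigenfunctions of a symmetric operator with different eigenvalues are orthogonal; the
  operator is the walk in a direction where the two indices differ.\<close>

lemma ip_e_orthogonal:
  assumes k: "k \<in> Idx" "k' \<in> Idx" "k \<noteq> k'"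
  shows "ip (e k) (e k') = 0"
proof -
  obtain b where b: "b \<in> Basis" "k b \<noteq> k' b"
    using k unfolding Idx_def by (auto simp: fun_eq_iff) metis
  define M where "M = max (k b) (k' b)"
  \<comment> \<open>With this step both angles are multiples k pi / M with k at most M, hence lie in
    [0, pi], where cosine is injective.\<close>
  define h where "h = pi / (\<omega> b * real M)"
  have M: "M \<ge> 1" using b unfolding M_def by auto
  have wM: "\<omega> b * real M > 0" using \<omega>_pos[OF b(1)] M by simp
  have h: "0 \<le> h" "h \<le> pi / \<omega> b"
    using \<omega>_pos[OF b(1)] M unfolding h_def by (auto simp: field_simps intro: less_imp_le)
  have rng: "0 \<le> \<omega> b * real j * h \<and> \<omega> b * real j * h \<le> pi" if "j \<le> M" for j
  proof -
    have "\<omega> b * real j * h = pi * (real j / real M)"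
      unfolding h_def using \<omega>_pos[OF b(1)] by simp
    moreover have "real j / real M \<le> 1" using that M by simp
    ultimately show ?thesis using mult_left_mono[of "real j / real M" 1 pi] by simp
  qed
  have "h > 0" unfolding h_def by (intro divide_pos_pos pi_gt_zero wM)
  then have "\<omega> b * real (k b) * h \<noteq> \<omega> b * real (k' b) * h"
    using b(2) \<omega>_pos[OF b(1)] by simp
  then have ne: "cos (\<omega> b * real (k b) * h) \<noteq> cos (\<omega> b * real (k' b) * h)"
    using cos_inj_pi[of "\<omega> b * real (k b) * h" "\<omega> b * real (k' b) * h"] rng[of "k b"] rng[of "k' b"]
    unfolding M_def by (metis max.cobounded1 max.cobounded2)
  have "ip (e k) (\<lambda>x. e k' (up b h x) + e k' (down b h x)) = ip (e k') (\<lambda>x. e k (up b h x) + e k (down b h x))"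
    unfolding ip_def by (rule walk_symmetric[OF b(1) h]) (auto intro: continuous_on_e)
  then have "cos (\<omega> b * real (k' b) * h) * ip (e k) (e k') = cos (\<omega> b * real (k b) * h) * ip (e k) (e k')"
    unfolding ip_walk_e[OF b(1)] by (simp add: ip_commute)
  then show ?thesis using ne by simp
qed

section \<open>Trigonometric polynomials, their density, and Parseval's identity\<close>

definition trig :: "('a \<Rightarrow> real) set" where
  "trig = {f. \<exists>K c. finite K \<and> K \<subseteq> Idx \<and> f = (\<lambda>x. \<Sum>k\<in>K. c k * e k x)}"

lemma trig_e: "k \<in> Idx \<Longrightarrow> (\<lambda>x. c * e k x) \<in> trig"
  unfolding trig_def by (intro CollectI exI[of _ "{k}"] exI[of _ "\<lambda>_. c"]) auto

lemma trig_add: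
  assumes "f \<in> trig" "g \<in> trig"
  shows "(\<lambda>x. f x + g x) \<in> trig"
proof -
  obtain K c where K: "finite K" "K \<subseteq> Idx" "f = (\<lambda>x. \<Sum>k\<in>K. c k * e k x)"
    using assms(1) unfolding trig_def by auto
  obtain L d where L: "finite L" "L \<subseteq> Idx" "g = (\<lambda>x. \<Sum>k\<in>L. d k * e k x)"
    using assms(2) unfolding trig_def by auto
  have "(\<Sum>k\<in>K \<union> L. ((if k \<in> K then c k else 0) + (if k \<in> L then d k else 0)) * e k x) =
     (\<Sum>k\<in>K. c k * e k x) + (\<Sum>k\<in>L. d k * e k x)" for x
  proof -
    have "(\<Sum>k\<in>K \<union> L. (if k \<in> K then c k else 0) * e k x) = (\<Sum>k\<in>K. c k * e k x)"
      using K L by (intro sum.mono_neutral_cong_right) auto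
    moreover have "(\<Sum>k\<in>K \<union> L. (if k \<in> L then d k else 0) * e k x) = (\<Sum>k\<in>L. d k * e k x)"
      using K L by (intro sum.mono_neutral_cong_right) auto
    ultimately show ?thesis by (simp add: distrib_right sum.distrib)
  qed
  then show ?thesis
    using K L unfolding trig_def
    by (intro CollectI exI[of _ "K \<union> L"] exI[of _ "\<lambda>k. (if k \<in> K then c k else 0) + (if k \<in> L then d k else 0)"]) auto
qed

lemma trig_sum: "finite A \<Longrightarrow> (\<And>a. a \<in> A \<Longrightarrow> f a \<in> trig) \<Longrightarrow> (\<lambda>x. \<Sum>a\<in>A. f a x) \<in> trig"
proof (induction A rule: finite_induct)
  case empty
  show ?case unfolding trig_def by (intro CollectI exI[of _ "{}"]) auto
next
  case (insert a A)
  then show ?case using trig_add[of "f a" "\<lambda>x. \<Sum>a\<in>A. f a x"] by simp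
qed

text \<open>Product to sum. As cosine is even, the difference of the frequencies may be replaced by
  its absolute value, which keeps the indices in the naturals and makes \<open>trig\<close> an
  algebra.\<close>

lemma e_times_cos:
  assumes b: "b \<in> Basis"
  shows "e k x * cos (\<omega> b * real m * (x \<bullet> b)) =
    (1/2) * e (k(b := k b + m)) x + (1/2) * e (k(b := nat \<bar>int (k b) - int m\<bar>)) x"
proof -
  let ?t = "\<omega> b * (x \<bullet> b)" and ?R = "\<Prod>b'\<in>Basis - {b}. cos (\<omega> b' * real (k b') * (x \<bullet> b'))"
  have R: "e (k(b := j)) x = cos (real j * ?t) * ?R" for j
  proof -
    have "(\<Prod>b'\<in>Basis - {b}. cos (\<omega> b' * real ((k(b := j)) b') * (x \<bullet> b'))) = ?R"
      by (rule prod.cong) auto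
    then show ?thesis using e_shift[OF b, of "k(b := j)" x 0] by (simp add: mult_ac)
  qed
  have c1: "cos (real (nat \<bar>int (k b) - int m\<bar>) * ?t) = cos ((real (k b) - real m) * ?t)"
  proof (cases "k b \<ge> m")
    case True
    then show ?thesis by (simp add: nat_diff_distrib of_nat_diff)
  next
    case False
    then have "real (nat \<bar>int (k b) - int m\<bar>) = - (real (k b) - real m)" by simp
    then show ?thesis by (metis cos_minus mult_minus_left)
  qed
  have c2: "cos ((real (k b) + real m) * ?t) + cos ((real (k b) - real m) * ?t) = 2 * (cos (real (k b) * ?t) * cos (real m * ?t))"
    by (simp add: distrib_right left_diff_distrib cos_add cos_diff)
  have "(1/2) * e (k(b := k b + m)) x + (1/2) * e (k(b := nat \<bar>int (k b) - int m\<bar>)) x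
     = (1/2) * (cos (real (k b + m) * ?t) + cos (real (nat \<bar>int (k b) - int m\<bar>) * ?t)) * ?R"
    unfolding R by (simp only: distrib_left distrib_right mult.assoc)
  also have "\<dots> = cos (real (k b) * ?t) * cos (real m * ?t) * ?R"
    unfolding c1 of_nat_add c2 by simp
  also have "\<dots> = e (k(b := k b)) x * cos (real m * ?t)" unfolding R by simp
  finally show ?thesis by (simp add: mult_ac)
qed

lemma trig_times_cos:
  assumes "f \<in> trig" and b: "b \<in> Basis"
  shows "(\<lambda>x. f x * cos (\<omega> b * real m * (x \<bullet> b))) \<in> trig"
proof -
  obtain K c where K: "finite K" "K \<subseteq> Idx" "f = (\<lambda>x. \<Sum>k\<in>K. c k * e k x)"
    using assms(1) unfolding trig_def by auto
  have "(\<lambda>x. c k * (e k x * cos (\<omega> b * real m * (x \<bullet> b)))) \<in> trig" if "k \<in> Idx" for k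
  proof -
    have "(\<lambda>x. (c k * (1/2)) * e (k(b := k b + m)) x + (c k * (1/2)) * e (k(b := nat \<bar>int (k b) - int m\<bar>)) x) \<in> trig"
      by (intro trig_add trig_e) (use that b in \<open>auto simp: Idx_def\<close>)
    then show ?thesis unfolding e_times_cos[OF b] by (simp add: distrib_left)
  qed
  then have "(\<lambda>x. \<Sum>k\<in>K. c k * (e k x * cos (\<omega> b * real m * (x \<bullet> b)))) \<in> trig"
    using K by (intro trig_sum) auto
  then show ?thesis unfolding K(3) by (simp add: sum_distrib_right mult.assoc)
qed

lemma trig_times_e:
  assumes "f \<in> trig"
  shows "(\<lambda>x. f x * e k x) \<in> trig"
proof -
  have "(\<lambda>x. f x * (\<Prod>b\<in>A. cos (\<omega> b * real (k b) * (x \<bullet> b)))) \<in> trig" if "finite A" "A \<subseteq> Basis" for A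
    using that
  proof (induction A rule: finite_induct)
    case (insert b A)
    then show ?case
      using trig_times_cos[of "\<lambda>x. f x * (\<Prod>b\<in>A. cos (\<omega> b * real (k b) * (x \<bullet> b)))" b "k b"]
      by (simp add: mult_ac)
  qed (use assms in auto)
  from this[of Basis] show ?thesis unfolding e_def by auto
qed

lemma trig_mult:
  assumes "f \<in> trig" "g \<in> trig"
  shows "(\<lambda>x. f x * g x) \<in> trig"
proof -
  obtain L d where L: "finite L" "L \<subseteq> Idx" "g = (\<lambda>x. \<Sum>k\<in>L. d k * e k x)"
    using assms(2) unfolding trig_def by auto
  have "(\<lambda>x. d k * f x) \<in> trig" for k
  proof -
    obtain K c where K: "finite K" "K \<subseteq> Idx" "f = (\<lambda>x. \<Sum>k\<in>K. c k * e k x)"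
      using assms(1) unfolding trig_def by auto
    have "(\<lambda>x. \<Sum>j\<in>K. (d k * c j) * e j x) \<in> trig"
      using K by (intro trig_sum trig_e) auto
    then show ?thesis unfolding K(3) by (simp add: sum_distrib_left mult.assoc)
  qed
  then have "(\<lambda>x. \<Sum>k\<in>L. (d k * f x) * e k x) \<in> trig"
    using L by (intro trig_sum trig_times_e) auto
  then show ?thesis unfolding L(3) by (simp add: sum_distrib_left mult_ac)
qed

lemma trig_continuous: "f \<in> trig \<Longrightarrow> continuous_on S f"
  unfolding trig_def by (auto intro!: continuous_intros)

lemma trig_dense:
  assumes f: "continuous_on Box f" and "\<delta> > 0"
  obtains g where "g \<in> trig" "\<And>x. x \<in> Box \<Longrightarrow> \<bar>f x - g x\<bar> < \<delta>"
proof -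
  have "\<exists>g. g \<in> trig \<and> (\<forall>x\<in>Box. \<bar>f x - g x\<bar> < \<delta>)"
  proof (rule Stone_Weierstrass_HOL[OF compact_Box _ trig_continuous])
    show "(\<lambda>x. c) \<in> trig" for c
      using trig_e[of "\<lambda>_. 0" c] by (simp add: Idx_def e_def)
    fix x y assume xy: "x \<in> Box \<and> y \<in> Box \<and> x \<noteq> y"
    then obtain b where b: "b \<in> Basis" "x \<bullet> b \<noteq> y \<bullet> b"
      by (metis euclidean_eqI)
    \<comment> \<open>Frequency 1 in direction \<open>b\<close> alone: this cosine is injective in
      the coordinate along \<open>b\<close>, over the range [0, pi / \<omega> b], and thus separates
      \<open>x\<close> from \<open>y\<close>.\<close>
    define k where "k = (\<lambda>b'. if b' = b then 1 else (0::nat))"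
    have ek: "e k z = cos (\<omega> b * (z \<bullet> b))" for z
      unfolding e_def using b(1) by (subst prod.remove[of _ b]) (auto simp: k_def intro!: prod.neutral)
    have rng: "0 \<le> \<omega> b * (z \<bullet> b) \<and> \<omega> b * (z \<bullet> b) \<le> pi" if "z \<in> Box" for z
      using that b(1) \<omega>_pos[OF b(1)] by (auto simp: mem_Box field_simps)
    have "e k x \<noteq> e k y"
      unfolding ek using cos_inj_pi[of "\<omega> b * (x \<bullet> b)" "\<omega> b * (y \<bullet> b)"] rng xy b \<omega>_pos[OF b(1)] by auto
    moreover have "e k \<in> trig" using trig_e[of k 1] b(1) by (auto simp: k_def Idx_def)
    ultimately show "\<exists>f. f \<in> trig \<and> f x \<noteq> f y" by blast
  qed (use assms in \<open>auto intro: trig_add trig_mult\<close>)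
  then show ?thesis using that by blast
qed

text \<open>The squared norm of the orthogonal projection of \<open>f\<close> onto
  \<open>e k\<close>; the \<open>e k\<close> are not normalized.\<close>

definition coeff_sq :: "('a \<Rightarrow> real) \<Rightarrow> ('a \<Rightarrow> nat) \<Rightarrow> real" where "coeff_sq f k = (ip f (e k))\<^sup>2 / ip (e k) (e k)"

lemma ip_trig_self:
  assumes "finite K" "K \<subseteq> Idx"
  shows "ip (\<lambda>x. \<Sum>k\<in>K. c k * e k x) (\<lambda>x. \<Sum>k\<in>K. d k * e k x) = (\<Sum>k\<in>K. c k * d k * ip (e k) (e k))"
proof -
  have "ip (\<lambda>x. \<Sum>k\<in>K. c k * e k x) (\<lambda>x. \<Sum>k\<in>K. d k * e k x) =
     (\<Sum>k\<in>K. d k * (\<Sum>j\<in>K. c j * ip (e j) (e k)))"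
  proof -
    have "ip (\<lambda>x. \<Sum>j\<in>K. c j * e j x) (e k) = (\<Sum>j\<in>K. c j * ip (e j) (e k))" for k
    proof -
      have "ip (e k) (\<lambda>x. \<Sum>j\<in>K. c j * e j x) = (\<Sum>j\<in>K. c j * ip (e k) (e j))"
        by (rule ip_sum_right[OF assms(1) continuous_on_e continuous_on_e])
      then show ?thesis unfolding ip_commute[of "e k"] .
    qed
    moreover have "continuous_on Box (\<lambda>x. \<Sum>k\<in>K. c k * e k x)" by (intro continuous_intros)
    ultimately show ?thesis
      by (simp only: ip_sum_right[OF assms(1) _ continuous_on_e])
  qed
  also have "\<dots> = (\<Sum>k\<in>K. d k * (\<Sum>j\<in>K. if j = k then c k * ip (e k) (e k) else 0))"
    by (intro sum.cong refl arg_cong2[where f="(*)"]) (use assms ip_e_orthogonal in \<open>auto\<close>)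
  finally show ?thesis using assms(1) by (simp add: sum.delta mult_ac)
qed

text \<open>The non-trivial half of Parseval's identity, with finite sums and an error instead of a
  series. A uniform approximation by a trigonometric polynomial is also one in mean square, and
  replacing its coefficients by those of \<open>f\<close> can only improve it.\<close>

lemma parseval_approx:
  assumes f: "continuous_on Box f" and "\<epsilon> > 0"
  obtains K where "finite K" "K \<subseteq> Idx" "ip f f \<le> (\<Sum>k\<in>K. coeff_sq f k) + \<epsilon>"
proof -
  define V where "V = integral Box (\<lambda>_. 1::real)"
  have "V \<ge> 0" unfolding V_def by (intro integral_nonneg integrable_Box) auto
  \<comment> \<open>\<delta> \<le> 1 gives \<delta>^2 \<le> \<delta>, so the mean square error is at
    most \<delta> V \<le> \<epsilon>.\<close>
  define \<delta> where "\<delta> = min 1 (\<epsilon> / (V + 1))"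
  have \<delta>: "\<delta> > 0" "\<delta> \<le> 1" "\<delta> * V \<le> \<epsilon>"
  proof -
    show "\<delta> > 0" "\<delta> \<le> 1" using \<open>\<epsilon> > 0\<close> \<open>V \<ge> 0\<close> unfolding \<delta>_def by auto
    have "\<delta> * V \<le> \<epsilon> / (V + 1) * (V + 1)"
      using \<open>V \<ge> 0\<close> \<open>\<epsilon> > 0\<close> by (intro mult_mono) (auto simp: \<delta>_def)
    then show "\<delta> * V \<le> \<epsilon>" using \<open>V \<ge> 0\<close> by simp
  qed
  obtain g where g: "g \<in> trig" "\<And>x. x \<in> Box \<Longrightarrow> \<bar>f x - g x\<bar> < \<delta>"
    using trig_dense[OF f \<open>\<delta> > 0\<close>] by blast
  obtain K c where K: "finite K" "K \<subseteq> Idx" "g = (\<lambda>x. \<Sum>k\<in>K. c k * e k x)"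
    using g(1) unfolding trig_def by auto
  have gc: "continuous_on Box g" using trig_continuous[OF g(1)] .
  let ?n = "\<lambda>k. ip (e k) (e k)"
  have "ip (\<lambda>x. f x - g x) (\<lambda>x. f x - g x) \<le> integral Box (\<lambda>x. \<delta> * 1)"
    unfolding ip_def
  proof (intro integral_le integrable_Box continuous_intros f gc)
    fix x assume x: "x \<in> Box"
    have "(f x - g x) * (f x - g x) = \<bar>f x - g x\<bar> * \<bar>f x - g x\<bar>" by simp
    also have "\<dots> \<le> \<delta> * 1" using g(2)[OF x] \<delta> by (intro mult_mono) auto
    finally show "(f x - g x) * (f x - g x) \<le> \<delta> * 1" .
  qed
  also have "\<dots> = \<delta> * V" unfolding V_def by (rule integral_mult_right)
  also have "\<dots> \<le> \<epsilon>" by (rule \<delta>(3))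
  finally have "ip (\<lambda>x. f x - g x) (\<lambda>x. f x - g x) \<le> \<epsilon>" .
  moreover have "ip (\<lambda>x. f x - g x) (\<lambda>x. f x - g x) = ip f f - 2 * ip f g + ip g g"
  proof -
    have "continuous_on Box (\<lambda>x. f x - g x)" by (intro continuous_intros f gc)
    from ip_diff_right[OF this f gc] ip_diff_right[OF f f gc] ip_diff_right[OF gc f gc]
    show ?thesis
      unfolding ip_commute[of "\<lambda>x. f x - g x" f] ip_commute[of "\<lambda>x. f x - g x" g] ip_commute[of g f] by linarith
  qed
  moreover have "2 * ip f g - ip g g \<le> (\<Sum>k\<in>K. coeff_sq f k)"
  proof -
    have "2 * ip f g - ip g g = (\<Sum>k\<in>K. 2 * (c k * ip f (e k)) - c k * c k * ?n k)"
      unfolding K(3) ip_trig_self[OF K(1,2)] ip_sum_right[OF K(1) f continuous_on_e]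
      by (simp add: sum_subtractf sum_distrib_left)
    also have "\<dots> \<le> (\<Sum>k\<in>K. coeff_sq f k)"
    proof (rule sum_mono)
      fix k
      \<comment> \<open>Completing the square in \<open>c k\<close>.\<close>
      have "0 \<le> (c k * ?n k - ip f (e k))\<^sup>2 / ?n k" using ip_e_self_pos[of k] by simp
      also have "\<dots> = coeff_sq f k - (2 * (c k * ip f (e k)) - c k * c k * ?n k)"
        unfolding coeff_sq_def using ip_e_self_pos[of k] by (simp add: field_simps power2_eq_square)
      finally show "2 * (c k * ip f (e k)) - c k * c k * ?n k \<le> coeff_sq f k" by simp
    qed
    finally show ?thesis .
  qed
  ultimately have "ip f f \<le> (\<Sum>k\<in>K. coeff_sq f k) + \<epsilon>" by linarith
  then show ?thesis using that K by blast
qed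

lemma eq_zero_of_coeffs_zero:
  assumes f: "continuous_on Box f" and "\<And>k. k \<in> Idx \<Longrightarrow> ip f (e k) = 0" and "x \<in> Box"
  shows "f x = 0"
proof (rule ip_self_eq_0[OF f _ \<open>x \<in> Box\<close>])
  have "ip f f \<le> 0 + \<epsilon>" if eps: "\<epsilon> > 0" for \<epsilon>
  proof -
    obtain K where K: "finite K" "K \<subseteq> Idx" "ip f f \<le> (\<Sum>k\<in>K. coeff_sq f k) + \<epsilon>"
      using parseval_approx[OF f eps] by blast
    moreover have "(\<Sum>k\<in>K. coeff_sq f k) = 0"
      using K assms(2) by (intro sum.neutral) (auto simp: coeff_sq_def)
    ultimately show ?thesis by simp
  qed
  then have "ip f f \<le> 0" by (rule field_le_epsilon)
  then show "ip f f = 0" using ip_self_nonneg[OF f] by simp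
qed

lemma eq_trig_of_coeffs:
  assumes f: "continuous_on Box f" and K: "finite K" "K \<subseteq> Idx"
    and z: "\<And>k. k \<in> Idx \<Longrightarrow> k \<notin> K \<Longrightarrow> ip f (e k) = 0" and "x \<in> Box"
  shows "f x = (\<Sum>k\<in>K. ip f (e k) / ip (e k) (e k) * e k x)"
proof -
  define p where "p x = (\<Sum>k\<in>K. ip f (e k) / ip (e k) (e k) * e k x)" for x
  have pc: "continuous_on Box p" unfolding p_def[abs_def] by (intro continuous_intros)
  have "f x - p x = 0"
  proof (rule eq_zero_of_coeffs_zero[OF _ _ \<open>x \<in> Box\<close>])
    show "continuous_on Box (\<lambda>x. f x - p x)" by (intro continuous_intros f pc)
    fix j assume j: "j \<in> Idx"
    have "ip (e j) p = (\<Sum>k\<in>K. ip f (e k) / ip (e k) (e k) * ip (e j) (e k))"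
      unfolding p_def by (rule ip_sum_right[OF K(1) continuous_on_e continuous_on_e])
    also have "\<dots> = (\<Sum>k\<in>K. if k = j then ip f (e j) else 0)"
      using K(2) j ip_e_orthogonal ip_e_self_pos[of j] by (intro sum.cong) auto
    also have "\<dots> = ip f (e j)" using K(1) z[OF j] by (simp add: sum.delta)
    finally have "ip (e j) p = ip f (e j)" .
    then show "ip (\<lambda>x. f x - p x) (e j) = 0"
      unfolding ip_commute[of _ "e j"] using ip_diff_right[OF continuous_on_e f pc, of j] by (simp add: ip_commute)
  qed
  then show ?thesis by (simp add: p_def)
qed

lemma finite_lam_le: "finite {k \<in> Idx. lam k \<le> r}"
proof -
  define N where "N b = nat \<lceil>sqrt (max r 0) / \<omega> b\<rceil>" for b
  define M where "M = Max (N ` Basis)"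
  have "{k \<in> Idx. lam k \<le> r} \<subseteq> {k. \<forall>x. (x \<in> Basis \<longrightarrow> k x \<in> {..M}) \<and> (x \<notin> Basis \<longrightarrow> k x = 0)}"
  proof (clarsimp simp: Idx_def)
    fix k :: "'a \<Rightarrow> nat" and b :: 'a assume "lam k \<le> r" and b: "b \<in> Basis"
    have "(\<omega> b * real (k b))\<^sup>2 \<le> lam k"
      unfolding lam_def using b by (intro member_le_sum) auto
    then have "(\<omega> b * real (k b))\<^sup>2 \<le> max r 0" using \<open>lam k \<le> r\<close> by simp
    then have "\<omega> b * real (k b) \<le> sqrt (max r 0)" by (rule real_le_rsqrt)
    then have "real (k b) \<le> sqrt (max r 0) / \<omega> b" using \<omega>_pos[OF b] by (simp add: field_simps)
    then have "k b \<le> N b" unfolding N_def by linarith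
    also have "N b \<le> M" unfolding M_def using b by (intro Max_ge) auto
    finally show "k b \<le> M" .
  qed
  then show ?thesis
    by (rule finite_subset) (intro finite_set_of_finite_funs, auto)
qed

end

section \<open>The Dirichlet form of the reflected walk\<close>

context cos_box
begin

definition step_energy :: "('a \<Rightarrow> 'a) \<Rightarrow> ('a \<Rightarrow> real) \<Rightarrow> ('a \<Rightarrow> real) \<Rightarrow> real" where
  "step_energy T f g = integral Box (\<lambda>x. (f (T x) - f x) * (g (T x) - g x))"

text \<open>A discrete substitute for \<open>\<integral> \<nabla>f \<bullet> \<nabla>g\<close>.\<close>

definition energy :: "real \<Rightarrow> ('a \<Rightarrow> real) \<Rightarrow> ('a \<Rightarrow> real) \<Rightarrow> real" where
  "energy h f g = (\<Sum>b\<in>Basis. (step_energy (up b h) f g + step_energy (down b h) f g) / (2 * h\<^sup>2))"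

text \<open>The eigenvalue of the discrete Neumann Laplacian of step h on
  \<open>e k\<close>.\<close>

definition walk_eig :: "real \<Rightarrow> ('a \<Rightarrow> nat) \<Rightarrow> real" where
  "walk_eig h k = (\<Sum>b\<in>Basis. (2 - 2 * cos (\<omega> b * real (k b) * h)) / h\<^sup>2)"

text \<open>A step of at most one side length stays in the box after a single reflection.\<close>

definition small :: "real \<Rightarrow> bool" where
  "small h \<longleftrightarrow> 0 < h \<and> (\<forall>b\<in>Basis. h \<le> pi / \<omega> b)"

lemma continuous_on_comp_up:
  "small h \<Longrightarrow> b \<in> Basis \<Longrightarrow> continuous_on Box f \<Longrightarrow> continuous_on Box (\<lambda>x. (f (up b h x) :: real))"
  by (rule continuous_on_compose2[OF _ continuous_on_up]) (auto simp: small_def intro!: up_in_Box)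

lemma continuous_on_comp_down:
  "small h \<Longrightarrow> b \<in> Basis \<Longrightarrow> continuous_on Box f \<Longrightarrow> continuous_on Box (\<lambda>x. (f (down b h x) :: real))"
  by (rule continuous_on_compose2[OF _ continuous_on_down]) (auto simp: small_def intro!: down_in_Box)

text \<open>Expand the product and use the symmetry of the walk twice: for f g against the constant
  1, which says that the walk preserves integrals, and for f against g, which merges the two mixed
  terms.\<close>

lemma step_energy_sum:
  assumes h: "small h" and b: "b \<in> Basis" and f: "continuous_on Box f" and g: "continuous_on Box g"
  shows "step_energy (up b h) f g + step_energy (down b h) f g
       = 4 * ip f g - 2 * ip f (\<lambda>x. g (up b h x) + g (down b h x))"
proof -
  note c = continuous_on_comp_up[OF h b] continuous_on_comp_down[OF h b]
  have hb: "0 \<le> h" "h \<le> pi / \<omega> b" using h b by (auto simp: small_def)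
  let ?A = "\<lambda>g x. g (up b h x) + g (down b h x)"
  have "step_energy (up b h) f g + step_energy (down b h) f g =
     integral Box (\<lambda>x. (1 * ?A (\<lambda>x. f x * g x) x + 2 * (f x * g x)) - (f x * ?A g x + g x * ?A f x))"
    unfolding step_energy_def
    by (subst integral_add[symmetric])
       (auto intro!: integrable_Box continuous_intros c f g integral_cong simp: algebra_simps)
  also have "\<dots> = (integral Box (\<lambda>x. 1 * ?A (\<lambda>x. f x * g x) x) + integral Box (\<lambda>x. 2 * (f x * g x)))
      - (integral Box (\<lambda>x. f x * ?A g x) + integral Box (\<lambda>x. g x * ?A f x))"
    by (subst integral_diff integral_add; (intro integrable_Box continuous_intros c f g)?)+ (rule refl)
  also have "integral Box (\<lambda>x. 1 * ?A (\<lambda>x. f x * g x) x) = integral Box (\<lambda>x. (f x * g x) * ?A (\<lambda>x. 1) x)"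
    by (rule walk_symmetric[OF b hb]) (intro continuous_intros f g)+
  also have "\<dots> = 2 * ip f g" unfolding ip_def by (subst integral_mult_right[symmetric]) (simp add: mult.commute)
  also have "integral Box (\<lambda>x. g x * ?A f x) = integral Box (\<lambda>x. f x * ?A g x)"
    by (rule walk_symmetric[OF b hb g f])
  also have "integral Box (\<lambda>x. 2 * (f x * g x)) = 2 * ip f g" unfolding ip_def by simp
  finally show ?thesis unfolding ip_def by simp
qed

lemma energy_e:
  assumes h: "small h" and f: "continuous_on Box f"
  shows "energy h f (e k) = walk_eig h k * ip f (e k)"
proof -
  have "energy h f (e k) = (\<Sum>b\<in>Basis. (2 - 2 * cos (\<omega> b * real (k b) * h)) / h\<^sup>2 * ip f (e k))"
    unfolding energy_def
  proof (rule sum.cong[OF refl])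
    fix b :: 'a assume b: "b \<in> Basis"
    show "(step_energy (up b h) f (e k) + step_energy (down b h) f (e k)) / (2 * h\<^sup>2)
        = (2 - 2 * cos (\<omega> b * real (k b) * h)) / h\<^sup>2 * ip f (e k)"
      unfolding step_energy_sum[OF h b f continuous_on_e] ip_walk_e[OF b]
      using h by (simp add: small_def field_simps)
  qed
  then show ?thesis by (simp add: walk_eig_def sum_distrib_right)
qed

lemma step_energy_scale: "step_energy T f (\<lambda>x. c * g x) = c * step_energy T f g"
  unfolding step_energy_def
  by (subst integral_mult_right[symmetric]) (simp add: right_diff_distrib mult_ac)

lemma step_energy_linear:
  assumes T: "T ` Box \<subseteq> Box" "continuous_on Box T" and c: "continuous_on Box f" "continuous_on Box g" "continuous_on Box g'"
  shows "step_energy T f (\<lambda>x. g x + g' x) = step_energy T f g + step_energy T f g'"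
    and "step_energy T (\<lambda>x. g x - g' x) f = step_energy T g f - step_energy T g' f"
proof -
  have cc: "continuous_on Box (\<lambda>x. u (T x))" if "continuous_on Box u" for u :: "'a \<Rightarrow> real"
    by (rule continuous_on_compose2[OF that T(2,1)])
  note i = integrable_Box continuous_intros cc c
  have "step_energy T f (\<lambda>x. g x + g' x) = integral Box (\<lambda>x. (f (T x) - f x) * (g (T x) - g x) + (f (T x) - f x) * (g' (T x) - g' x))"
    unfolding step_energy_def by (rule integral_cong) (simp add: algebra_simps)
  also have "\<dots> = step_energy T f g + step_energy T f g'"
    unfolding step_energy_def by (intro integral_add i)
  finally show "step_energy T f (\<lambda>x. g x + g' x) = step_energy T f g + step_energy T f g'" .
  have "step_energy T (\<lambda>x. g x - g' x) f = integral Box (\<lambda>x. (g (T x) - g x) * (f (T x) - f x) - (g' (T x) - g' x) * (f (T x) - f x))"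
    unfolding step_energy_def by (rule integral_cong) (simp add: algebra_simps)
  also have "\<dots> = step_energy T g f - step_energy T g' f"
    unfolding step_energy_def by (intro integral_diff i)
  finally show "step_energy T (\<lambda>x. g x - g' x) f = step_energy T g f - step_energy T g' f" .
qed

lemma step_energy_commute: "step_energy T f g = step_energy T g f"
  by (simp add: step_energy_def mult.commute)

lemma up_image: "small h \<Longrightarrow> b \<in> Basis \<Longrightarrow> up b h ` Box \<subseteq> Box"
  and down_image: "small h \<Longrightarrow> b \<in> Basis \<Longrightarrow> down b h ` Box \<subseteq> Box"
  using up_in_Box down_in_Box by (auto simp: small_def)

lemma energy_commute: "energy h f g = energy h g f"
  by (simp add: energy_def step_energy_commute)

lemma energy_add_right:
  assumes h: "small h" and c: "continuous_on Box f" "continuous_on Box g" "continuous_on Box g'"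
  shows "energy h f (\<lambda>x. g x + g' x) = energy h f g + energy h f g'"
  unfolding energy_def sum.distrib[symmetric]
  by (rule sum.cong[OF refl])
     (simp add: step_energy_linear(1)[OF up_image[OF h] continuous_on_up c] step_energy_linear(1)[OF down_image[OF h] continuous_on_down c]
       add_divide_distrib)

lemma energy_scale_right: "energy h f (\<lambda>x. c * g x) = c * energy h f g"
  unfolding energy_def step_energy_scale sum_distrib_left by (simp add: distrib_left)

lemma energy_diff_left:
  assumes h: "small h" and c: "continuous_on Box f" "continuous_on Box g" "continuous_on Box g'"
  shows "energy h (\<lambda>x. g x - g' x) f = energy h g f - energy h g' f"
  unfolding energy_def sum_subtractf[symmetric]
  by (rule sum.cong[OF refl])
     (simp add: step_energy_linear(2)[OF up_image[OF h] continuous_on_up c] step_energy_linear(2)[OF down_image[OF h] continuous_on_down c]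
       add_divide_distrib diff_divide_distrib)

lemma energy_trig:
  assumes h: "small h" and f: "continuous_on Box f" and K: "finite K"
  shows "energy h f (\<lambda>x. \<Sum>k\<in>K. c k * e k x) = (\<Sum>k\<in>K. c k * (walk_eig h k * ip f (e k)))"
  using K
proof (induction K)
  case empty
  show ?case by (simp add: energy_def step_energy_def)
next
  case (insert k K)
  have "energy h f (\<lambda>x. c k * e k x + (\<Sum>k\<in>K. c k * e k x)) = energy h f (\<lambda>x. c k * e k x) + energy h f (\<lambda>x. \<Sum>k\<in>K. c k * e k x)"
    by (intro energy_add_right[OF h f] continuous_intros)
  then show ?case using insert by (simp add: energy_scale_right energy_e[OF h f])
qed

lemma energy_self_nonneg:
  assumes h: "small h" and f: "continuous_on Box f"
  shows "energy h f f \<ge> 0"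
  unfolding energy_def step_energy_def
  by (intro sum_nonneg divide_nonneg_nonneg add_nonneg_nonneg integral_nonneg integrable_Box continuous_intros
      continuous_on_comp_up[OF h _ f] continuous_on_comp_down[OF h _ f] f) auto

text \<open>Bessel's inequality for the energy form: both forms are diagonal in the
  \<open>e k\<close>, so subtracting from \<open>f\<close> its projection onto the span of
  \<open>K\<close> removes exactly the sum on the left, and what remains is non-negative.\<close>

lemma bessel_energy:
  assumes h: "small h" and f: "continuous_on Box f" and K: "finite K" "K \<subseteq> Idx"
  shows "(\<Sum>k\<in>K. walk_eig h k * coeff_sq f k) \<le> energy h f f"
proof -
  define c where "c k = ip f (e k) / ip (e k) (e k)" for k
  define p where "p x = (\<Sum>k\<in>K. c k * e k x)" for x
  have pc: "continuous_on Box p" unfolding p_def[abs_def] by (intro continuous_intros)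
  have cn: "c k * ip (e k) (e k) = ip f (e k)" for k
    unfolding c_def using ip_e_self_pos[of k] by simp
  have pe: "ip p (e k) = ip f (e k)" if k: "k \<in> K" for k
  proof -
    have "ip (e k) p = (\<Sum>j\<in>K. c j * ip (e k) (e j))"
      unfolding p_def by (rule ip_sum_right[OF K(1) continuous_on_e continuous_on_e])
    also have "\<dots> = (\<Sum>j\<in>K. if j = k then ip f (e k) else 0)"
    proof (rule sum.cong[OF refl])
      fix j assume "j \<in> K"
      then show "c j * ip (e k) (e j) = (if j = k then ip f (e k) else 0)"
        using K(2) k ip_e_orthogonal[of k j] cn by (cases "j = k") auto
    qed
    finally show ?thesis using K k by (simp add: ip_commute)
  qed
  have fp: "energy h f p = (\<Sum>k\<in>K. walk_eig h k * coeff_sq f k)"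
    unfolding p_def energy_trig[OF h f K(1)]
    by (rule sum.cong) (auto simp: c_def coeff_sq_def power2_eq_square)
  have pp: "energy h p p = (\<Sum>k\<in>K. walk_eig h k * coeff_sq f k)"
  proof -
    have "energy h p p = (\<Sum>k\<in>K. c k * (walk_eig h k * ip p (e k)))"
      using energy_trig[OF h pc K(1), of c] unfolding p_def .
    also have "\<dots> = (\<Sum>k\<in>K. walk_eig h k * coeff_sq f k)"
      by (rule sum.cong) (auto simp: pe c_def coeff_sq_def power2_eq_square)
    finally show ?thesis .
  qed
  have dc: "continuous_on Box (\<lambda>x. f x - p x)" by (intro continuous_intros f pc)
  have "energy h (\<lambda>x. f x - p x) (\<lambda>x. f x - p x) = energy h f f - 2 * energy h f p + energy h p p"
    using energy_diff_left[OF h dc f pc] energy_diff_left[OF h f f pc] energy_diff_left[OF h pc f pc]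
    unfolding energy_commute[of h f "\<lambda>x. f x - p x"] energy_commute[of h p "\<lambda>x. f x - p x"] energy_commute[of h p f]
    by linarith
  then show ?thesis using energy_self_nonneg[OF h dc] fp pp by simp
qed

lemma walk_eig_tendsto: "((\<lambda>h. walk_eig h k) \<longlongrightarrow> lam k) (at_right 0)"
proof -
  have "((\<lambda>h::real. (2 - 2 * cos (c * h)) / h\<^sup>2) \<longlongrightarrow> c\<^sup>2) (at_right 0)" for c :: real
  proof -
    have s: "((\<lambda>h::real. sin (c / 2 * h) / h) \<longlongrightarrow> c / 2) (at 0)"
    proof -
      have "((\<lambda>h. sin (c / 2 * h)) has_real_derivative c / 2) (at 0)"
        by (auto intro!: derivative_eq_intros)
      then show ?thesis by (simp add: DERIV_def)
    qed
    \<comment> \<open>Half-angle formula: 2 - 2 cos (c h) = 4 sin^2 (c h / 2), so the derivative of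
      sine at 0 suffices.\<close>
    have "((\<lambda>h::real. 4 * (sin (c / 2 * h) / h)\<^sup>2) \<longlongrightarrow> 4 * (c / 2)\<^sup>2) (at_right 0)"
      by (intro tendsto_intros tendsto_mono[OF _ s] at_le) auto
    moreover have "4 * (sin (c / 2 * h) / h)\<^sup>2 = (2 - 2 * cos (c * h)) / h\<^sup>2" for h
    proof -
      have "cos (c * h) = 1 - 2 * (sin (c / 2 * h))\<^sup>2"
        using cos_double_sin[of "c / 2 * h"] by simp
      then show ?thesis by (simp add: power_divide)
    qed
    moreover have "4 * (c / 2)\<^sup>2 = c\<^sup>2" by (simp add: power_divide)
    ultimately show ?thesis by (simp only:)
  qed
  then show ?thesis unfolding walk_eig_def lam_def by (intro tendsto_sum)
qed

lemma lipschitz_e: "\<exists>C\<ge>0. \<forall>x\<in>Box. \<forall>y\<in>Box. \<bar>e k x - e k y\<bar> \<le> C * dist x y"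
proof -
  have "\<exists>C\<ge>0. \<forall>x y. \<bar>(\<Prod>b\<in>A. cos (\<omega> b * real (k b) * (x \<bullet> b))) - (\<Prod>b\<in>A. cos (\<omega> b * real (k b) * (y \<bullet> b)))\<bar> \<le> C * dist x y"
    if "finite A" "A \<subseteq> Basis" for A
    using that
  proof (induction A rule: finite_induct)
    case (insert b A)
    let ?P = "\<lambda>x. \<Prod>b\<in>A. cos (\<omega> b * real (k b) * (x \<bullet> b))" and ?w = "\<omega> b * real (k b)"
    obtain C where C: "C \<ge> 0" "\<And>x y. \<bar>?P x - ?P y\<bar> \<le> C * dist x y" using insert by auto
    have b: "b \<in> Basis" using insert by auto
    have "\<bar>cos (?w * (x \<bullet> b)) * ?P x - cos (?w * (y \<bullet> b)) * ?P y\<bar> \<le> (C + ?w) * dist x y" for x y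
    proof -
      have P1: "\<bar>?P y\<bar> \<le> 1" unfolding abs_prod by (intro prod_le_1) auto
      have "\<bar>cos (?w * (x \<bullet> b)) - cos (?w * (y \<bullet> b))\<bar> \<le> \<bar>?w * (x \<bullet> b) - ?w * (y \<bullet> b)\<bar>"
      proof -
        have "\<bar>cos s - cos t\<bar> \<le> \<bar>s - t\<bar>" for s t :: real
        proof -
          have "\<bar>cos s - cos t\<bar> = 2 * (\<bar>sin ((s + t) / 2)\<bar> * \<bar>sin ((t - s) / 2)\<bar>)"
            unfolding cos_diff_cos by (simp add: abs_mult)
          also have "\<dots> \<le> 2 * (1 * \<bar>(t - s) / 2\<bar>)"
            by (intro mult_left_mono mult_mono abs_sin_le_one abs_sin_x_le_abs_x) auto
          finally show ?thesis by simp
        qed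
        then show ?thesis .
      qed
      also have "\<dots> = ?w * \<bar>(x - y) \<bullet> b\<bar>"
        using \<omega>_pos[OF b] by (simp add: right_diff_distrib[symmetric] abs_mult inner_diff_left)
      also have "\<dots> \<le> ?w * dist x y"
        using \<omega>_pos[OF b] Basis_le_norm[OF b, of "x - y"] by (intro mult_left_mono) (auto simp: dist_norm)
      finally have 1: "\<bar>cos (?w * (x \<bullet> b)) - cos (?w * (y \<bullet> b))\<bar> \<le> ?w * dist x y" .
      have split: "cos (?w * (x \<bullet> b)) * ?P x - cos (?w * (y \<bullet> b)) * ?P y =
          cos (?w * (x \<bullet> b)) * (?P x - ?P y) + (cos (?w * (x \<bullet> b)) - cos (?w * (y \<bullet> b))) * ?P y"
        by (simp add: algebra_simps)
      have "\<bar>cos (?w * (x \<bullet> b)) * ?P x - cos (?w * (y \<bullet> b)) * ?P y\<bar> \<le> \<bar>cos (?w * (x \<bullet> b))\<bar> * \<bar>?P x - ?P y\<bar> + \<bar>cos (?w * (x \<bullet> b)) - cos (?w * (y \<bullet> b))\<bar> * \<bar>?P y\<bar>"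
        unfolding split by (rule order_trans[OF abs_triangle_ineq]) (simp add: abs_mult)
      also have "\<dots> \<le> 1 * (C * dist x y) + (?w * dist x y) * 1"
        by (intro add_mono mult_mono 1 C P1 abs_cos_le_one) (use C \<omega>_pos[OF b] in \<open>auto intro: mult_nonneg_nonneg less_imp_le\<close>)
      finally show ?thesis by (simp add: algebra_simps)
    qed
    moreover have "C + ?w \<ge> 0" using C \<omega>_pos[OF b] by auto
    ultimately show ?case using insert by (intro exI[of _ "C + ?w"]) auto
  qed (auto intro: exI[of _ 0])
  from this[of Basis] show ?thesis unfolding e_def by auto
qed

lemma lipschitz_trig:
  assumes "finite K"
  obtains C where "C \<ge> 0" "\<And>x y. x \<in> Box \<Longrightarrow> y \<in> Box \<Longrightarrow> \<bar>(\<Sum>k\<in>K. c k * e k x) - (\<Sum>k\<in>K. c k * e k y)\<bar> \<le> C * dist x y"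
proof -
  obtain L where L: "\<And>k. L k \<ge> 0" "\<And>k x y. x \<in> Box \<Longrightarrow> y \<in> Box \<Longrightarrow> \<bar>e k x - e k y\<bar> \<le> L k * dist x y"
    using lipschitz_e by metis
  show ?thesis
  proof (rule that)
    show "(\<Sum>k\<in>K. \<bar>c k\<bar> * L k) \<ge> 0" using L by (intro sum_nonneg) auto
    fix x y assume xy: "x \<in> Box" "y \<in> Box"
    have "\<bar>(\<Sum>k\<in>K. c k * e k x) - (\<Sum>k\<in>K. c k * e k y)\<bar> \<le> (\<Sum>k\<in>K. \<bar>c k * (e k x - e k y)\<bar>)"
      unfolding sum_subtractf[symmetric] right_diff_distrib[symmetric] by (rule sum_abs)
    also have "\<dots> \<le> (\<Sum>k\<in>K. \<bar>c k\<bar> * L k * dist x y)"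
      using L(2)[OF xy] by (intro sum_mono) (auto simp: abs_mult mult.assoc intro!: mult_left_mono)
    finally show "\<bar>(\<Sum>k\<in>K. c k * e k x) - (\<Sum>k\<in>K. c k * e k y)\<bar> \<le> (\<Sum>k\<in>K. \<bar>c k\<bar> * L k) * dist x y"
      by (simp add: sum_distrib_right)
  qed
qed

text \<open>Unique continuation. On the line from a point of \<open>S\<close> to \<open>y\<close>
  the sum extends to an entire function of one complex variable, and the identity theorem
  applies.\<close>

lemma trig_zero_on_open:
  assumes "finite K" and S: "open S" "S \<noteq> {}" and z: "\<And>x. x \<in> S \<Longrightarrow> (\<Sum>k\<in>K. c k * e k x) = 0"
  shows "(\<Sum>k\<in>K. c k * e k y) = 0"
proof -
  obtain x where x: "x \<in> S" using S by auto
  obtain r where r: "r > 0" "ball x r \<subseteq> S" using S(1) x open_contains_ball by blast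
  define g where "g t = (\<Sum>k\<in>K. of_real (c k) * (\<Prod>b\<in>Basis. cos (of_real (\<omega> b * real (k b)) * (of_real (x \<bullet> b) + t * of_real ((y - x) \<bullet> b)))))" for t :: complex
  have greal: "g (of_real t) = of_real (\<Sum>k\<in>K. c k * e k (x + t *\<^sub>R (y - x)))" for t :: real
    unfolding g_def e_def
    by (simp add: inner_add_left cos_of_real del: of_real_add of_real_mult flip: of_real_add of_real_mult of_real_prod of_real_sum)
  have hol: "g holomorphic_on UNIV"
    unfolding g_def[abs_def] by (intro holomorphic_intros)
  \<comment> \<open>Parameters of modulus below \<delta> stay in the ball around \<open>x\<close>;
    the 1 covers the case \<open>y = x\<close>.\<close>
  define \<delta> where "\<delta> = r / (norm (y - x) + 1)"
  have \<delta>: "\<delta> > 0" using r(1) unfolding \<delta>_def by (intro divide_pos_pos) (auto simp: add_nonneg_pos)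
  have g0: "g (of_real t) = 0" if "\<bar>t\<bar> < \<delta>" for t
  proof -
    have "\<bar>t\<bar> * norm (y - x) \<le> \<bar>t\<bar> * (norm (y - x) + 1)" by (intro mult_left_mono) auto
    also have "\<dots> < \<delta> * (norm (y - x) + 1)" using that by (intro mult_strict_right_mono) (auto simp: add_nonneg_pos)
    also have "\<dots> = r" unfolding \<delta>_def by (simp add: add_nonneg_eq_0_iff)
    finally have "x + t *\<^sub>R (y - x) \<in> S" using r(2) by (auto simp: dist_norm)
    then show ?thesis unfolding greal by (simp add: z)
  qed
  have "g (of_real 1) = 0"
  proof (rule analytic_continuation[OF hol open_UNIV connected_UNIV, of "of_real ` {-\<delta><..<\<delta>}" 0])
    show "(0::complex) islimpt of_real ` {-\<delta><..<\<delta>}"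
    proof (rule islimptI)
      fix T :: "complex set" assume T: "0 \<in> T" "open T"
      then obtain s where s: "s > 0" "ball 0 s \<subseteq> T" using open_contains_ball by blast
      define t where "t = min s \<delta> / 2"
      have "t > 0" "t < s" "t < \<delta>" using s \<delta> unfolding t_def by auto
      then show "\<exists>y\<in>of_real ` {-\<delta><..<\<delta>}. y \<in> T \<and> y \<noteq> 0"
        using s by (intro bexI[of _ "of_real t"]) auto
    qed
  qed (use g0 in auto)
  then have "(\<Sum>k\<in>K. c k * e k (x + 1 *\<^sub>R (y - x))) = 0"
    by (simp only: greal of_real_eq_0_iff)
  then show ?thesis by simp
qed

end

section \<open>Courant's argument\<close>

text \<open>Meant for a factor \<kappa> that is locally constant off the nodal set and may jump
  across it: boundedness of \<kappa> suffices at the zeros of \<phi>.\<close>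

lemma continuous_on_mult_zero_set:
  fixes \<kappa> \<phi> :: "'a::metric_space \<Rightarrow> real"
  assumes \<phi>: "continuous_on S \<phi>" and M: "\<And>x. x \<in> S \<Longrightarrow> \<bar>\<kappa> x\<bar> \<le> M"
    and \<kappa>: "continuous_on {x\<in>S. \<phi> x \<noteq> 0} \<kappa>"
  shows "continuous_on S (\<lambda>x. \<kappa> x * \<phi> x)"
  unfolding continuous_on_def
proof
  fix x assume x: "x \<in> S"
  let ?Z = "{x\<in>S. \<phi> x \<noteq> 0}"
  show "((\<lambda>x. \<kappa> x * \<phi> x) \<longlongrightarrow> \<kappa> x * \<phi> x) (at x within S)"
  proof (cases "\<phi> x = 0")
    case True
    have "(\<phi> \<longlongrightarrow> 0) (at x within S)"
      using \<phi> x True unfolding continuous_on_def by force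
    then have "((\<lambda>y. M * \<bar>\<phi> y\<bar>) \<longlongrightarrow> M * \<bar>0\<bar>) (at x within S)"
      by (intro tendsto_intros)
    then have "((\<lambda>y. M * \<bar>\<phi> y\<bar>) \<longlongrightarrow> 0) (at x within S)" by simp
    moreover have "\<forall>\<^sub>F y in at x within S. norm (\<kappa> y * \<phi> y) \<le> M * \<bar>\<phi> y\<bar>"
      using M by (auto simp: eventually_at_filter abs_mult intro!: always_eventually mult_right_mono)
    ultimately have "((\<lambda>y. \<kappa> y * \<phi> y) \<longlongrightarrow> 0) (at x within S)"
      by (rule Lim_null_comparison[rotated])
    then show ?thesis using True by simp
  next
    case False
    obtain T where T: "open T" "T \<inter> S = \<phi> -` (- {0}) \<inter> S"
      using \<phi> unfolding continuous_on_open_invariant by (meson open_Compl closed_singleton)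
    have "at x within S = at x within ?Z"
      by (rule at_within_nhd[of x T]) (use T x False in auto)
    moreover have "continuous_on ?Z (\<lambda>x. \<kappa> x * \<phi> x)"
      by (intro continuous_intros \<kappa> continuous_on_subset[OF \<phi>]) auto
    then have "((\<lambda>x. \<kappa> x * \<phi> x) \<longlongrightarrow> \<kappa> x * \<phi> x) (at x within ?Z)"
      using x False unfolding continuous_on_def by blast
    ultimately show ?thesis by simp
  qed
qed

context cos_box
begin

text \<open>The ground state representation: with \<open>u = \<kappa> \<phi>\<close> and \<open>v = \<kappa>\<^sup>2 \<phi>\<close> one has
  \<open>(u' - u)\<^sup>2 - (v' - v) (\<phi>' - \<phi>) = \<phi> \<phi>' (\<kappa>' - \<kappa>)\<^sup>2\<close>. Where the right-hand side is positive, \<open>\<phi>\<close>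
  vanishes on the segment between the two points, so that \<open>\<phi>\<close> and \<open>\<phi>'\<close> are of the order of the step.\<close>

lemma step_error_tendsto:
  assumes \<phi>: "continuous_on Box \<phi>"
    and lip: "\<And>x y. x \<in> Box \<Longrightarrow> y \<in> Box \<Longrightarrow> \<bar>\<phi> x - \<phi> y\<bar> \<le> C * dist x y" and "C \<ge> 0"
    and fin: "finite (\<kappa> ` Box)" and \<kappa>: "continuous_on {x\<in>Box. \<phi> x \<noteq> 0} \<kappa>"
    and T: "\<And>n. continuous_on Box (T n)" "\<And>n x. x \<in> Box \<Longrightarrow> T n x \<in> Box" "\<And>n x. x \<in> Box \<Longrightarrow> dist x (T n x) \<le> h n"
    and h: "\<And>n. h n > 0" "h \<longlonglongrightarrow> 0"
  shows "\<exists>R. R \<longlonglongrightarrow> 0 \<and> (\<forall>n. step_energy (T n) (\<lambda>x. \<kappa> x * \<phi> x) (\<lambda>x. \<kappa> x * \<phi> x) / (2 * (h n)\<^sup>2)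
       \<le> step_energy (T n) (\<lambda>x. (\<kappa> x)\<^sup>2 * \<phi> x) \<phi> / (2 * (h n)\<^sup>2) + R n)"
proof -
  define u where "u x = \<kappa> x * \<phi> x" for x
  define v where "v x = (\<kappa> x)\<^sup>2 * \<phi> x" for x
  obtain M where M: "\<And>x. x \<in> Box \<Longrightarrow> \<bar>\<kappa> x\<bar> \<le> M"
    using finite_imp_bounded[OF fin] by (auto simp: bounded_iff)
  have M0: "M \<ge> 0" using M[OF zero_in_Box] by linarith
  have uc: "continuous_on Box u"
    unfolding u_def[abs_def] by (rule continuous_on_mult_zero_set[OF \<phi> M \<kappa>])
  have vc: "continuous_on Box v"
    unfolding v_def[abs_def]
  proof (rule continuous_on_mult_zero_set[OF \<phi>, where M="M\<^sup>2"])
    show "\<bar>(\<kappa> x)\<^sup>2\<bar> \<le> M\<^sup>2" if "x \<in> Box" for x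
      using power_mono[OF M[OF that], of 2] by simp
  qed (intro continuous_intros \<kappa>)
  have comp: "continuous_on Box (\<lambda>x. g (T n x))" if "continuous_on Box g" for g :: "'a \<Rightarrow> real" and n
    by (rule continuous_on_compose2[OF that T(1)]) (use T(2) in auto)
  \<comment> \<open>A continuous function with finitely many values is constant on a connected set,
    here on a segment that misses the zeros of \<phi>.\<close>
  have seg: "\<kappa> x = \<kappa> y" if "x \<in> Box" "y \<in> Box" "\<And>z. z \<in> closed_segment x y \<Longrightarrow> \<phi> z \<noteq> 0" for x y
  proof -
    have sub: "closed_segment x y \<subseteq> {x\<in>Box. \<phi> x \<noteq> 0}"
      using that closed_segment_subset[OF that(1,2) convex_Box] by auto
    have "\<kappa> constant_on closed_segment x y"
    proof (rule continuous_finite_range_constant)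
      show "continuous_on (closed_segment x y) \<kappa>" by (rule continuous_on_subset[OF \<kappa> sub])
      show "finite (\<kappa> ` closed_segment x y)" by (rule finite_subset[OF _ fin]) (use sub in auto)
    qed auto
    then show ?thesis unfolding constant_on_def by (metis ends_in_segment)
  qed
  define \<tau> where "\<tau> n x = (u (T n x) - u x)\<^sup>2 - (v (T n x) - v x) * (\<phi> (T n x) - \<phi> x)" for n x
  have \<tau>_eq: "\<tau> n x = \<phi> x * \<phi> (T n x) * (\<kappa> (T n x) - \<kappa> x)\<^sup>2" for n x
    unfolding \<tau>_def u_def v_def by (simp add: power2_eq_square algebra_simps)
  define D where "D = C\<^sup>2 * (2 * M)\<^sup>2"
  have bound: "max 0 (\<tau> n x) \<le> D * (h n)\<^sup>2" if x: "x \<in> Box" for n x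
  proof (cases "\<kappa> x = \<kappa> (T n x)")
    case True
    then show ?thesis unfolding \<tau>_eq D_def by simp
  next
    case False
    then obtain z where z: "z \<in> closed_segment x (T n x)" "\<phi> z = 0"
      using seg[OF x T(2)[OF x]] by blast
    have zB: "z \<in> Box" using z(1) closed_segment_subset[OF x T(2)[OF x] convex_Box] by auto
    have d: "dist x z \<le> h n" "dist (T n x) z \<le> h n"
      using dist_in_closed_segment[OF z(1)] T(3)[OF x, of n] by (auto simp: dist_commute)
    have "\<bar>\<phi> x\<bar> \<le> C * h n" "\<bar>\<phi> (T n x)\<bar> \<le> C * h n"
      using lip[OF x zB] lip[OF T(2)[OF x] zB] mult_left_mono[OF d(1) \<open>C \<ge> 0\<close>] mult_left_mono[OF d(2) \<open>C \<ge> 0\<close>]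
      by (auto simp: z(2) intro: order_trans)
    then have 1: "\<bar>\<phi> x\<bar> * \<bar>\<phi> (T n x)\<bar> \<le> (C * h n) * (C * h n)"
      by (intro mult_mono) auto
    have "\<bar>\<kappa> (T n x) - \<kappa> x\<bar> \<le> 2 * M"
      using M[OF x] M[OF T(2)[OF x], of n] by linarith
    then have 2: "(\<kappa> (T n x) - \<kappa> x)\<^sup>2 \<le> (2 * M)\<^sup>2"
      using power_mono[of "\<bar>\<kappa> (T n x) - \<kappa> x\<bar>" "2 * M" 2] by simp
    have "\<tau> n x \<le> \<bar>\<phi> x\<bar> * \<bar>\<phi> (T n x)\<bar> * (\<kappa> (T n x) - \<kappa> x)\<^sup>2"
      unfolding \<tau>_eq by (intro mult_right_mono) (auto simp: abs_mult[symmetric])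
    also have "\<dots> \<le> (C * h n) * (C * h n) * (2 * M)\<^sup>2"
      by (intro mult_mono 1 2) auto
    also have "\<dots> = D * (h n)\<^sup>2" by (simp add: D_def power2_eq_square)
    finally show ?thesis by (simp add: D_def)
  qed
  define r where "r n x = max 0 (\<tau> n x) / (2 * (h n)\<^sup>2)" for n x
  have \<tau>c: "continuous_on Box (\<tau> n)" for n
    unfolding \<tau>_def[abs_def] by (intro continuous_intros comp uc vc \<phi>)
  have rc: "continuous_on Box (r n)" for n
    unfolding r_def[abs_def] divide_inverse by (intro continuous_intros \<tau>c)
  have "(\<lambda>n. integral Box (r n)) \<longlonglongrightarrow> integral Box (\<lambda>x. 0)"
  proof (rule dominated_convergence(2))
    show "r n integrable_on Box" for n by (rule integrable_Box[OF rc])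
    show "(\<lambda>x. D) integrable_on Box" by (intro integrable_Box continuous_intros)
    show "norm (r n x) \<le> D" if "x \<in> Box" for n x
    proof -
      have "r n x \<le> D * (h n)\<^sup>2 / (2 * (h n)\<^sup>2)"
        unfolding r_def using h(1)[of n] by (intro divide_right_mono bound that) auto
      also have "\<dots> = D / 2" using h(1)[of n] by simp
      also have "\<dots> \<le> D" by (simp add: D_def)
      finally show ?thesis by (simp add: r_def)
    qed
    \<comment> \<open>The bound alone keeps the error only of order one. It tends to 0 because it
      vanishes at zeros of \<phi>, and at any other point as soon as the step is too short to reach
      the nodal set.\<close>
    show "(\<lambda>n. r n x) \<longlonglongrightarrow> 0" if x: "x \<in> Box" for x
    proof (cases "\<phi> x = 0")
      case True
      then show ?thesis by (simp add: r_def \<tau>_eq)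
    next
      case False
      obtain d where d: "d > 0" "\<And>y. y \<in> Box \<Longrightarrow> dist y x < d \<Longrightarrow> dist (\<phi> y) (\<phi> x) < \<bar>\<phi> x\<bar>"
        using \<phi> x False unfolding continuous_on_iff by (meson zero_less_abs_iff)
      have "\<forall>\<^sub>F n in sequentially. h n < d" using order_tendstoD(2)[OF h(2) d(1)] .
      then have "\<forall>\<^sub>F n in sequentially. r n x = 0"
      proof (rule eventually_mono)
        fix n assume n: "h n < d"
        have "\<kappa> x = \<kappa> (T n x)"
        proof (rule seg[OF x T(2)[OF x]])
          fix z assume z: "z \<in> closed_segment x (T n x)"
          have "z \<in> Box" using z closed_segment_subset[OF x T(2)[OF x] convex_Box] by auto
          moreover have "dist z x < d"
            using dist_in_closed_segment[OF z] T(3)[OF x, of n] n by (auto simp: dist_commute)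
          ultimately show "\<phi> z \<noteq> 0" using d(2)[of z] by (auto simp: dist_real_def)
        qed
        then show "r n x = 0" by (simp add: r_def \<tau>_eq)
      qed
      then show ?thesis by (rule tendsto_eventually)
    qed
  qed
  then have "(\<lambda>n. integral Box (r n)) \<longlonglongrightarrow> 0" by simp
  moreover have "step_energy (T n) u u / (2 * (h n)\<^sup>2) \<le> step_energy (T n) v \<phi> / (2 * (h n)\<^sup>2) + integral Box (r n)" for n
  proof -
    have "step_energy (T n) u u - step_energy (T n) v \<phi> = integral Box (\<tau> n)"
      unfolding step_energy_def \<tau>_def power2_eq_square
      by (rule integral_diff[symmetric]) (intro integrable_Box continuous_intros comp uc vc \<phi>)+
    also have "\<dots> \<le> integral Box (\<lambda>x. max 0 (\<tau> n x))"
      by (intro integral_le integrable_Box continuous_intros \<tau>c) auto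
    also have "\<dots> = integral Box (\<lambda>x. 2 * (h n)\<^sup>2 * r n x)"
      unfolding r_def using h(1)[of n] by simp
    also have "\<dots> = 2 * (h n)\<^sup>2 * integral Box (r n)" by (rule integral_mult_right)
    finally have "step_energy (T n) u u \<le> step_energy (T n) v \<phi> + 2 * (h n)\<^sup>2 * integral Box (r n)" by linarith
    then have "step_energy (T n) u u / (2 * (h n)\<^sup>2) \<le> (step_energy (T n) v \<phi> + 2 * (h n)\<^sup>2 * integral Box (r n)) / (2 * (h n)\<^sup>2)"
      by (intro divide_right_mono) auto
    also have "\<dots> = step_energy (T n) v \<phi> / (2 * (h n)\<^sup>2) + integral Box (r n)"
      using h(1)[of n] by (simp add: add_divide_distrib)
    finally show ?thesis .
  qed
  ultimately show ?thesis
    unfolding u_def[abs_def] v_def[abs_def] by (intro exI[of _ "\<lambda>n. integral Box (r n)"]) auto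
qed

lemma exists_small: "\<exists>h. small h"
proof -
  have "Min ((\<lambda>b. pi / \<omega> b) ` (Basis :: 'a set)) > 0" using \<omega>_pos by auto
  moreover have "Min ((\<lambda>b. pi / \<omega> b) ` (Basis :: 'a set)) \<le> pi / \<omega> b" if "b \<in> Basis" for b
    using that by (intro Min_le) auto
  ultimately show ?thesis unfolding small_def by blast
qed

text \<open>The discrete form of the bound of the Dirichlet integral of u = \<kappa> \<phi> by l
  |u|^2. Bessel's inequality bounds the left side by the energy of u, and
  \<open>step_error_tendsto\<close> bounds this by the energy of v = \<kappa>^2 \<phi> against
  \<phi>. The latter tends to l <v, \<phi>>, as \<phi> has only modes of eigenvalue l, and <v,
  \<phi>> = <u, u>. With \<open>F\<close> finite the limit on the left can be taken
  termwise.\<close>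

lemma energy_locally_constant_multiple:
  assumes K: "finite K" "\<And>k. k \<in> K \<Longrightarrow> lam k = l" and \<phi>_def: "\<And>x. \<phi> x = (\<Sum>k\<in>K. a k * e k x)"
    and fin: "finite (\<kappa> ` Box)" and \<kappa>: "continuous_on {x\<in>Box. \<phi> x \<noteq> 0} \<kappa>"
    and F: "finite F" "F \<subseteq> Idx"
  shows "(\<Sum>k\<in>F. lam k * coeff_sq (\<lambda>x. \<kappa> x * \<phi> x) k) \<le> l * ip (\<lambda>x. \<kappa> x * \<phi> x) (\<lambda>x. \<kappa> x * \<phi> x)"
    and "continuous_on Box (\<lambda>x. \<kappa> x * \<phi> x)"
proof -
  let ?u = "\<lambda>x. \<kappa> x * \<phi> x" and ?v = "\<lambda>x. (\<kappa> x)\<^sup>2 * \<phi> x"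
  have \<phi>_eq: "\<phi> = (\<lambda>x. \<Sum>k\<in>K. a k * e k x)" by (rule ext) (rule \<phi>_def)
  have \<phi>: "continuous_on Box \<phi>" unfolding \<phi>_eq by (intro continuous_intros)
  obtain M where M: "\<And>x. x \<in> Box \<Longrightarrow> \<bar>\<kappa> x\<bar> \<le> M"
    using finite_imp_bounded[OF fin] by (auto simp: bounded_iff)
  show uc: "continuous_on Box ?u"
    by (rule continuous_on_mult_zero_set[OF \<phi> M \<kappa>])
  have vc: "continuous_on Box ?v"
  proof (rule continuous_on_mult_zero_set[OF \<phi>, where M="M\<^sup>2"])
    show "\<bar>(\<kappa> x)\<^sup>2\<bar> \<le> M\<^sup>2" if "x \<in> Box" for x
      using power_mono[OF M[OF that], of 2] by simp
  qed (intro continuous_intros \<kappa>)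
  obtain C where C: "C \<ge> 0" "\<And>x y. x \<in> Box \<Longrightarrow> y \<in> Box \<Longrightarrow> \<bar>\<phi> x - \<phi> y\<bar> \<le> C * dist x y"
    by (rule lipschitz_trig[OF K(1), of a], rule that, assumption) (unfold \<phi>_def, blast)
  obtain h0 where h0: "small h0" using exists_small by blast
  define h where "h n = h0 / real (Suc n)" for n
  have hs: "small (h n)" for n
  proof -
    have "h n \<le> h0" "h n > 0"
      using h0 unfolding h_def small_def by (auto simp: field_simps mult_le_cancel_left1)
    then show ?thesis using h0 unfolding small_def by force
  qed
  have hpos: "h n > 0" for n using hs by (simp add: small_def)
  have hlim: "h \<longlonglongrightarrow> 0"
    unfolding h_def[abs_def] using tendsto_mult_left[OF LIMSEQ_inverse_real_of_nat, of h0] by (simp add: divide_inverse)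
  have hb: "0 \<le> h n" "h n \<le> pi / \<omega> b" if "b \<in> Basis" for n b using hs[of n] that by (auto simp: small_def)
  have "\<exists>R. R \<longlonglongrightarrow> 0 \<and> (\<forall>n. step_energy (up b (h n)) ?u ?u / (2 * (h n)\<^sup>2) \<le> step_energy (up b (h n)) ?v \<phi> / (2 * (h n)\<^sup>2) + R n)"
    if b: "b \<in> Basis" for b
    by (rule step_error_tendsto[OF \<phi> C(2,1) fin \<kappa> continuous_on_up up_in_Box[OF b hb[OF b]] dist_up[OF b hb(1)[OF b]] hpos hlim])
  then have "\<forall>b\<in>Basis. \<exists>R. R \<longlonglongrightarrow> 0 \<and> (\<forall>n. step_energy (up b (h n)) ?u ?u / (2 * (h n)\<^sup>2) \<le> step_energy (up b (h n)) ?v \<phi> / (2 * (h n)\<^sup>2) + R n)"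
    by (rule ballI)
  then obtain R where "\<forall>b\<in>Basis. R b \<longlonglongrightarrow> 0 \<and> (\<forall>n. step_energy (up b (h n)) ?u ?u / (2 * (h n)\<^sup>2) \<le> step_energy (up b (h n)) ?v \<phi> / (2 * (h n)\<^sup>2) + R b n)"
    by (rule bchoice[THEN exE])
  then have R: "R b \<longlonglongrightarrow> 0"
    "step_energy (up b (h n)) ?u ?u / (2 * (h n)\<^sup>2) \<le> step_energy (up b (h n)) ?v \<phi> / (2 * (h n)\<^sup>2) + R b n"
    if "b \<in> Basis" for b n
    using that by blast+
  have "\<exists>R. R \<longlonglongrightarrow> 0 \<and> (\<forall>n. step_energy (down b (h n)) ?u ?u / (2 * (h n)\<^sup>2) \<le> step_energy (down b (h n)) ?v \<phi> / (2 * (h n)\<^sup>2) + R n)"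
    if b: "b \<in> Basis" for b
    by (rule step_error_tendsto[OF \<phi> C(2,1) fin \<kappa> continuous_on_down down_in_Box[OF b hb[OF b]] dist_down[OF b hb(1)[OF b]] hpos hlim])
  then have "\<forall>b\<in>Basis. \<exists>R. R \<longlonglongrightarrow> 0 \<and> (\<forall>n. step_energy (down b (h n)) ?u ?u / (2 * (h n)\<^sup>2) \<le> step_energy (down b (h n)) ?v \<phi> / (2 * (h n)\<^sup>2) + R n)"
    by (rule ballI)
  then obtain R' where "\<forall>b\<in>Basis. R' b \<longlonglongrightarrow> 0 \<and> (\<forall>n. step_energy (down b (h n)) ?u ?u / (2 * (h n)\<^sup>2) \<le> step_energy (down b (h n)) ?v \<phi> / (2 * (h n)\<^sup>2) + R' b n)"
    by (rule bchoice[THEN exE])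
  then have R': "R' b \<longlonglongrightarrow> 0"
    "step_energy (down b (h n)) ?u ?u / (2 * (h n)\<^sup>2) \<le> step_energy (down b (h n)) ?v \<phi> / (2 * (h n)\<^sup>2) + R' b n"
    if "b \<in> Basis" for b n
    using that by blast+
  have en: "energy (h n) ?u ?u \<le> energy (h n) ?v \<phi> + (\<Sum>b\<in>Basis. R b n + R' b n)" for n
    unfolding energy_def sum.distrib[symmetric] add_divide_distrib
  proof (rule sum_mono)
    fix b :: 'a assume b: "b \<in> Basis"
    show "step_energy (up b (h n)) ?u ?u / (2 * (h n)\<^sup>2) + step_energy (down b (h n)) ?u ?u / (2 * (h n)\<^sup>2)
      \<le> step_energy (up b (h n)) ?v \<phi> / (2 * (h n)\<^sup>2) + step_energy (down b (h n)) ?v \<phi> / (2 * (h n)\<^sup>2) + (R b n + R' b n)"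
      using R(2)[OF b, of n] R'(2)[OF b, of n] by linarith
  qed
  have hr: "filterlim h (at_right 0) sequentially"
    using hlim hpos hpos[THEN less_imp_neq, THEN not_sym] by (simp add: filterlim_at)
  have wl: "(\<lambda>n. walk_eig (h n) k) \<longlonglongrightarrow> lam k" for k
    by (rule filterlim_compose[OF walk_eig_tendsto hr])
  have "energy (h n) ?v \<phi> = (\<Sum>k\<in>K. a k * (walk_eig (h n) k * ip ?v (e k)))" for n
    unfolding \<phi>_eq by (rule energy_trig[OF hs vc[unfolded \<phi>_eq] K(1)])
  moreover have "(\<lambda>n. (\<Sum>k\<in>K. a k * (walk_eig (h n) k * ip ?v (e k)))) \<longlonglongrightarrow> (\<Sum>k\<in>K. a k * (lam k * ip ?v (e k)))"
    by (intro tendsto_intros wl)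
  moreover have "(\<Sum>k\<in>K. a k * (lam k * ip ?v (e k))) = l * ip ?v \<phi>"
  proof -
    have "ip ?v \<phi> = (\<Sum>k\<in>K. a k * ip ?v (e k))"
      unfolding \<phi>_eq by (rule ip_sum_right[OF K(1) vc[unfolded \<phi>_eq] continuous_on_e])
    then show ?thesis using K(2) by (simp add: sum_distrib_left mult.left_commute)
  qed
  moreover have "ip ?v \<phi> = ip ?u ?u"
    unfolding ip_def by (simp add: power2_eq_square mult_ac)
  ultimately have "(\<lambda>n. energy (h n) ?v \<phi>) \<longlonglongrightarrow> l * ip ?u ?u" by simp
  moreover have "(\<lambda>n. \<Sum>b\<in>Basis. R b n + R' b n) \<longlonglongrightarrow> (\<Sum>b\<in>(Basis::'a set). 0 + 0)"
    by (intro tendsto_sum tendsto_add R(1) R'(1))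
  ultimately have rhs: "(\<lambda>n. energy (h n) ?v \<phi> + (\<Sum>b\<in>Basis. R b n + R' b n)) \<longlonglongrightarrow> l * ip ?u ?u + (\<Sum>b\<in>(Basis::'a set). 0 + 0)"
    by (rule tendsto_add)
  have lhs: "(\<lambda>n. \<Sum>k\<in>F. walk_eig (h n) k * coeff_sq ?u k) \<longlonglongrightarrow> (\<Sum>k\<in>F. lam k * coeff_sq ?u k)"
    by (intro tendsto_intros wl)
  have "(\<Sum>k\<in>F. walk_eig (h n) k * coeff_sq ?u k) \<le> energy (h n) ?v \<phi> + (\<Sum>b\<in>Basis. R b n + R' b n)" for n
    by (rule order_trans[OF bessel_energy[OF hs uc F] en])
  then have "(\<Sum>k\<in>F. lam k * coeff_sq ?u k) \<le> l * ip ?u ?u + (\<Sum>b\<in>(Basis::'a set). 0 + 0)"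
    by (intro LIMSEQ_le[OF lhs rhs]) auto
  then show "(\<Sum>k\<in>F. lam k * coeff_sq ?u k) \<le> l * ip ?u ?u" by simp
qed

lemma coeff_sq_nonneg: "coeff_sq f k \<ge> 0"
  unfolding coeff_sq_def using ip_e_self_pos[of k] by simp

text \<open>Subtracting l times Parseval from the energy bound gives a non-positive sum of (lam k -
  l) \<open>coeff_sq\<close>. With no modes below l all its terms are non-negative, so no mode above
  l can occur.\<close>

theorem locally_constant_multiple_eigenfunction:
  assumes K: "finite K" "\<And>k. k \<in> K \<Longrightarrow> lam k = l" and \<phi>_def: "\<And>x. \<phi> x = (\<Sum>k\<in>K. a k * e k x)"
    and fin: "finite (\<kappa> ` Box)" and \<kappa>: "continuous_on {x\<in>Box. \<phi> x \<noteq> 0} \<kappa>"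
    and orth: "\<And>k. k \<in> Idx \<Longrightarrow> lam k < l \<Longrightarrow> ip (\<lambda>x. \<kappa> x * \<phi> x) (e k) = 0"
    and "l \<ge> 0"
  shows "\<exists>c. \<forall>x\<in>Box. \<kappa> x * \<phi> x = (\<Sum>k\<in>{k\<in>Idx. lam k = l}. c k * e k x)"
proof -
  let ?u = "\<lambda>x. \<kappa> x * \<phi> x"
  note bd = energy_locally_constant_multiple[OF K \<phi>_def fin \<kappa>]
  have uc: "continuous_on Box ?u" by (rule bd(2)[of "{}"]) auto
  have q0: "coeff_sq ?u k = 0" if k: "k \<in> Idx" "lam k > l" for k
  proof -
    have "(lam k - l) * coeff_sq ?u k \<le> 0 + \<epsilon>" if eps: "\<epsilon> > 0" for \<epsilon>
    proof -
      \<comment> \<open>After multiplication by l the error is at most \<epsilon>, also when l =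
        0.\<close>
      obtain F where F: "finite F" "F \<subseteq> Idx" "ip ?u ?u \<le> (\<Sum>k\<in>F. coeff_sq ?u k) + \<epsilon> / (l + 1)"
        using parseval_approx[OF uc, of "\<epsilon> / (l + 1)"] eps \<open>l \<ge> 0\<close> by auto
      \<comment> \<open>The index under study need not belong to the set supplied by
        Parseval.\<close>
      let ?F = "insert k F"
      have "(\<Sum>k\<in>?F. lam k * coeff_sq ?u k) \<le> l * ip ?u ?u"
        by (rule bd(1)) (use F k in auto)
      also have "\<dots> \<le> l * ((\<Sum>k\<in>?F. coeff_sq ?u k) + \<epsilon> / (l + 1))"
      proof -
        have "(\<Sum>k\<in>F. coeff_sq ?u k) \<le> (\<Sum>k\<in>?F. coeff_sq ?u k)"
          by (rule sum_mono2) (use F coeff_sq_nonneg in auto)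
        then show ?thesis using F(3) \<open>l \<ge> 0\<close> by (intro mult_left_mono) linarith+
      qed
      also have "\<dots> \<le> l * (\<Sum>k\<in>?F. coeff_sq ?u k) + \<epsilon>"
        using \<open>l \<ge> 0\<close> eps by (simp add: distrib_left field_simps)
      finally have "(\<Sum>k\<in>?F. (lam k - l) * coeff_sq ?u k) \<le> \<epsilon>"
        by (simp only: left_diff_distrib sum_subtractf sum_distrib_left)
      moreover have "(lam k - l) * coeff_sq ?u k \<le> (\<Sum>k\<in>?F. (lam k - l) * coeff_sq ?u k)"
      proof (rule member_le_sum)
        fix j assume "j \<in> ?F - {k}"
        then have "j \<in> Idx" using F k by auto
        show "0 \<le> (lam j - l) * coeff_sq ?u j"
        proof (cases "lam j < l")
          case True
          then show ?thesis using orth[OF \<open>j \<in> Idx\<close>] by (simp add: coeff_sq_def)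
        qed (use coeff_sq_nonneg in auto)
      qed (use F in auto)
      ultimately show ?thesis by simp
    qed
    then have "(lam k - l) * coeff_sq ?u k \<le> 0" by (rule field_le_epsilon)
    then show ?thesis using k(2) coeff_sq_nonneg[of ?u k] by (simp add: mult_le_0_iff)
  qed
  have "finite {k\<in>Idx. lam k = l}"
    by (rule finite_subset[OF _ finite_lam_le[of l]]) auto
  moreover have "ip ?u (e k) = 0" if "k \<in> Idx" "k \<notin> {k\<in>Idx. lam k = l}" for k
  proof (cases "lam k < l")
    case False
    then have "coeff_sq ?u k = 0" using q0[of k] that by auto
    then show ?thesis using ip_e_self_pos[of k] by (simp add: coeff_sq_def)
  qed (use orth that in auto)
  ultimately show ?thesis
    by (intro exI[of _ "\<lambda>k. ip ?u (e k) / ip (e k) (e k)"] ballI eq_trig_of_coeffs[OF uc]) auto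
qed

end

section \<open>Linear algebra and topology for the combination of nodal domains\<close>

lemma underdetermined_system:
  fixes A :: "'s \<Rightarrow> 'k \<Rightarrow> real"
  assumes "finite C" "finite S" "card C < card S"
  shows "\<exists>c. (\<exists>s\<in>S. c s \<noteq> 0) \<and> (\<forall>k\<in>C. (\<Sum>s\<in>S. c s * A s k) = 0)"
  using assms
proof (induction C arbitrary: S A rule: finite_induct)
  case empty
  then have "S \<noteq> {}" by auto
  then show ?case by (intro exI[of _ "\<lambda>_. 1"]) auto
next
  case (insert k C)
  show ?case
  proof (cases "\<forall>s\<in>S. A s k = 0")
    case True
    have "card C < card S" using insert by simp
    from insert.IH[OF insert.prems(1) this, of A] obtain c where
      "\<exists>s\<in>S. c s \<noteq> 0" "\<forall>k\<in>C. (\<Sum>s\<in>S. c s * A s k) = 0" by blast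
    then show ?thesis using True by (intro exI[of _ c]) auto
  next
    case False
    \<comment> \<open>Gaussian elimination: equation \<open>k\<close> is solved for the unknown of
      \<open>s0\<close>, which is then removed from the remaining equations.\<close>
    then obtain s0 where s0: "s0 \<in> S" "A s0 k \<noteq> 0" by blast
    define S' where "S' = S - {s0}"
    have S': "finite S'" "card C < card S'" "S = insert s0 S'" "s0 \<notin> S'"
      using insert s0 unfolding S'_def by auto
    from insert.IH[OF S'(1,2), of "\<lambda>s j. A s j - A s k / A s0 k * A s0 j"]
    obtain c where c: "\<exists>s\<in>S'. c s \<noteq> 0" "\<forall>j\<in>C. (\<Sum>s\<in>S'. c s * (A s j - A s k / A s0 k * A s0 j)) = 0"
      by blast
    define t where "t = - (\<Sum>s\<in>S'. c s * A s k) / A s0 k"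
    define c' where "c' = c(s0 := t)"
    have sum: "(\<Sum>s\<in>S. c' s * A s j) = t * A s0 j + (\<Sum>s\<in>S'. c s * A s j)" for j
    proof -
      have "(\<Sum>s\<in>S'. c' s * A s j) = (\<Sum>s\<in>S'. c s * A s j)"
        using S'(4) by (intro sum.cong) (auto simp: c'_def)
      then show ?thesis using S' by (simp add: c'_def)
    qed
    have "(\<Sum>s\<in>S. c' s * A s j) = 0" if "j \<in> insert k C" for j
    proof (cases "j = k")
      case True
      then show ?thesis unfolding sum t_def using s0(2) by simp
    next
      case False
      then have "j \<in> C" using that by auto
      then have "0 = (\<Sum>s\<in>S'. c s * (A s j - A s k / A s0 k * A s0 j))" using c(2) by simp
      also have "\<dots> = (\<Sum>s\<in>S'. c s * A s j) - (\<Sum>s\<in>S'. c s * A s k) / A s0 k * A s0 j"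
        by (simp add: right_diff_distrib sum_subtractf sum_distrib_right sum_divide_distrib mult.assoc)
      finally show ?thesis unfolding sum t_def by simp
    qed
    moreover have "\<exists>s\<in>S. c' s \<noteq> 0" using c(1) S' by (auto simp: c'_def)
    ultimately show ?thesis by blast
  qed
qed

lemma finite_image_sum:
  fixes f :: "'s \<Rightarrow> 'b \<Rightarrow> 'c::comm_monoid_add"
  assumes "finite A" "\<And>s. s \<in> A \<Longrightarrow> finite (f s ` B)"
  shows "finite ((\<lambda>x. \<Sum>s\<in>A. f s x) ` B)"
  using assms
proof (induction A rule: finite_induct)
  case empty
  then show ?case by (simp add: image_constant_conv)
next
  case (insert s A)
  have "(\<lambda>x. \<Sum>s\<in>insert s A. f s x) ` B \<subseteq> (\<lambda>(p, r). p + r) ` (f s ` B \<times> (\<lambda>x. \<Sum>s\<in>A. f s x) ` B)"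
    using insert.hyps by (auto simp: image_iff)
  moreover have "finite (f s ` B \<times> (\<lambda>x. \<Sum>s\<in>A. f s x) ` B)" using insert by simp
  ultimately show ?case by (meson finite_imageI finite_subset)
qed

text \<open>On a convex body a nodal domain touches only those non-zero boundary points near which it fills
  the whole interior; hence passing to the closure extends its indicator continuously.\<close>

lemma continuous_on_indicator_closure_component:
  fixes \<phi> :: "'a::euclidean_space \<Rightarrow> real"
  assumes \<Omega>: "convex \<Omega>" "interior \<Omega> \<noteq> {}" and \<phi>: "continuous_on \<Omega> \<phi>"
    and D: "D \<in> components (interior \<Omega> - \<phi> -` {0})"
  shows "continuous_on {x\<in>\<Omega>. \<phi> x \<noteq> 0} (indicator (closure D) :: 'a \<Rightarrow> real)"
  unfolding continuous_on_def
proof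
  fix x assume "x \<in> {x\<in>\<Omega>. \<phi> x \<noteq> 0}"
  then have x: "x \<in> \<Omega>" "\<phi> x \<noteq> 0" by auto
  let ?Z = "{x\<in>\<Omega>. \<phi> x \<noteq> 0}" and ?I = "indicator (closure D) :: 'a \<Rightarrow> real"
  obtain r where r: "r > 0" "\<And>y. y \<in> \<Omega> \<Longrightarrow> dist y x < r \<Longrightarrow> dist (\<phi> y) (\<phi> x) < \<bar>\<phi> x\<bar>"
    using \<phi> x unfolding continuous_on_iff by (meson zero_less_abs_iff)
  have nz: "\<phi> y \<noteq> 0" if "y \<in> \<Omega>" "y \<in> ball x r" for y
    using r(2)[OF that(1)] that(2) by (auto simp: dist_commute dist_real_def)
  \<comment> \<open>Convexity of \<Omega> makes \<open>W\<close> connected. As it avoids the zeros,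
    it lies in \<open>D\<close> or misses \<open>D\<close> altogether.\<close>
  define W where "W = ball x r \<inter> interior \<Omega>"
  have W: "connected W" "W \<subseteq> interior \<Omega> - \<phi> -` {0}"
    unfolding W_def using nz interior_subset[of \<Omega>]
    by (auto intro!: convex_connected convex_Int convex_interior \<Omega>(1))
  have cl: "\<Omega> \<subseteq> closure (interior \<Omega>)"
    using convex_closure_interior[OF \<Omega>] closure_subset by auto
  have same: "?I y = (if W \<inter> D = {} then 0 else 1)" if y: "y \<in> \<Omega>" "y \<in> ball x r" for y
  proof (cases "W \<inter> D = {}")
    case True
    have "ball x r \<inter> D = {}"
      using True in_components_subset[OF D] unfolding W_def by auto
    then have "ball x r \<inter> closure D = {}" by (simp add: open_Int_closure_eq_empty)
    then show ?thesis using True y by (auto simp: indicator_def)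
  next
    case False
    then have "W \<subseteq> D" using components_maximal[OF D W] by (simp add: Int_commute)
    moreover have "y \<in> closure W"
      using open_Int_closure_subset[of "ball x r" "interior \<Omega>"] y cl unfolding W_def by auto
    ultimately have "y \<in> closure D" using closure_mono by blast
    then show ?thesis using False by simp
  qed
  have "\<forall>\<^sub>F y in at x within ?Z. ?I y = ?I x"
    unfolding eventually_at
  proof (intro exI[of _ r] conjI ballI impI r(1))
    fix y assume "y \<in> ?Z" "y \<noteq> x \<and> dist y x < r"
    then show "?I y = ?I x" using same[of y] same[of x] x(1) r(1) by (simp add: dist_commute)
  qed
  then show "(?I \<longlongrightarrow> ?I x) (at x within ?Z)" by (rule tendsto_eventually)
qed

text \<open>The image lies in some component; mapping that one back and using maximality of
  \<open>D\<close> gives the reverse inclusion.\<close>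

lemma component_image_involution:
  fixes \<sigma> :: "'a::topological_space \<Rightarrow> 'a"
  assumes \<sigma>: "continuous_on UNIV \<sigma>" "\<And>x. \<sigma> (\<sigma> x) = x" "\<sigma> ` S \<subseteq> S" and D: "D \<in> components S"
  shows "\<sigma> ` D \<in> components S"
proof -
  have conn: "connected (\<sigma> ` C)" if "C \<in> components S" for C
    by (intro connected_continuous_image continuous_on_subset[OF \<sigma>(1)] in_components_connected[OF that]) auto
  have sub: "\<sigma> ` C \<subseteq> S" if "C \<in> components S" for C
    using \<sigma>(3) in_components_subset[OF that] by blast
  have inv: "\<sigma> ` \<sigma> ` C = C" for C using \<sigma>(2) by (simp add: image_image)
  have "D \<noteq> {}" by (rule in_components_nonempty[OF D])
  then obtain C where C: "C \<in> components S" "\<sigma> ` D \<subseteq> C"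
    using exists_component_superset[OF sub[OF D] _ conn[OF D]] in_components_subset[OF D] by blast
  have "D \<subseteq> \<sigma> ` C" using C(2) inv by (metis image_mono)
  then have "D \<inter> \<sigma> ` C \<noteq> {}" using \<open>D \<noteq> {}\<close> by blast
  then have "\<sigma> ` C \<subseteq> D" using components_maximal[OF D conn[OF C(1)] sub[OF C(1)]] by blast
  then have "C \<subseteq> \<sigma> ` D" using inv by (metis image_mono)
  then show ?thesis using C by (metis subset_antisym)
qed

context cos_box
begin

text \<open>\<rho> retracts the box onto \<Omega>, so that functions on \<Omega> unfold to the box:
  the identity for the boxes, folding along the diagonal for the triangle. \<sigma> is the symmetry
  of \<Omega> that negates \<phi>. \<open>C\<close> lists modes to which orthogonality has to be
  enforced; for unfolded antisymmetric functions it then holds for all modes below l. The bound is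
  card C + 1 for each sign.\<close>

theorem nodal_domains_odd_bound:
  assumes \<Omega>: "convex \<Omega>" "interior \<Omega> \<noteq> {}" "\<Omega> \<subseteq> Box"
    and \<rho>: "continuous_on Box \<rho>" "\<And>x. x \<in> Box \<Longrightarrow> \<rho> x \<in> \<Omega>" "\<And>x. x \<in> \<Omega> \<Longrightarrow> \<rho> x = x"
    and \<sigma>: "continuous_on UNIV \<sigma>" "\<And>x. \<sigma> (\<sigma> x) = x" "\<And>x. x \<in> \<Omega> \<Longrightarrow> \<sigma> x \<in> \<Omega>"
      "\<And>x. x \<in> Box \<Longrightarrow> \<rho> (\<sigma> x) = \<sigma> (\<rho> x)"
    and K: "finite K" "\<And>k. k \<in> K \<Longrightarrow> lam k = l" and \<phi>_def: "\<And>x. \<phi> x = (\<Sum>k\<in>K. a k * e k x)"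
    and "l \<ge> 0"
    and \<phi>\<rho>: "\<And>x. x \<in> Box \<Longrightarrow> \<phi> (\<rho> x) = \<phi> x" and \<phi>\<sigma>: "\<And>x. x \<in> Box \<Longrightarrow> \<phi> (\<sigma> x) = - \<phi> x"
    and C: "finite C" "\<And>f k. continuous_on Box f \<Longrightarrow> (\<And>x. x \<in> Box \<Longrightarrow> f (\<rho> x) = f x) \<Longrightarrow>
        (\<And>x. x \<in> Box \<Longrightarrow> f (\<sigma> x) = - f x) \<Longrightarrow> (\<And>k. k \<in> C \<Longrightarrow> ip f (e k) = 0) \<Longrightarrow>
        k \<in> Idx \<Longrightarrow> lam k < l \<Longrightarrow> ip f (e k) = 0"
    and u: "\<And>x. x \<in> \<Omega> \<Longrightarrow> u x = \<phi> x"
  shows "finite (nodal_domains \<Omega> u) \<and> card (nodal_domains \<Omega> u) \<le> 2 * card C + 2"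
proof -
  define S where "S = interior \<Omega> - \<phi> -` {0}"
  have nd: "nodal_domains \<Omega> u = components S"
  proof -
    have "interior \<Omega> - u -` {0} = S" unfolding S_def using u interior_subset[of \<Omega>] by auto
    then show ?thesis by (simp add: nodal_domains_def)
  qed
  have \<phi>_eq: "\<phi> = (\<lambda>x. \<Sum>k\<in>K. a k * e k x)" by (rule ext) (rule \<phi>_def)
  have \<phi>c: "continuous_on T \<phi>" for T unfolding \<phi>_eq by (intro continuous_intros)
  have "open S"
  proof -
    have "open (\<phi> -` (- {0}))" using \<phi>c[of UNIV] by (intro open_vimage) auto
    moreover have "S = interior \<Omega> \<inter> \<phi> -` (- {0})" unfolding S_def by auto
    ultimately show ?thesis by auto
  qed
  have openD: "open D" if "D \<in> components S" for D using open_components[OF \<open>open S\<close> that] .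
  have S\<Omega>: "S \<subseteq> \<Omega>" unfolding S_def using interior_subset[of \<Omega>] by auto
  \<comment> \<open>Being its own inverse and continuous, \<sigma> is a homeomorphism, so it maps
    the interior of \<Omega> to an open subset of \<Omega>.\<close>
  have \<sigma>S: "\<sigma> ` S \<subseteq> S"
  proof -
    have "\<sigma> ` interior \<Omega> = \<sigma> -` interior \<Omega>" using \<sigma>(2) by (auto simp: image_iff) (metis \<sigma>(2))
    then have "open (\<sigma> ` interior \<Omega>)" using \<sigma>(1) by (simp add: open_vimage)
    moreover have "\<sigma> ` interior \<Omega> \<subseteq> \<Omega>" using \<sigma>(3) interior_subset[of \<Omega>] by blast
    ultimately have "\<sigma> ` interior \<Omega> \<subseteq> interior \<Omega>" by (rule interior_maximal[rotated])
    then show ?thesis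
      using \<phi>\<sigma> \<Omega>(3) interior_subset[of \<Omega>] unfolding S_def by fastforce
  qed
  have sgn: "(\<forall>x\<in>D. \<phi> x > 0) \<or> (\<forall>x\<in>D. \<phi> x < 0)" if D: "D \<in> components S" for D
  proof (rule ccontr)
    assume neg: "\<not> ?thesis"
    have nz: "\<phi> x \<noteq> 0" if "x \<in> D" for x using in_components_subset[OF D] that unfolding S_def by auto
    from neg obtain x y where xy: "x \<in> D" "y \<in> D" "\<phi> x < 0" "\<phi> y > 0"
      using nz by (meson linorder_neqE_linordered_idom)
    have "connected (\<phi> ` D)"
      by (intro connected_continuous_image \<phi>c in_components_connected[OF D])
    then have "0 \<in> \<phi> ` D"
      using connectedD_interval[of "\<phi> ` D" "\<phi> x" "\<phi> y" 0] xy by auto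
    then show False using nz by auto
  qed
  define P where "P = {D\<in>components S. \<forall>x\<in>D. \<phi> x > 0}"
  define Q where "Q = {D\<in>components S. \<forall>x\<in>D. \<phi> x < 0}"
  have PQ: "components S = P \<union> Q" unfolding P_def Q_def using sgn by blast
  \<comment> \<open>Thus negative domains are at most as many as positive ones, and bounding the
    latter is enough.\<close>
  have \<sigma>Q: "(\<lambda>D. \<sigma> ` D) ` Q \<subseteq> P"
  proof
    fix E assume "E \<in> (\<lambda>D. \<sigma> ` D) ` Q"
    then obtain D where D: "D \<in> Q" "E = \<sigma> ` D" by blast
    have "D \<subseteq> Box" using D(1) in_components_subset S\<Omega> \<Omega>(3) unfolding Q_def by blast
    then have "\<phi> (\<sigma> x) > 0" if "x \<in> D" for x using \<phi>\<sigma>[of x] that D(1) unfolding Q_def by auto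
    then show "E \<in> P"
      using component_image_involution[OF \<sigma>(1,2) \<sigma>S, of D] D unfolding P_def Q_def by auto
  qed
  have injQ: "inj_on (\<lambda>D. \<sigma> ` D) Q"
  proof (rule inj_onI)
    fix D D' assume "\<sigma> ` D = \<sigma> ` D'"
    then have "\<sigma> ` \<sigma> ` D = \<sigma> ` \<sigma> ` D'" by simp
    then show "D = D'" by (simp add: image_image \<sigma>(2))
  qed
  have "finite P \<and> card P \<le> card C + 1"
  proof (rule ccontr)
    assume neg: "\<not> ?thesis"
    \<comment> \<open>One of these domains will be left out, and card C + 1 unknowns face card C
      equations.\<close>
    have "\<exists>R\<subseteq>P. finite R \<and> card R = card C + 2"
    proof (cases "finite P")
      case True
      then have "card C + 2 \<le> card P" using neg by auto
      then obtain R where "R \<subseteq> P" "card R = card C + 2" "finite R"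
        using obtain_subset_with_card_n by blast
      then show ?thesis by blast
    qed (use infinite_arbitrarily_large in blast)
    then obtain R where R: "R \<subseteq> P" "finite R" "card R = card C + 2" by blast
    then obtain D0 where D0: "D0 \<in> R" by fastforce
    define R' where "R' = R - {D0}"
    have R': "finite R'" "card C < card R'" "R' \<subseteq> P" using R D0 unfolding R'_def by auto
    define \<iota> :: "'a set \<Rightarrow> 'a \<Rightarrow> real" where "\<iota> D = indicator (closure D)" for D
    \<comment> \<open>The sign is plus because \<phi> is already odd: an invariant factor times
      \<phi> is the antisymmetrized restriction of \<phi> to \<open>D\<close>.\<close>
    define \<kappa>\<^sub>1 where "\<kappa>\<^sub>1 D x = \<iota> D (\<rho> x) + \<iota> D (\<sigma> (\<rho> x))" for D x
    have \<iota>c: "continuous_on {x\<in>\<Omega>. \<phi> x \<noteq> 0} (\<iota> D)" if "D \<in> R'" for D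
      unfolding \<iota>_def
      by (rule continuous_on_indicator_closure_component[OF \<Omega>(1,2) \<phi>c])
         (use that R'(3) in \<open>auto simp: P_def S_def\<close>)
    have \<kappa>\<^sub>1c: "continuous_on {x\<in>Box. \<phi> x \<noteq> 0} (\<kappa>\<^sub>1 D)" if "D \<in> R'" for D
      unfolding \<kappa>\<^sub>1_def
    proof (intro continuous_on_add)
      have 1: "continuous_on {x\<in>Box. \<phi> x \<noteq> 0} \<rho>" by (rule continuous_on_subset[OF \<rho>(1)]) auto
      show "continuous_on {x\<in>Box. \<phi> x \<noteq> 0} (\<lambda>x. \<iota> D (\<rho> x))"
        by (rule continuous_on_compose2[OF \<iota>c[OF that] 1]) (use \<rho>(2) \<phi>\<rho> in auto)
      have 2: "continuous_on {x\<in>Box. \<phi> x \<noteq> 0} (\<lambda>x. \<sigma> (\<rho> x))"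
        by (rule continuous_on_compose2[OF \<sigma>(1) 1]) auto
      show "continuous_on {x\<in>Box. \<phi> x \<noteq> 0} (\<lambda>x. \<iota> D (\<sigma> (\<rho> x)))"
      proof (rule continuous_on_compose2[OF \<iota>c[OF that] 2], clarsimp)
        fix x assume x: "x \<in> Box" "\<phi> x \<noteq> 0"
        have "\<rho> x \<in> \<Omega>" "\<rho> x \<in> Box" using \<rho>(2)[OF x(1)] \<Omega>(3) by auto
        then show "\<sigma> (\<rho> x) \<in> \<Omega> \<and> \<phi> (\<sigma> (\<rho> x)) \<noteq> 0"
          using \<sigma>(3) \<phi>\<sigma> \<phi>\<rho>[OF x(1)] x(2) by auto
      qed
    qed
    have \<kappa>\<^sub>1b: "\<bar>\<kappa>\<^sub>1 D x\<bar> \<le> 2" for D x unfolding \<kappa>\<^sub>1_def \<iota>_def by (auto simp: indicator_def)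
    define g where "g D x = \<kappa>\<^sub>1 D x * \<phi> x" for D x
    have gc: "continuous_on Box (g D)" if "D \<in> R'" for D
      unfolding g_def[abs_def] by (rule continuous_on_mult_zero_set[OF \<phi>c \<kappa>\<^sub>1b \<kappa>\<^sub>1c[OF that]])
    obtain c where c: "\<exists>D\<in>R'. c D \<noteq> 0" "\<forall>k\<in>C. (\<Sum>D\<in>R'. c D * ip (g D) (e k)) = 0"
      using underdetermined_system[OF C(1) R'(1,2), of "\<lambda>D k. ip (g D) (e k)"] by blast
    define \<kappa> where "\<kappa> x = (\<Sum>D\<in>R'. c D * \<kappa>\<^sub>1 D x)" for x
    have \<kappa>c: "continuous_on {x\<in>Box. \<phi> x \<noteq> 0} \<kappa>"
      unfolding \<kappa>_def[abs_def] by (intro continuous_on_sum continuous_on_mult continuous_on_const \<kappa>\<^sub>1c)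
    have fin: "finite (\<kappa> ` Box)"
      unfolding \<kappa>_def
    proof (rule finite_image_sum[OF R'(1)])
      fix D
      \<comment> \<open>The value 2 occurs only where both a point and its mirror image lie in the
        closure of \<open>D\<close>; there \<phi> = 0.\<close>
      have "(\<lambda>x. c D * \<kappa>\<^sub>1 D x) ` Box \<subseteq> {0, c D, 2 * c D}"
      proof (rule image_subsetI)
        fix x
        show "c D * \<kappa>\<^sub>1 D x \<in> {0, c D, 2 * c D}"
          unfolding \<kappa>\<^sub>1_def \<iota>_def
          by (cases "\<rho> x \<in> closure D"; cases "\<sigma> (\<rho> x) \<in> closure D") simp_all
      qed
      then show "finite ((\<lambda>x. c D * \<kappa>\<^sub>1 D x) ` Box)" by (rule finite_subset) simp
    qed
    define f where "f x = \<kappa> x * \<phi> x" for x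
    have f_sum: "f = (\<lambda>x. \<Sum>D\<in>R'. c D * g D x)"
      unfolding f_def \<kappa>_def g_def by (simp add: sum_distrib_right mult.assoc fun_eq_iff)
    have fc: "continuous_on Box f"
      unfolding f_sum by (intro continuous_on_sum continuous_on_mult continuous_on_const gc)
    have f0: "ip f (e k) = 0" if "k \<in> Idx" "lam k < l" for k
    proof (rule C(2)[OF fc _ _ _ that])
      fix x assume x: "x \<in> Box"
      have px: "\<rho> x \<in> \<Omega>" using \<rho>(2)[OF x] .
      show "f (\<rho> x) = f x"
        unfolding f_def \<kappa>_def \<kappa>\<^sub>1_def \<rho>(3)[OF px] \<phi>\<rho>[OF x] ..
      show "f (\<sigma> x) = - f x"
        unfolding f_def \<kappa>_def \<kappa>\<^sub>1_def \<sigma>(4)[OF x] \<sigma>(2) \<phi>\<sigma>[OF x] by (simp add: add.commute)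
    next
      fix k assume k: "k \<in> C"
      have "ip (e k) f = (\<Sum>D\<in>R'. c D * ip (e k) (g D))"
        unfolding f_sum by (rule ip_sum_right[OF R'(1) continuous_on_e gc])
      then show "ip f (e k) = 0"
        unfolding ip_commute[of "e k"] using c(2) k by simp
    qed
    obtain d where d: "\<And>x. x \<in> Box \<Longrightarrow> f x = (\<Sum>k\<in>{k\<in>Idx. lam k = l}. d k * e k x)"
      using locally_constant_multiple_eigenfunction[OF K \<phi>_def fin \<kappa>c f0[unfolded f_def] \<open>l \<ge> 0\<close>]
      unfolding f_def[symmetric] by blast
    have finl: "finite {k\<in>Idx. lam k = l}"
      by (rule finite_subset[OF _ finite_lam_le[of l]]) auto
    \<comment> \<open>On a positive domain the mirror term vanishes, as \<phi> is negative at the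
      image point but non-negative on the closure of every domain in \<open>P\<close>; and disjoint
      open sets do not meet each other's closures.\<close>
    have val: "\<kappa>\<^sub>1 D' x = (if D' = D then 1 else 0)" if "D \<in> P" "D' \<in> P" "x \<in> D" for D D' x
    proof -
      have xS: "x \<in> S" using that(1,3) in_components_subset[of D S] unfolding P_def by blast
      have x\<Omega>: "x \<in> \<Omega>" using xS S\<Omega> by blast
      have "\<phi> y \<ge> 0" if "y \<in> closure D'" for y
      proof -
        have "closed {y. \<phi> y \<ge> 0}" using \<phi>c[of UNIV] by (intro closed_Collect_le) (auto intro: continuous_on_const)
        moreover have "D' \<subseteq> {y. \<phi> y \<ge> 0}" using \<open>D' \<in> P\<close> by (auto simp: P_def intro: less_imp_le)
        ultimately have "closure D' \<subseteq> {y. \<phi> y \<ge> 0}" by (rule closure_minimal[rotated])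
        then show ?thesis using that by blast
      qed
      moreover have "\<phi> (\<sigma> x) < 0"
        using \<phi>\<sigma>[of x] x\<Omega> \<Omega>(3) that(1,3) unfolding P_def by auto
      ultimately have "\<sigma> x \<notin> closure D'" by force
      moreover have "x \<in> closure D' \<longleftrightarrow> D' = D"
      proof
        assume "x \<in> closure D'"
        then have "D \<inter> closure D' \<noteq> {}" using that(3) by auto
        then have "D \<inter> D' \<noteq> {}"
          using open_Int_closure_eq_empty[OF openD[of D], of D'] that(1) unfolding P_def by blast
        then show "D' = D" using components_nonoverlap[of D S D'] that(1,2) unfolding P_def by auto
      qed (use that(3) closure_subset in blast)
      ultimately show ?thesis
        unfolding \<kappa>\<^sub>1_def \<iota>_def \<rho>(3)[OF x\<Omega>] by (auto simp: indicator_def)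
    qed
    have DB: "D \<subseteq> Box" if "D \<in> P" for D
      using that in_components_subset[of D S] S\<Omega> \<Omega>(3) unfolding P_def by blast
    \<comment> \<open>The eigenfunction is zero on the omitted domain, hence everywhere by unique
      continuation, although it is a non-zero multiple of \<phi> on some domain of
      \<open>R'\<close>.\<close>
    have "(\<Sum>k\<in>{k\<in>Idx. lam k = l}. d k * e k x) = 0" for x
    proof (rule trig_zero_on_open[OF finl])
      show "open D0" "D0 \<noteq> {}"
        using openD[of D0] in_components_nonempty[of D0 S] D0 R(1) unfolding P_def by auto
      fix x assume x: "x \<in> D0"
      have D0P: "D0 \<in> P" using D0 R(1) by auto
      have "\<kappa> x = 0"
        unfolding \<kappa>_def
      proof (intro sum.neutral ballI)
        fix D assume D: "D \<in> R'"
        then have "D \<in> P" "D \<noteq> D0" using R'(3) unfolding R'_def by auto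
        then show "c D * \<kappa>\<^sub>1 D x = 0" using val[OF D0P _ x, of D] by simp
      qed
      then show "(\<Sum>k\<in>{k\<in>Idx. lam k = l}. d k * e k x) = 0"
        using d[of x] DB[OF D0P] x by (auto simp: f_def)
    qed
    then have fz: "f x = 0" if "x \<in> Box" for x using d[OF that] by simp
    obtain D where D: "D \<in> R'" "c D \<noteq> 0" using c(1) by blast
    have DP: "D \<in> P" using D R' by auto
    then obtain x where x: "x \<in> D" using in_components_nonempty[of D S] unfolding P_def by auto
    have "\<kappa> x = (\<Sum>D'\<in>R'. if D' = D then c D else 0)"
      unfolding \<kappa>_def
    proof (rule sum.cong[OF refl])
      fix D' assume "D' \<in> R'"
      then have "D' \<in> P" using R'(3) by blast
      then show "c D' * \<kappa>\<^sub>1 D' x = (if D' = D then c D else 0)" using val[OF DP _ x] by simp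
    qed
    also have "\<dots> = c D" using D(1) R'(1) by simp
    finally have "f x \<noteq> 0" using D(2) DP x unfolding f_def P_def by auto
    then show False using fz[of x] DB[OF DP] x by blast
  qed
  then have P: "finite P" "card P \<le> card C + 1" by auto
  have "finite Q" using finite_imageD[OF finite_subset[OF \<sigma>Q P(1)] injQ] .
  moreover have "card Q \<le> card P" by (rule card_inj_on_le[OF injQ \<sigma>Q P(1)])
  moreover have "card (P \<union> Q) \<le> card P + card Q" by (rule card_Un_le)
  ultimately show ?thesis unfolding nd PQ using P by auto
qed

end

section \<open>Eigenspaces\<close>

lemma sum_apply: "(\<Sum>a\<in>A. f a) x = (\<Sum>a\<in>A. f a x)"
  for f :: "'b \<Rightarrow> 'a \<Rightarrow> real"
  by (induction A rule: infinite_finite_induct) auto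

text \<open>The scaling is literally the one in \<open>multiplicity_of\<close>, so that its
  dimension is the one of this interpretation.\<close>

interpretation fv: vector_space "\<lambda>(c::real) (u :: 'a \<Rightarrow> real) x. c * u x"
  by unfold_locales (auto simp: algebra_simps fun_eq_iff)

lemma span_image_combination:
  fixes E :: "'p \<Rightarrow> 'a \<Rightarrow> real"
  assumes "finite A" "u \<in> fv.span (E ` A)"
  obtains c where "\<And>x. u x = (\<Sum>p\<in>A. c p * E p x)"
proof -
  let ?T = "{u. \<exists>c. u = (\<lambda>x. \<Sum>p\<in>A. c p * E p x)}"
  have "fv.span (E ` A) \<subseteq> ?T"
  proof (rule fv.span_minimal)
    show "E ` A \<subseteq> ?T"
    proof clarify
      fix p assume p: "p \<in> A"
      have "E p = (\<lambda>x. \<Sum>r\<in>A. (if r = p then 1 else 0) * E r x)"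
      proof
        fix x
        have "(\<Sum>r\<in>A. (if r = p then 1 else 0) * E r x) = (\<Sum>r\<in>A. if r = p then E p x else 0)"
          by (rule sum.cong) auto
        then show "E p x = (\<Sum>r\<in>A. (if r = p then 1 else 0) * E r x)" using assms(1) p by simp
      qed
      then show "\<exists>c. E p = (\<lambda>x. \<Sum>r\<in>A. c r * E r x)"
        by (intro exI[of _ "\<lambda>r. if r = p then 1 else 0"])
    qed
    show "fv.subspace ?T"
    proof (rule fv.subspaceI)
      show "0 \<in> ?T" by (intro CollectI exI[of _ "\<lambda>_. 0"]) (simp add: fun_eq_iff)
      show "u + v \<in> ?T" if "u \<in> ?T" "v \<in> ?T" for u v
      proof -
        from that obtain c d where "u = (\<lambda>x. \<Sum>p\<in>A. c p * E p x)" "v = (\<lambda>x. \<Sum>p\<in>A. d p * E p x)" by auto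
        then have "u + v = (\<lambda>x. \<Sum>p\<in>A. (c p + d p) * E p x)"
          by (simp add: fun_eq_iff distrib_right sum.distrib)
        then show ?thesis by auto
      qed
      show "(\<lambda>x. c * u x) \<in> ?T" if "u \<in> ?T" for c u
      proof -
        from that obtain d where "u = (\<lambda>x. \<Sum>p\<in>A. d p * E p x)" by auto
        then have "(\<lambda>x. c * u x) = (\<lambda>x. \<Sum>p\<in>A. (c * d p) * E p x)"
          by (simp add: fun_eq_iff sum_distrib_left mult.assoc)
        then show ?thesis by auto
      qed
    qed
  qed
  then show ?thesis using assms(2) that by blast
qed

lemma combination_in_span:
  fixes E :: "'p \<Rightarrow> 'a \<Rightarrow> real"
  shows "(\<lambda>x. \<Sum>p\<in>A. c p * E p x) \<in> fv.span (E ` A)"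
proof -
  have "(\<Sum>p\<in>A. (\<lambda>x. c p * E p x)) \<in> fv.span (E ` A)"
    by (intro fv.span_sum fv.span_scale fv.span_base) auto
  moreover have "(\<Sum>p\<in>A. (\<lambda>x. c p * E p x)) = (\<lambda>x. \<Sum>p\<in>A. c p * E p x)"
    by (simp add: fun_eq_iff sum_apply)
  ultimately show ?thesis by simp
qed

text \<open>Independence turns multiplicities into numbers of labels with the given eigenvalue;
  grouping the labels below l by their eigenvalue then counts them all.\<close>

theorem spectral_position_eq:
  fixes E :: "'p \<Rightarrow> 'a::euclidean_space \<Rightarrow> real"
  assumes es: "\<And>\<mu>. neumann_eigenspace \<Omega> \<mu> = fv.span (E ` {p\<in>Q. \<Lambda> p = \<mu>})"
    and ind: "\<And>F c p. finite F \<Longrightarrow> F \<subseteq> Q \<Longrightarrow> (\<And>x. (\<Sum>p\<in>F. c p * E p x) = 0) \<Longrightarrow> p \<in> F \<Longrightarrow> c p = 0"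
    and fin: "finite {p\<in>Q. \<Lambda> p < l}"
  shows "spectral_position \<Omega> l = card {p\<in>Q. \<Lambda> p < l} + 1"
proof -
  have inj: "inj_on E Q"
  proof (rule inj_onI, rule ccontr)
    fix p r assume *: "p \<in> Q" "r \<in> Q" "E p = E r" "p \<noteq> r"
    then have "(\<Sum>s\<in>{p, r}. (if s = p then 1 else - 1) * E s x) = 0" for x by simp
    from ind[OF _ _ this, of p] * show False by auto
  qed
  have indep: "fv.independent (E ` A)" if "A \<subseteq> Q" for A
  proof
    assume "fv.dependent (E ` A)"
    then obtain S u v where S: "finite S" "S \<subseteq> E ` A" "v \<in> S" "u v \<noteq> 0" "(\<Sum>v\<in>S. (\<lambda>x. u v * v x)) = 0"
      unfolding fv.dependent_explicit by blast
    obtain F where F: "F \<subseteq> A" "finite F" "S = E ` F"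
      using finite_subset_image[OF S(1,2)] by blast
    have injF: "inj_on E F" using inj F(1) that by (meson inj_on_subset subset_trans)
    have "(\<Sum>p\<in>F. u (E p) * E p x) = 0" for x
    proof -
      have "(\<Sum>v\<in>S. u v * v x) = 0"
        using fun_cong[OF S(5), of x] by (simp add: sum_apply)
      then show ?thesis unfolding F(3) using sum.reindex[OF injF, of "\<lambda>v. u v * v x"] by simp
    qed
    moreover obtain p where "p \<in> F" "v = E p" using S(3) F(3) by blast
    ultimately show False using ind[of F "\<lambda>p. u (E p)" p] F that S(4) by auto
  qed
  have mult: "multiplicity_of \<Omega> \<mu> = card {p\<in>Q. \<Lambda> p = \<mu>}" for \<mu>
  proof -
    have "multiplicity_of \<Omega> \<mu> = card (E ` {p\<in>Q. \<Lambda> p = \<mu>})"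
      unfolding multiplicity_of_def es by (intro fv.dim_span_eq_card_independent indep) auto
    also have "\<dots> = card {p\<in>Q. \<Lambda> p = \<mu>}"
      by (intro card_image inj_on_subset[OF inj]) auto
    finally show ?thesis .
  qed
  let ?P = "{p\<in>Q. \<Lambda> p < l}"
  \<comment> \<open>A number that is no value of \<open>\<Lambda>\<close> on \<open>Q\<close> has
    multiplicity 0, so only finitely many \<mu> contribute.\<close>
  have "{(\<mu>, i). i < multiplicity_of \<Omega> \<mu> \<and> \<mu> < l} = (SIGMA \<mu>:\<Lambda> ` ?P. {..<card {p\<in>Q. \<Lambda> p = \<mu>}})"
  proof (safe, unfold mult)
    fix \<mu> i assume "i < card {p\<in>Q. \<Lambda> p = \<mu>}" "\<mu> < l"
    then have "{p\<in>Q. \<Lambda> p = \<mu>} \<noteq> {}" by (metis card.empty not_less_zero)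
    then show "\<mu> \<in> \<Lambda> ` ?P" using \<open>\<mu> < l\<close> by blast
  qed auto
  then have "card {(\<mu>, i). i < multiplicity_of \<Omega> \<mu> \<and> \<mu> < l} = (\<Sum>\<mu>\<in>\<Lambda> ` ?P. card {p\<in>Q. \<Lambda> p = \<mu>})"
    using fin by simp
  also have "\<dots> = (\<Sum>\<mu>\<in>\<Lambda> ` ?P. card {p\<in>?P. \<Lambda> p = \<mu>})"
    by (intro sum.cong refl arg_cong[where f=card]) auto
  also have "\<dots> = card ?P"
  proof -
    have "card ?P = (\<Sum>p\<in>?P. 1)" by simp
    also have "\<dots> = (\<Sum>\<mu>\<in>\<Lambda> ` ?P. \<Sum>p\<in>{p\<in>?P. \<Lambda> p = \<mu>}. 1)"
      by (rule sum.group[symmetric]) (use fin in auto)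
    finally show ?thesis by simp
  qed
  finally show ?thesis by (simp add: spectral_position_def)
qed

lemma subspace_neumann_eigenspace:
  fixes \<Omega> :: "'a::euclidean_space set"
  shows "fv.subspace (neumann_eigenspace \<Omega> \<mu>)"
proof (rule fv.subspaceI)
  show "0 \<in> neumann_eigenspace \<Omega> \<mu>"
    unfolding neumann_eigenspace_def
  proof (intro CollectI conjI exI[of _ "\<lambda>_. 0"] exI[of _ 0])
    have "(\<bullet>) (0::'a) = (\<lambda>h. 0)" by (simp add: fun_eq_iff)
    then show "\<forall>x\<in>\<Omega>. (0 has_derivative (\<bullet>) 0) (at x within \<Omega>)" by (simp add: zero_fun_def)
    show "\<forall>x\<in>interior \<Omega>. ((\<lambda>_. 0::'a) has_derivative 0) (at x)"
      by (simp add: zero_fun_def)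
  qed auto
next
  fix u v assume "u \<in> neumann_eigenspace \<Omega> \<mu>" "v \<in> neumann_eigenspace \<Omega> \<mu>"
  then obtain G H G' H' where
    u: "\<forall>x. x \<notin> \<Omega> \<longrightarrow> u x = 0" "\<forall>x\<in>\<Omega>. (u has_derivative (\<lambda>h. G x \<bullet> h)) (at x within \<Omega>)" "continuous_on \<Omega> G"
       "\<forall>x\<in>interior \<Omega>. (G has_derivative H x) (at x)" "\<forall>h. continuous_on (interior \<Omega>) (\<lambda>x. H x h)"
       "\<forall>x\<in>interior \<Omega>. - (\<Sum>b\<in>Basis. H x b \<bullet> b) = \<mu> * u x"
       "\<forall>x\<in>frontier \<Omega>. \<forall>v\<in>outward_normal_cone \<Omega> x. G x \<bullet> v = 0"
    and v: "\<forall>x. x \<notin> \<Omega> \<longrightarrow> v x = 0" "\<forall>x\<in>\<Omega>. (v has_derivative (\<lambda>h. G' x \<bullet> h)) (at x within \<Omega>)" "continuous_on \<Omega> G'"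
       "\<forall>x\<in>interior \<Omega>. (G' has_derivative H' x) (at x)" "\<forall>h. continuous_on (interior \<Omega>) (\<lambda>x. H' x h)"
       "\<forall>x\<in>interior \<Omega>. - (\<Sum>b\<in>Basis. H' x b \<bullet> b) = \<mu> * v x"
       "\<forall>x\<in>frontier \<Omega>. \<forall>v\<in>outward_normal_cone \<Omega> x. G' x \<bullet> v = 0"
    unfolding neumann_eigenspace_def by blast
  show "u + v \<in> neumann_eigenspace \<Omega> \<mu>"
    unfolding neumann_eigenspace_def
  proof (intro CollectI conjI exI[of _ "\<lambda>x. G x + G' x"] exI[of _ "\<lambda>x h. H x h + H' x h"])
    show "\<forall>x\<in>\<Omega>. (u + v has_derivative (\<lambda>h. (G x + G' x) \<bullet> h)) (at x within \<Omega>)"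
      using has_derivative_add[OF u(2)[rule_format] v(2)[rule_format]] by (simp add: plus_fun_def inner_add_left)
    show "\<forall>x\<in>interior \<Omega>. - (\<Sum>b\<in>Basis. (H x b + H' x b) \<bullet> b) = \<mu> * (u + v) x"
      using u(6) v(6) by (simp add: inner_add_left sum.distrib distrib_left)
    show "\<forall>x\<in>interior \<Omega>. ((\<lambda>x. G x + G' x) has_derivative (\<lambda>h. H x h + H' x h)) (at x)"
      using u(4) v(4) by (auto intro: has_derivative_add)
  qed (use u v in \<open>auto intro!: continuous_intros simp: inner_add_left\<close>)
next
  fix c u assume "u \<in> neumann_eigenspace \<Omega> \<mu>"
  then obtain G H where
    u: "\<forall>x. x \<notin> \<Omega> \<longrightarrow> u x = 0" "\<forall>x\<in>\<Omega>. (u has_derivative (\<lambda>h. G x \<bullet> h)) (at x within \<Omega>)" "continuous_on \<Omega> G"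
       "\<forall>x\<in>interior \<Omega>. (G has_derivative H x) (at x)" "\<forall>h. continuous_on (interior \<Omega>) (\<lambda>x. H x h)"
       "\<forall>x\<in>interior \<Omega>. - (\<Sum>b\<in>Basis. H x b \<bullet> b) = \<mu> * u x"
       "\<forall>x\<in>frontier \<Omega>. \<forall>v\<in>outward_normal_cone \<Omega> x. G x \<bullet> v = 0"
    unfolding neumann_eigenspace_def by blast
  show "(\<lambda>x. c * u x) \<in> neumann_eigenspace \<Omega> \<mu>"
    unfolding neumann_eigenspace_def
  proof (intro CollectI conjI exI[of _ "\<lambda>x. c *\<^sub>R G x"] exI[of _ "\<lambda>x h. c *\<^sub>R H x h"])
    show "\<forall>x\<in>\<Omega>. ((\<lambda>x. c * u x) has_derivative (\<lambda>h. (c *\<^sub>R G x) \<bullet> h)) (at x within \<Omega>)"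
      using has_derivative_mult_right[OF u(2)[rule_format], of _ c] by simp
    show "\<forall>x\<in>interior \<Omega>. - (\<Sum>b\<in>Basis. (c *\<^sub>R H x b) \<bullet> b) = \<mu> * (c * u x)"
    proof
      fix x assume "x \<in> interior \<Omega>"
      then have "c * (- (\<Sum>b\<in>Basis. H x b \<bullet> b)) = c * (\<mu> * u x)" using u(6) by simp
      then show "- (\<Sum>b\<in>Basis. (c *\<^sub>R H x b) \<bullet> b) = \<mu> * (c * u x)"
        by (simp add: sum_distrib_left mult.left_commute)
    qed
    show "\<forall>x\<in>interior \<Omega>. ((\<lambda>x. c *\<^sub>R G x) has_derivative (\<lambda>h. c *\<^sub>R H x h)) (at x)"
      using u(4) by (auto intro: has_derivative_scaleR_right)
  qed (use u in \<open>auto intro!: continuous_intros\<close>)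
qed

context polytope
begin

text \<open>Green's second identity: the field w \<nabla>u - u \<nabla>w is tangential to the faces,
  and its divergence (\<nu> - \<mu>) u w is continuous up to the boundary. Eigenfunctions are thus
  orthogonal to every explicit \<open>w\<close> with another eigenvalue.\<close>

theorem neumann_green:
  assumes u: "u \<in> neumann_eigenspace \<Omega> \<mu>"
    and w: "\<And>x. (w has_derivative (\<lambda>h. Gw x \<bullet> h)) (at x)" "\<And>x. (Gw has_derivative Hw x) (at x)"
      "\<And>h. continuous_on UNIV (\<lambda>x. Hw x h)" "\<And>x. (\<Sum>b\<in>Basis. Hw x b \<bullet> b) = - \<nu> * w x"
    and bd: "\<And>x i. x \<in> \<Omega> \<Longrightarrow> i \<in> I \<Longrightarrow> a i \<bullet> x = d i \<Longrightarrow> a i \<bullet> Gw x = 0"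
  shows "(\<nu> - \<mu>) * integral \<Omega> (\<lambda>x. u x * w x) = 0" and "continuous_on \<Omega> u"
proof -
  obtain G H where
    u: "\<forall>x. x \<notin> \<Omega> \<longrightarrow> u x = 0" "\<forall>x\<in>\<Omega>. (u has_derivative (\<lambda>h. G x \<bullet> h)) (at x within \<Omega>)" "continuous_on \<Omega> G"
       "\<forall>x\<in>interior \<Omega>. (G has_derivative H x) (at x)" "\<forall>h. continuous_on (interior \<Omega>) (\<lambda>x. H x h)"
       "\<forall>x\<in>interior \<Omega>. - (\<Sum>b\<in>Basis. H x b \<bullet> b) = \<mu> * u x"
       "\<forall>x\<in>frontier \<Omega>. \<forall>v\<in>outward_normal_cone \<Omega> x. G x \<bullet> v = 0"
    using u unfolding neumann_eigenspace_def by blast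
  show uc: "continuous_on \<Omega> u"
    by (rule has_derivative_continuous_on) (use u(2) in blast)
  have wc: "continuous_on S w" for S
    by (intro continuous_at_imp_continuous_on ballI has_derivative_continuous[OF w(1)])
  have Gwc: "continuous_on S Gw" for S
    by (intro continuous_at_imp_continuous_on ballI has_derivative_continuous[OF w(2)])
  have UI: "U \<subseteq> interior \<Omega>" by (rule interior_maximal[OF U_subset_Omega open_U])
  have uU: "(u has_derivative (\<lambda>h. G x \<bullet> h)) (at x)" if "x \<in> U" for x
  proof -
    have "x \<in> \<Omega>" "x \<in> interior \<Omega>" using that UI U_subset_Omega by auto
    then show ?thesis using u(2) at_within_interior[of x \<Omega>] by metis
  qed
  define F where "F x = w x *\<^sub>R G x - u x *\<^sub>R Gw x" for x
  define DF where "DF x h = (w x *\<^sub>R H x h + (Gw x \<bullet> h) *\<^sub>R G x) - (u x *\<^sub>R Hw x h + (G x \<bullet> h) *\<^sub>R Gw x)" for x h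
  have "integral \<Omega> (\<lambda>x. (\<nu> - \<mu>) * (u x * w x)) = 0"
  proof (rule integral_divergence_zero[of F DF])
    fix x assume x: "x \<in> U"
    have xI: "x \<in> interior \<Omega>" using x UI by auto
    have GH: "(G has_derivative H x) (at x)" using u(4) xI by blast
    show "(F has_derivative DF x) (at x)"
      unfolding F_def[abs_def] DF_def[abs_def]
      by (intro has_derivative_diff has_derivative_scaleR uU[OF x] w GH)
    have "(\<Sum>b\<in>Basis. DF x b \<bullet> b) = w x * (\<Sum>b\<in>Basis. H x b \<bullet> b) - u x * (\<Sum>b\<in>Basis. Hw x b \<bullet> b)"
      unfolding DF_def
      by (simp add: inner_diff_left inner_add_left sum.distrib sum_subtractf sum_distrib_left mult.commute)
    moreover have "(\<Sum>b\<in>Basis. H x b \<bullet> b) = - \<mu> * u x" using u(6) xI by fastforce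
    ultimately show "(\<nu> - \<mu>) * (u x * w x) = (\<Sum>b\<in>Basis. DF x b \<bullet> b)"
      unfolding w(4) by (simp add: algebra_simps)
  next
    show "continuous_on U (\<lambda>x. DF x h)" for h
      unfolding DF_def
      by (intro continuous_intros continuous_on_subset[OF uc U_subset_Omega] continuous_on_subset[OF u(3) U_subset_Omega]
          continuous_on_subset[OF u(5)[rule_format] UI] continuous_on_subset[OF w(3)] wc Gwc) auto
  next
    fix x i assume x: "x \<in> \<Omega>" "i \<in> I" "a i \<bullet> x = d i"
    have "a i \<noteq> 0" using strict_c[OF x(2)] x(3) by auto
    have "x \<notin> interior \<Omega>"
    proof
      assume "x \<in> interior \<Omega>"
      then obtain r where r: "r > 0" "cball x r \<subseteq> \<Omega>" using mem_interior_cball by blast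
      \<comment> \<open>Moving outwards along the normal violates the constraint of face i, so
        \<open>x\<close> lies on the frontier.\<close>
      define y where "y = x + (r / norm (a i)) *\<^sub>R a i"
      have "y \<in> \<Omega>" using r \<open>a i \<noteq> 0\<close> unfolding y_def by (intro subsetD[OF r(2)]) (simp add: dist_norm)
      then have "a i \<bullet> y \<le> d i" using x(2) by (simp add: Omega_eq)
      moreover have "a i \<bullet> y = d i + r / norm (a i) * (a i \<bullet> a i)"
        unfolding y_def by (simp add: inner_add_right x(3))
      moreover have "r / norm (a i) * (a i \<bullet> a i) > 0" using r(1) \<open>a i \<noteq> 0\<close> by simp
      ultimately show False by linarith
    qed
    then have "x \<in> frontier \<Omega>" using x(1) closed_Omega by (simp add: frontier_def)
    moreover have "a i \<in> outward_normal_cone \<Omega> x"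
      unfolding outward_normal_cone_def using x by (auto simp: Omega_eq inner_diff_right)
    ultimately have "G x \<bullet> a i = 0" using u(7) by blast
    then show "a i \<bullet> F x = 0"
      using bd[OF x] by (simp add: F_def inner_diff_right inner_commute)
  next
    show "continuous_on \<Omega> F"
      unfolding F_def[abs_def] by (intro continuous_intros uc u(3) wc Gwc)
    show "continuous_on \<Omega> (\<lambda>x. (\<nu> - \<mu>) * (u x * w x))"
      by (intro continuous_intros uc wc)
  qed
  then show "(\<nu> - \<mu>) * integral \<Omega> (\<lambda>x. u x * w x) = 0" by simp
qed

end

section \<open>Derivatives of the cosine products and the eigenspaces of the box\<close>

context cos_box
begin

text \<open>A partial derivative of such a product replaces one factor, so one derivative rule
  yields both the gradient and the Hessian of \<open>e k\<close>.\<close>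

definition sep :: "('a \<Rightarrow> real \<Rightarrow> real) \<Rightarrow> 'a \<Rightarrow> real" where
  "sep p x = (\<Prod>b\<in>Basis. p b (x \<bullet> b))"

lemma sep_has_derivative:
  assumes "\<And>b t. b \<in> Basis \<Longrightarrow> (p b has_real_derivative p' b t) (at t)"
  shows "(sep p has_derivative (\<lambda>h. \<Sum>b\<in>Basis. (h \<bullet> b) * sep (p(b := p' b)) x)) (at x)"
proof -
  have "((\<lambda>x. p b (x \<bullet> b)) has_derivative (\<lambda>h. p' b (x \<bullet> b) * (h \<bullet> b))) (at x)" if "b \<in> Basis" for b
    by (rule has_derivative_compose[OF _ assms[OF that, unfolded has_field_derivative_def]])
       (auto intro!: derivative_eq_intros)
  from has_derivative_prod[where I=Basis, OF this]
  have "(sep p has_derivative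
      (\<lambda>h. \<Sum>b\<in>Basis. p' b (x \<bullet> b) * (h \<bullet> b) * (\<Prod>j\<in>Basis - {b}. p j (x \<bullet> j)))) (at x)"
    unfolding sep_def[abs_def] .
  moreover have "p' b (x \<bullet> b) * (h \<bullet> b) * (\<Prod>j\<in>Basis - {b}. p j (x \<bullet> j)) = (h \<bullet> b) * sep (p(b := p' b)) x"
    if "b \<in> Basis" for b h
  proof -
    have "sep (p(b := p' b)) x = p' b (x \<bullet> b) * (\<Prod>j\<in>Basis - {b}. (p(b := p' b)) j (x \<bullet> j))"
      unfolding sep_def using that by (subst prod.remove[of _ b]) auto
    also have "(\<Prod>j\<in>Basis - {b}. (p(b := p' b)) j (x \<bullet> j)) = (\<Prod>j\<in>Basis - {b}. p j (x \<bullet> j))"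
      by (rule prod.cong) auto
    finally show ?thesis by (simp only: mult.assoc mult.commute mult.left_commute)
  qed
  ultimately show ?thesis by (simp cong: sum.cong)
qed

lemma continuous_on_sep:
  assumes "\<And>b. b \<in> Basis \<Longrightarrow> continuous_on UNIV (p b)"
  shows "continuous_on S (sep p)"
  unfolding sep_def[abs_def]
  by (intro continuous_on_prod continuous_on_compose2[OF assms] continuous_intros) auto

definition cc :: "('a \<Rightarrow> nat) \<Rightarrow> 'a \<Rightarrow> real \<Rightarrow> real" where
  "cc k b t = cos (\<omega> b * real (k b) * t)"

definition cc' :: "('a \<Rightarrow> nat) \<Rightarrow> 'a \<Rightarrow> real \<Rightarrow> real" where
  "cc' k b t = - (\<omega> b * real (k b) * sin (\<omega> b * real (k b) * t))"

definition cc'' :: "('a \<Rightarrow> nat) \<Rightarrow> 'a \<Rightarrow> real \<Rightarrow> real" where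
  "cc'' k b t = - ((\<omega> b * real (k b))\<^sup>2 * cos (\<omega> b * real (k b) * t))"

lemma cc_deriv: "(cc k b has_real_derivative cc' k b t) (at t)"
  unfolding cc_def[abs_def] cc'_def by (auto intro!: derivative_eq_intros)

lemma cc'_deriv: "(cc' k b has_real_derivative cc'' k b t) (at t)"
  unfolding cc'_def[abs_def] cc''_def by (auto intro!: derivative_eq_intros simp: power2_eq_square)

lemma continuous_on_cc: "continuous_on S (cc k b)" "continuous_on S (cc' k b)" "continuous_on S (cc'' k b)"
  unfolding cc_def[abs_def] cc'_def[abs_def] cc''_def[abs_def] by (intro continuous_intros)+

lemma e_sep: "e k = sep (cc k)"
  by (simp add: fun_eq_iff e_def sep_def cc_def)

definition grad :: "('a \<Rightarrow> nat) \<Rightarrow> 'a \<Rightarrow> 'a" where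
  "grad k x = (\<Sum>b\<in>Basis. sep ((cc k)(b := cc' k b)) x *\<^sub>R b)"

text \<open>For \<open>j = b\<close> the second update overrides the first, and the factor is the
  second derivative; otherwise two different factors are differentiated once.\<close>

definition hess :: "('a \<Rightarrow> nat) \<Rightarrow> 'a \<Rightarrow> 'a \<Rightarrow> 'a" where
  "hess k x h = (\<Sum>b\<in>Basis. (\<Sum>j\<in>Basis. (h \<bullet> j) *
     sep ((cc k)(b := cc' k b, j := if j = b then cc'' k b else cc' k j)) x) *\<^sub>R b)"

lemma e_has_derivative: "(e k has_derivative (\<lambda>h. grad k x \<bullet> h)) (at x)"
proof -
  have "(sep (cc k) has_derivative (\<lambda>h. \<Sum>b\<in>Basis. (h \<bullet> b) * sep ((cc k)(b := cc' k b)) x)) (at x)"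
    by (rule sep_has_derivative) (rule cc_deriv)
  moreover have "(\<Sum>b\<in>Basis. (h \<bullet> b) * sep ((cc k)(b := cc' k b)) x) = grad k x \<bullet> h" for h
    by (simp add: grad_def inner_sum_left inner_commute[of h] mult.commute)
  ultimately show ?thesis by (simp add: e_sep)
qed

lemma grad_has_derivative: "(grad k has_derivative hess k x) (at x)"
proof -
  have "((\<lambda>x. sep ((cc k)(b := cc' k b)) x) has_derivative (\<lambda>h. \<Sum>j\<in>Basis. (h \<bullet> j) *
     sep (((cc k)(b := cc' k b))(j := (if j = b then cc'' k b else cc' k j))) x)) (at x)" for b
    by (rule sep_has_derivative) (auto intro: cc_deriv cc'_deriv)
  then have "((\<lambda>x. \<Sum>b\<in>Basis. sep ((cc k)(b := cc' k b)) x *\<^sub>R b) has_derivative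
     (\<lambda>h. \<Sum>b\<in>Basis. (\<Sum>j\<in>Basis. (h \<bullet> j) *
       sep ((cc k)(b := cc' k b, j := if j = b then cc'' k b else cc' k j)) x) *\<^sub>R b)) (at x)"
    by (intro has_derivative_sum has_derivative_scaleR_left)
  then show ?thesis by (simp add: grad_def[abs_def] hess_def[abs_def])
qed

lemma continuous_on_hess: "continuous_on S (\<lambda>x. hess k x h)"
  unfolding hess_def
  by (intro continuous_intros continuous_on_sep) (auto intro: continuous_on_cc)

lemma continuous_on_grad: "continuous_on S (grad k)"
  by (intro continuous_at_imp_continuous_on ballI has_derivative_continuous[OF grad_has_derivative])

lemma trace_hess: "(\<Sum>b\<in>Basis. hess k x b \<bullet> b) = - lam k * e k x"
proof -
  have "hess k x b \<bullet> b = - ((\<omega> b * real (k b))\<^sup>2) * e k x" if b: "b \<in> Basis" for b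
  proof -
    have "hess k x b \<bullet> b = (\<Sum>j\<in>Basis. (b \<bullet> j) * sep ((cc k)(b := cc' k b, j := if j = b then cc'' k b else cc' k j)) x)"
      unfolding hess_def using b by simp
    also have "\<dots> = (\<Sum>j\<in>Basis. if j = b then sep ((cc k)(b := cc'' k b)) x else 0)"
      by (rule sum.cong) (use b in \<open>auto simp: inner_Basis\<close>)
    also have "\<dots> = sep ((cc k)(b := cc'' k b)) x" using b by simp
    also have "\<dots> = cc'' k b (x \<bullet> b) * (\<Prod>j\<in>Basis - {b}. ((cc k)(b := cc'' k b)) j (x \<bullet> j))"
      unfolding sep_def using b by (subst prod.remove[of _ b]) auto
    also have "(\<Prod>j\<in>Basis - {b}. ((cc k)(b := cc'' k b)) j (x \<bullet> j)) = (\<Prod>j\<in>Basis - {b}. cc k j (x \<bullet> j))"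
      by (rule prod.cong) auto
    also have "cc'' k b (x \<bullet> b) * \<dots> = - ((\<omega> b * real (k b))\<^sup>2) * (cc k b (x \<bullet> b) * (\<Prod>j\<in>Basis - {b}. cc k j (x \<bullet> j)))"
      by (simp add: cc''_def cc_def)
    also have "cc k b (x \<bullet> b) * (\<Prod>j\<in>Basis - {b}. cc k j (x \<bullet> j)) = e k x"
      unfolding e_sep sep_def using b by (subst prod.remove[of _ b]) auto
    finally show ?thesis .
  qed
  then show ?thesis unfolding lam_def by (simp add: sum_negf sum_distrib_right)
qed

lemma grad_inner:
  assumes b: "b \<in> Basis"
  shows "grad k x \<bullet> b = cc' k b (x \<bullet> b) * (\<Prod>j\<in>Basis - {b}. cc k j (x \<bullet> j))"
proof -
  have "grad k x \<bullet> b = sep ((cc k)(b := cc' k b)) x" unfolding grad_def using b by simp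
  also have "\<dots> = cc' k b (x \<bullet> b) * (\<Prod>j\<in>Basis - {b}. ((cc k)(b := cc' k b)) j (x \<bullet> j))"
    unfolding sep_def using b by (subst prod.remove[of _ b]) auto
  also have "(\<Prod>j\<in>Basis - {b}. ((cc k)(b := cc' k b)) j (x \<bullet> j)) = (\<Prod>j\<in>Basis - {b}. cc k j (x \<bullet> j))"
    by (rule prod.cong) auto
  finally show ?thesis .
qed

lemma grad_face:
  assumes b: "b \<in> Basis" and x: "x \<bullet> b = 0 \<or> x \<bullet> b = pi / \<omega> b"
  shows "grad k x \<bullet> b = 0"
proof -
  have "\<omega> b * real (k b) * (pi / \<omega> b) = real (k b) * pi"
    using \<omega>_pos[OF b] by simp
  then have "sin (\<omega> b * real (k b) * (pi / \<omega> b)) = 0" by (simp only: sin_npi)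
  then have "cc' k b (x \<bullet> b) = 0" using x by (auto simp: cc'_def)
  then show ?thesis by (simp add: grad_inner[OF b])
qed

text \<open>The index (b, True) stands for the upper face orthogonal to \<open>b\<close>, (b, False)
  for the lower one.\<close>

lemma Box_polytope:
  "polytope (Basis \<times> UNIV) (\<lambda>(b, s). if s then b else - b) (\<lambda>(b, s). if s then pi / \<omega> b else 0)
     ((1 / 2) *\<^sub>R top_corner) Box"
proof
  show "Box = {x. \<forall>i\<in>Basis \<times> UNIV. (case i of (b, s) \<Rightarrow> if s then b else - b) \<bullet> x
      \<le> (case i of (b, s) \<Rightarrow> if s then pi / \<omega> b else 0)}"
    by (force simp: mem_Box inner_commute split: if_splits)
  show "bounded Box" using compact_Box compact_imp_bounded by blast
  show "(case i of (b, s) \<Rightarrow> if s then b else - b) \<bullet> ((1 / 2) *\<^sub>R top_corner) < (case i of (b, s) \<Rightarrow> if s then pi / \<omega> b else 0)"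
    if "i \<in> Basis \<times> UNIV" for i
    using that \<omega>_pos by (auto simp: top_corner_inner inner_commute[of _ top_corner] intro!: divide_strict_right_mono)
qed auto

definition eBox :: "('a \<Rightarrow> nat) \<Rightarrow> 'a \<Rightarrow> real" where
  "eBox k x = (if x \<in> Box then e k x else 0)"

text \<open>The condition on normals holds coordinate by coordinate. On a face orthogonal to
  \<open>b\<close> the derivative along \<open>b\<close> is 0; strictly between the two faces one
  can move both ways along \<open>b\<close>, so normals have no component there. Corners need no
  separate treatment.\<close>

lemma eBox_eigenfunction: "eBox k \<in> neumann_eigenspace Box (lam k)"
  unfolding neumann_eigenspace_def
proof (intro CollectI conjI exI[of _ "grad k"] exI[of _ "hess k"])
  show "\<forall>x\<in>Box. (eBox k has_derivative (\<lambda>h. grad k x \<bullet> h)) (at x within Box)"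
  proof
    fix x assume x: "x \<in> Box"
    show "(eBox k has_derivative (\<lambda>h. grad k x \<bullet> h)) (at x within Box)"
      by (rule has_derivative_transform[OF x _ has_derivative_at_withinI[OF e_has_derivative]]) (simp add: eBox_def)
  qed
  show "\<forall>x\<in>interior Box. - (\<Sum>b\<in>Basis. hess k x b \<bullet> b) = lam k * eBox k x"
    using interior_subset[of Box] by (auto simp: trace_hess eBox_def)
  show "\<forall>x\<in>frontier Box. \<forall>v\<in>outward_normal_cone Box x. grad k x \<bullet> v = 0"
  proof (intro ballI)
    fix x v assume "x \<in> frontier Box" and v: "v \<in> outward_normal_cone Box x"
    then have x: "x \<in> Box" using compact_Box by (metis compact_imp_closed frontier_subset_eq subsetD)
    have zero: "(grad k x \<bullet> b) * (v \<bullet> b) = 0" if b: "b \<in> Basis" for b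
    proof (cases "x \<bullet> b = 0 \<or> x \<bullet> b = pi / \<omega> b")
      case True
      then show ?thesis using grad_face[OF b] by simp
    next
      case False
      define t where "t = min (x \<bullet> b) (pi / \<omega> b - x \<bullet> b)"
      have t: "t > 0" using False x b unfolding t_def mem_Box by force
      have "x + s *\<^sub>R b \<in> Box" if "\<bar>s\<bar> \<le> t" for s
        unfolding mem_Box
      proof
        fix b' :: 'a assume b': "b' \<in> Basis"
        show "0 \<le> (x + s *\<^sub>R b) \<bullet> b' \<and> (x + s *\<^sub>R b) \<bullet> b' \<le> pi / \<omega> b'"
        proof (cases "b' = b")
          case True
          then show ?thesis using that b unfolding t_def by (auto simp: inner_add_left)
        next
          case False
          then show ?thesis using x b b' by (simp add: inner_add_left inner_not_same_Basis mem_Box)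
        qed
      qed
      from this[of t] this[of "- t"] have "v \<bullet> (t *\<^sub>R b) \<le> 0" "v \<bullet> (- t *\<^sub>R b) \<le> 0"
        using v t unfolding outward_normal_cone_def by fastforce+
      then have "t * (v \<bullet> b) = 0" by simp
      then show ?thesis using t by simp
    qed
    show "grad k x \<bullet> v = 0"
      unfolding euclidean_inner[of "grad k x" v] by (rule sum.neutral, rule ballI, rule zero)
  qed
qed (auto simp: eBox_def continuous_on_grad continuous_on_hess intro: grad_has_derivative)

lemma finite_lam_eq: "finite {k\<in>Idx. lam k = \<mu>}"
  by (rule finite_subset[OF _ finite_lam_le[of \<mu>]]) auto

lemma finite_lam_less: "finite {k\<in>Idx. lam k < \<mu>}"
  by (rule finite_subset[OF _ finite_lam_le[of \<mu>]]) auto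

text \<open>Green's identity kills every cosine coefficient at other eigenvalues, and a continuous
  function is determined by its coefficients.\<close>

theorem eigenspace_Box: "neumann_eigenspace Box \<mu> = fv.span (eBox ` {k\<in>Idx. lam k = \<mu>})"
proof
  show "fv.span (eBox ` {k\<in>Idx. lam k = \<mu>}) \<subseteq> neumann_eigenspace Box \<mu>"
    by (rule fv.span_minimal[OF _ subspace_neumann_eigenspace]) (use eBox_eigenfunction in auto)
next
  interpret B: polytope "Basis \<times> UNIV" "\<lambda>(b, s). if s then b else - b" "\<lambda>(b, s). if s then pi / \<omega> b else 0"
     "(1 / 2) *\<^sub>R top_corner" Box by (rule Box_polytope)
  show "neumann_eigenspace Box \<mu> \<subseteq> fv.span (eBox ` {k\<in>Idx. lam k = \<mu>})"
  proof
    fix u assume u: "u \<in> neumann_eigenspace Box \<mu>"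
    have face: "(case i of (b, s) \<Rightarrow> if s then b else - b) \<bullet> grad k x = 0"
      if "i \<in> Basis \<times> (UNIV :: bool set)" "(case i of (b, s) \<Rightarrow> if s then b else - b) \<bullet> x = (case i of (b, s) \<Rightarrow> if s then pi / \<omega> b else 0)"
      for x k and i :: "'a \<times> bool"
    proof -
      obtain b s where i: "i = (b, s)" by (cases i)
      have b: "b \<in> Basis" using that(1) i by simp
      have "x \<bullet> b = 0 \<or> x \<bullet> b = pi / \<omega> b"
        using that(2) unfolding i by (cases s) (auto simp: inner_commute)
      from grad_face[OF b this, of k] show ?thesis unfolding i by (simp add: inner_commute)
    qed
    note green = B.neumann_green[OF u e_has_derivative grad_has_derivative continuous_on_hess trace_hess face]
    have uc: "continuous_on Box u" by (rule green(2)) auto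
    have coef: "ip u (e k) = 0" if "k \<in> Idx" "k \<notin> {k\<in>Idx. lam k = \<mu>}" for k
    proof -
      have "(lam k - \<mu>) * integral Box (\<lambda>x. u x * e k x) = 0" by (rule green(1)) auto
      then show ?thesis using that by (auto simp: ip_def)
    qed
    have "u = (\<lambda>x. \<Sum>k\<in>{k\<in>Idx. lam k = \<mu>}. ip u (e k) / ip (e k) (e k) * eBox k x)"
    proof
      fix x
      show "u x = (\<Sum>k\<in>{k\<in>Idx. lam k = \<mu>}. ip u (e k) / ip (e k) (e k) * eBox k x)"
      proof (cases "x \<in> Box")
        case True
        then show ?thesis using eq_trig_of_coeffs[OF uc finite_lam_eq _ coef True] by (simp add: eBox_def)
      next
        case False
        then show ?thesis using u by (simp add: eBox_def neumann_eigenspace_def)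
      qed
    qed
    then show "u \<in> fv.span (eBox ` {k\<in>Idx. lam k = \<mu>})"
      by (rule ssubst) (rule combination_in_span)
  qed
qed

lemma e_independent:
  assumes "finite F" "F \<subseteq> Idx" and z: "\<And>x. x \<in> Box \<Longrightarrow> (\<Sum>k\<in>F. c k * e k x) = 0" and p: "p \<in> F"
  shows "c p = 0"
proof -
  have "0 = ip (e p) (\<lambda>x. \<Sum>k\<in>F. c k * e k x)"
    unfolding ip_def using z by (simp cong: integral_cong)
  also have "\<dots> = (\<Sum>k\<in>F. c k * ip (e p) (e k))"
    by (rule ip_sum_right[OF assms(1) continuous_on_e continuous_on_e])
  also have "\<dots> = (\<Sum>k\<in>F. if k = p then c p * ip (e p) (e p) else 0)"
  proof (rule sum.cong[OF refl])
    fix k assume "k \<in> F"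
    then show "c k * ip (e p) (e k) = (if k = p then c p * ip (e p) (e p) else 0)"
      using ip_e_orthogonal[of p k] p assms(2) by (cases "k = p") auto
  qed
  also have "\<dots> = c p * ip (e p) (e p)" using p assms(1) by simp
  finally show ?thesis using ip_e_self_pos[of p] by simp
qed

lemma spectral_position_Box: "spectral_position Box l = card {k\<in>Idx. lam k < l} + 1"
proof (rule spectral_position_eq[OF eigenspace_Box _ finite_lam_less])
  fix F c p assume F: "finite F" "F \<subseteq> Idx" "p \<in> F" and z: "\<And>x. (\<Sum>k\<in>F. c k * eBox k x) = 0"
  have "(\<Sum>k\<in>F. c k * e k x) = 0" if "x \<in> Box" for x
    using z[of x] that by (simp add: eBox_def)
  then show "c p = 0" by (rule e_independent[OF F(1,2) _ F(3)])
qed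

end

section \<open>Parity and counting\<close>

text \<open>Modulo 2 the matrix is upper unitriangular, so its determinant is odd and non-zero.
  Instead of determinants, division-free elimination is used.\<close>

lemma odd_diagonal_system_trivial:
  fixes x :: "nat \<Rightarrow> real" and M :: "nat \<Rightarrow> nat \<Rightarrow> int"
  assumes "\<And>i. i < n \<Longrightarrow> (\<Sum>j<n. real_of_int (M i j) * x j) = 0"
    and "\<And>i. i < n \<Longrightarrow> odd (M i i)" and "\<And>i j. j < i \<Longrightarrow> i < n \<Longrightarrow> even (M i j)"
    and "j < n"
  shows "x j = 0"
  using assms
proof (induction n arbitrary: M j)
  case (Suc n)
  \<comment> \<open>The last unknown is eliminated with the last row. The entries of this row before
    the diagonal are even and \<open>M n n\<close> is odd, so \<open>M'\<close> has the parities of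
    \<open>M\<close>.\<close>
  define M' where "M' i j = M n n * M i j - M i n * M n j" for i j
  have IH: "x j = 0" if "j < n" for j
  proof (rule Suc.IH[of M', OF _ _ _ that])
    fix i assume i: "i < n"
    have "(\<Sum>j<n. real_of_int (M' i j) * x j) =
       real_of_int (M n n) * (\<Sum>j<Suc n. real_of_int (M i j) * x j) - real_of_int (M i n) * (\<Sum>j<Suc n. real_of_int (M n j) * x j)"
      by (simp add: M'_def left_diff_distrib sum_subtractf sum_distrib_left algebra_simps)
    also have "\<dots> = 0" using Suc.prems(1)[of i] Suc.prems(1)[of n] i by simp
    finally show "(\<Sum>j<n. real_of_int (M' i j) * x j) = 0" .
    show "odd (M' i i)"
      using Suc.prems(2)[of i] Suc.prems(2)[of n] Suc.prems(3)[of i n] i by (simp add: M'_def)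
    show "even (M' i j)" if "j < i" for j
      using Suc.prems(3)[of j i] Suc.prems(3)[of j n] i that by (simp add: M'_def)
  qed
  have "real_of_int (M n n) * x n = (\<Sum>j<Suc n. real_of_int (M n j) * x j)"
    using IH by simp
  then have "real_of_int (M n n) * x n = 0" using Suc.prems(1)[of n] by simp
  moreover have "M n n \<noteq> 0" using Suc.prems(2)[of n] by force
  ultimately have "x n = 0" by simp
  then show ?case using IH Suc.prems(4) by (cases "j = n") auto
qed simp

text \<open>Modulo the relation \<open>c\<^sup>n = 2\<close>, multiplication by \<open>c\<^sup>i\<close> shifts the coefficients cyclically, doubling
  those that wrap around; the \<open>n\<close> shifts of a relation with odd constant term thus form a matrix that
  is unitriangular modulo \<open>2\<close>.\<close>

lemma root_of_two_relation_even:
  fixes c :: real and a :: "nat \<Rightarrow> int"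
  assumes c: "c ^ n = 2" and n: "n > 0" and rel: "(\<Sum>j<n. real_of_int (a j) * c ^ j) = 0"
  shows "even (a 0)"
proof (rule ccontr)
  assume odd: "odd (a 0)"
  define M where "M i j = (if i \<le> j then a (j - i) else 2 * a (j + n - i))" for i j
  \<comment> \<open>The powers of \<open>c\<close> solve the homogeneous system, whose row i is the
    relation multiplied by c^i.\<close>
  have "c ^ 0 = 0"
  proof (rule odd_diagonal_system_trivial[of n M "\<lambda>j. c ^ j"])
    fix i assume i: "i < n"
    have "(\<Sum>j<n. real_of_int (M i j) * c ^ j) =
       (\<Sum>j\<in>{..<i}. real_of_int (M i j) * c ^ j) + (\<Sum>j\<in>{i..<n}. real_of_int (M i j) * c ^ j)"
      using i sum.atLeastLessThan_concat[of 0 i n "\<lambda>j. real_of_int (M i j) * c ^ j"]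
      by (simp add: atLeast0LessThan)
    also have "(\<Sum>j\<in>{..<i}. real_of_int (M i j) * c ^ j) = (\<Sum>j\<in>{n - i..<n}. c ^ i * (real_of_int (a j) * c ^ j))"
    proof (rule sum.reindex_bij_witness[of _ "\<lambda>j. j + i - n" "\<lambda>j. j + n - i"])
      fix j assume j: "j \<in> {..<i}"
      have "c ^ i * c ^ (j + n - i) = c ^ n * c ^ j"
        using i j by (simp add: power_add[symmetric] add.commute)
      then show "c ^ i * (real_of_int (a (j + n - i)) * c ^ (j + n - i)) = real_of_int (M i j) * c ^ j"
        using j by (simp add: M_def c mult.left_commute)
    qed (use i in auto)
    also have "(\<Sum>j\<in>{i..<n}. real_of_int (M i j) * c ^ j) = (\<Sum>j\<in>{0..<n - i}. c ^ i * (real_of_int (a j) * c ^ j))"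
    proof (rule sum.reindex_bij_witness[of _ "\<lambda>j. j + i" "\<lambda>j. j - i"])
      fix j assume j: "j \<in> {i..<n}"
      have "c ^ i * c ^ (j - i) = c ^ j" using j by (simp add: power_add[symmetric])
      then show "c ^ i * (real_of_int (a (j - i)) * c ^ (j - i)) = real_of_int (M i j) * c ^ j"
        using j by (simp add: M_def mult.left_commute)
    qed (use i in auto)
    also have "(\<Sum>j\<in>{n - i..<n}. c ^ i * (real_of_int (a j) * c ^ j)) + (\<Sum>j\<in>{0..<n - i}. c ^ i * (real_of_int (a j) * c ^ j))
      = c ^ i * (\<Sum>j<n. real_of_int (a j) * c ^ j)"
      using sum.atLeastLessThan_concat[of 0 "n - i" n "\<lambda>j. c ^ i * (real_of_int (a j) * c ^ j)"]
      by (simp add: atLeast0LessThan sum_distrib_left add.commute)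
    finally show "(\<Sum>j<n. real_of_int (M i j) * c ^ j) = 0" using rel by simp
  qed (use odd n in \<open>auto simp: M_def\<close>)
  then show False by simp
qed

text \<open>Exponents may exceed n and agree modulo n, as 2 (j - 1) does for the boxes. Reducing
  them by c^n = 2 sends positive multiples of n to the constant term with an even factor, so that
  only \<open>t i0\<close> decides its parity.\<close>

lemma root_of_two_power_relation_even:
  fixes c :: real and t :: "'i \<Rightarrow> int" and p :: "'i \<Rightarrow> nat"
  assumes c: "c ^ n = 2" and n: "n > 0" and J: "finite J" "i0 \<in> J" "p i0 = 0" "\<And>i. i \<in> J \<Longrightarrow> i \<noteq> i0 \<Longrightarrow> p i > 0"
    and rel: "(\<Sum>i\<in>J. real_of_int (t i) * c ^ p i) = 0"
  shows "even (t i0)"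
proof -
  define a where "a j = (\<Sum>i\<in>{i\<in>J. p i mod n = j}. t i * 2 ^ (p i div n))" for j
  have cp: "c ^ p i = 2 ^ (p i div n) * c ^ (p i mod n)" for i
  proof -
    have "c ^ p i = c ^ (n * (p i div n) + p i mod n)" by simp
    also have "\<dots> = (c ^ n) ^ (p i div n) * c ^ (p i mod n)" by (simp only: power_add power_mult)
    finally show ?thesis by (simp add: c)
  qed
  have "(\<Sum>j<n. real_of_int (a j) * c ^ j) = (\<Sum>j<n. \<Sum>i\<in>{i\<in>J. p i mod n = j}. real_of_int (t i) * c ^ p i)"
    unfolding a_def of_int_sum sum_distrib_right
    by (intro sum.cong refl) (auto simp: cp)
  also have "\<dots> = (\<Sum>i\<in>J. real_of_int (t i) * c ^ p i)"
    by (rule sum.group) (use J n in auto)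
  finally have "even (a 0)" using root_of_two_relation_even[OF c n] rel by simp
  moreover have "a 0 = t i0 + (\<Sum>i\<in>{i\<in>J. p i mod n = 0} - {i0}. t i * 2 ^ (p i div n))"
    unfolding a_def by (subst sum.remove[of _ i0]) (use J in auto)
  moreover have "even (\<Sum>i\<in>{i\<in>J. p i mod n = 0} - {i0}. t i * 2 ^ (p i div n))"
  proof (rule dvd_sum)
    fix i assume i: "i \<in> {i\<in>J. p i mod n = 0} - {i0}"
    then have "p i > 0" "n dvd p i" using J(4) by auto
    then have "p i div n > 0" using n by (auto simp: dvd_def)
    then show "even (t i * 2 ^ (p i div n))" by simp
  qed
  ultimately show ?thesis by simp
qed

text \<open>(2 o' + c + 1) - (2 o' + 2) = c - 1, uniformly over the eigenfunctions.\<close>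

lemma nodal_deficiency_ge:
  assumes bd: "\<And>u. u \<in> neumann_eigenfunctions \<Omega> l \<Longrightarrow> finite (nodal_domains \<Omega> u) \<and> card (nodal_domains \<Omega> u) \<le> 2 * o' + 2"
    and pos: "spectral_position \<Omega> l = o' + e' + 1" and eq: "e' = o' + c"
  shows "nodal_deficiency \<Omega> l \<ge> ereal (real c - 1)"
  unfolding nodal_deficiency_def
proof (rule INF_greatest)
  fix u assume "u \<in> neumann_eigenfunctions \<Omega> l"
  from bd[OF this] have f: "finite (nodal_domains \<Omega> u)" "card (nodal_domains \<Omega> u) \<le> 2 * o' + 2" by auto
  have "real c - 1 \<le> real (spectral_position \<Omega> l) - real (card (nodal_domains \<Omega> u))"
    unfolding pos eq using f(2) by linarith
  then show "ereal (real c - 1) \<le> deficiency_of \<Omega> l u"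
    by (simp add: deficiency_of_def nodal_count_def f(1))
qed

section \<open>Parity of the cosine products under reflections\<close>

context cos_box
begin

lemma e_reflect:
  assumes "J \<subseteq> Basis"
  shows "e k (reflect_coords J 0 top_corner x) = (-1) ^ (\<Sum>b\<in>J. k b) * e k x"
proof -
  have "cos (\<omega> b * real (k b) * (reflect_coords J 0 top_corner x \<bullet> b)) =
      (if b \<in> J then (-1) ^ k b else 1) * cos (\<omega> b * real (k b) * (x \<bullet> b))" if b: "b \<in> Basis" for b
  proof (cases "b \<in> J")
    case True
    have "\<omega> b * real (k b) * (pi / \<omega> b - x \<bullet> b) = real (k b) * pi - \<omega> b * real (k b) * (x \<bullet> b)"
      using \<omega>_pos[OF b] by (simp add: right_diff_distrib)
    then show ?thesis
      using True b by (simp add: inner_reflect_coords top_corner_inner cos_diff)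
  qed (use b in \<open>simp add: inner_reflect_coords\<close>)
  then have "e k (reflect_coords J 0 top_corner x) =
     (\<Prod>b\<in>Basis. (if b \<in> J then (-1) ^ k b else 1) * cos (\<omega> b * real (k b) * (x \<bullet> b)))"
    unfolding e_def by (intro prod.cong) auto
  also have "\<dots> = (\<Prod>b\<in>Basis. (if b \<in> J then (-1) ^ k b else 1)) * e k x"
    by (simp add: prod.distrib e_def)
  also have "(\<Prod>b\<in>Basis. (if b \<in> J then (-1) ^ k b else (1::real))) = (\<Prod>b\<in>J. (-1) ^ k b)"
    using assms by (simp add: prod.If_cases Int_absorb1)
  also have "\<dots> = (-1) ^ (\<Sum>b\<in>J. k b)" by (simp add: power_sum)
  finally show ?thesis .
qed

lemma ip_reflect:
  assumes "continuous_on Box f" "continuous_on Box g"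
  shows "ip (\<lambda>x. f (reflect_coords J 0 top_corner x)) (\<lambda>x. g (reflect_coords J 0 top_corner x)) = ip f g"
proof -
  have "((\<lambda>x. f x * g x) has_integral ip f g) (cbox 0 top_corner)"
    unfolding ip_def Box_def[symmetric] by (intro integrable_integral integrable_Box continuous_intros assms)
  from has_integral_reflect_coords[OF this, of J] show ?thesis
    unfolding ip_def Box_def[symmetric] by (rule integral_unique)
qed

text \<open>The source of the saving against Courant's bound: antisymmetry makes orthogonality to
  the even modes automatic.\<close>

lemma ip_e_zero_of_odd:
  assumes f: "continuous_on Box f" and J: "J \<subseteq> Basis"
    and odd: "\<And>x. x \<in> Box \<Longrightarrow> f (reflect_coords J 0 top_corner x) = - f x" and ev: "even (\<Sum>b\<in>J. k b)"
  shows "ip f (e k) = 0"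
proof -
  have "ip f (e k) = ip (\<lambda>x. f (reflect_coords J 0 top_corner x)) (\<lambda>x. e k (reflect_coords J 0 top_corner x))"
    by (rule ip_reflect[symmetric]) (intro f continuous_on_e)+
  also have "\<dots> = ip (\<lambda>x. (- 1) * f x) (e k)"
    by (rule ip_cong) (use ev in \<open>auto simp: odd e_reflect[OF J]\<close>)
  also have "\<dots> = (- 1) * ip f (e k)"
    unfolding ip_commute[of _ "e k"] by (rule ip_scale_right)
  finally show ?thesis by simp
qed

lemma reflect_coords_involution: "reflect_coords J l u (reflect_coords J l u x) = x"
  by (rule euclidean_eqI) (simp add: inner_reflect_coords)

end

section \<open>The boxes\<close>

definition omega_box :: "(real, 'n::{finite,linorder}) vec \<Rightarrow> real" where
  "omega_box b = box_gamma CARD('n) ^ position (axis_index b)"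

lemma box_gamma_pos: "box_gamma n > 0"
  by (simp add: box_gamma_def)

lemma box_gamma_power: "n > 0 \<Longrightarrow> box_gamma n ^ n = 2"
  by (simp add: box_gamma_def powr_realpow[symmetric] powr_powr)

global_interpretation bx: cos_box "omega_box :: (real, 'n::{finite,linorder}) vec \<Rightarrow> real"
  by unfold_locales (simp add: omega_box_def box_gamma_pos)

lemma position_first_index: "position (first_index :: 'n::{finite,linorder}) = 0"
proof -
  have "{i::'n. i < first_index} = {}"
    unfolding first_index_def using Min_le[of "UNIV :: 'n set"] by (auto simp: not_less[symmetric])
  then show ?thesis by (simp add: position_def)
qed

lemma position_pos:
  assumes "j \<noteq> (first_index :: 'n::{finite,linorder})"
  shows "position j > 0"
proof -
  have "first_index < j"
    using Min_le[of "UNIV :: 'n set" j] assms unfolding first_index_def by (simp add: order_less_le)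
  then have "first_index \<in> {i. i < j}" by simp
  then show ?thesis unfolding position_def by (intro card_gt_0_iff[THEN iffD2]) auto
qed

lemma Basis_axis: "(Basis :: ((real, 'n::finite) vec) set) = range (\<lambda>j. axis j 1)"
  by (auto simp: Basis_vec_def)

lemma inj_axis: "inj (\<lambda>j. axis j (1::real) :: (real, 'n::finite) vec)"
  by (auto simp: inj_on_def axis_eq_axis)

lemma omega_box_axis: "omega_box (axis j 1 :: (real, 'n::{finite,linorder}) vec) = box_gamma CARD('n) ^ position j"
  by (simp add: omega_box_def)

lemma box_domain_eq: "box_domain = (bx.Box :: (real, 'n::{finite,linorder}) vec set)"
  unfolding box_domain_def by (auto simp: bx.mem_Box Basis_axis omega_box_axis inner_axis)

text \<open>Carries quantum numbers over to multi-indices on basis vectors, with the value 0 off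
  \<open>Basis\<close> that \<open>Idx\<close> demands.\<close>

definition axis_fun :: "('n::{finite,linorder} \<Rightarrow> nat) \<Rightarrow> (real, 'n) vec \<Rightarrow> nat" where
  "axis_fun m b = (if b \<in> Basis then m (axis_index b) else 0)"

lemma axis_fun_axis [simp]: "axis_fun m (axis j 1) = m j"
  by (simp add: axis_fun_def axis_in_Basis_iff)

lemma lam_axis_fun:
  fixes m :: "'n::{finite,linorder} \<Rightarrow> nat"
  shows "bx.lam (axis_fun m) = box_lambda m"
  unfolding bx.lam_def box_lambda_def Basis_axis
  by (subst sum.reindex[OF inj_axis]) (simp add: omega_box_axis)

lemma bij_axis_fun: "bij_betw axis_fun UNIV bx.Idx"
proof (rule bij_betw_byWitness[where f'="\<lambda>k j. k (axis j 1)"])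
  show "\<forall>k\<in>bx.Idx. axis_fun (\<lambda>j. k (axis j 1)) = k"
    by (auto simp: bx.Idx_def axis_fun_def fun_eq_iff axis_index[symmetric])
qed (auto simp: bx.Idx_def axis_fun_def axis_in_Basis_iff)

lemma card_axis_fun: "card {k\<in>bx.Idx. P k} = card {m. P (axis_fun m)}"
proof -
  have "bij_betw axis_fun {m. P (axis_fun m)} {k\<in>bx.Idx. P k}"
    using bij_axis_fun unfolding bij_betw_def by (auto intro: inj_on_subset)
  then show ?thesis by (simp add: bij_betw_same_card)
qed

lemma finite_box_Q_below: "finite (box_Q_below l :: ('n::{finite,linorder} \<Rightarrow> nat) set)"
proof -
  have "axis_fun ` (box_Q_below l :: ('n \<Rightarrow> nat) set) \<subseteq> {k\<in>bx.Idx. bx.lam k < l}"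
    using bij_betw_imp_surj_on[OF bij_axis_fun] by (auto simp: box_Q_below_def lam_axis_fun)
  then have "finite (axis_fun ` (box_Q_below l :: ('n \<Rightarrow> nat) set))"
    using bx.finite_lam_less finite_subset by blast
  then show ?thesis
    by (rule finite_imageD) (meson bij_axis_fun bij_betw_imp_inj_on inj_on_subset subset_UNIV)
qed

text \<open>Equal eigenvalues give an integer relation between powers of gamma_n whose coefficients
  are differences of squares; its constant term belongs to the first coordinate and must be even.
  Hence all eigenfunctions of an odd eigenvalue are odd in that coordinate.\<close>

lemma box_lambda_parity:
  fixes m m' :: "'n::{finite,linorder} \<Rightarrow> nat"
  assumes "box_lambda m = box_lambda m'"
  shows "even (m first_index) \<longleftrightarrow> even (m' first_index)"
proof -
  let ?c = "box_gamma CARD('n)"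
  have "even (int (m first_index) ^ 2 - int (m' first_index) ^ 2)"
  proof (rule root_of_two_power_relation_even[where c="?c" and n="CARD('n)" and J=UNIV
        and p="\<lambda>j. 2 * position j" and t="\<lambda>j. int (m j) ^ 2 - int (m' j) ^ 2"])
    show "?c ^ CARD('n) = 2" by (rule box_gamma_power) simp
    have "(\<Sum>j\<in>UNIV. real_of_int (int (m j) ^ 2 - int (m' j) ^ 2) * ?c ^ (2 * position j)) = box_lambda m - box_lambda m'"
      unfolding box_lambda_def sum_subtractf[symmetric]
      by (rule sum.cong) (auto simp: power_mult_distrib power_mult[symmetric] mult.commute[of 2] algebra_simps)
    then show "(\<Sum>j\<in>UNIV. real_of_int (int (m j) ^ 2 - int (m' j) ^ 2) * ?c ^ (2 * position j)) = 0"
      using assms by simp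
  qed (simp_all add: position_first_index position_pos)
  then show ?thesis by simp
qed

lemma box_lambda_mono_first:
  fixes m :: "'n::{finite,linorder} \<Rightarrow> nat"
  assumes "m first_index \<le> i"
  shows "box_lambda m \<le> box_lambda (m(first_index := i))"
  unfolding box_lambda_def
proof (rule sum_mono)
  fix j :: 'n
  let ?g = "box_gamma CARD('n) ^ position j"
  have "?g \<ge> 0" using box_gamma_pos by (intro zero_le_power less_imp_le)
  moreover have "m j \<le> (m(first_index := i)) j" using assms by simp
  ultimately show "(?g * real (m j))\<^sup>2 \<le> (?g * real ((m(first_index := i)) j))\<^sup>2"
    by (intro power_mono mult_left_mono mult_nonneg_nonneg) (simp_all only: of_nat_le_iff of_nat_0_le_iff)
qed

lemma card_box_even:
  fixes l :: real
  defines "Q \<equiv> (box_Q_below l :: ('n::{finite,linorder} \<Rightarrow> nat) set)"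
  shows "card (Q \<inter> box_even) = card (Q \<inter> box_odd) + card (box_right_boundary Q \<inter> box_even)"
proof -
  let ?f = "first_index :: 'n"
  have fin: "finite Q" unfolding Q_def by (rule finite_box_Q_below)
  have "bij_betw (\<lambda>m. m(?f := m ?f - 1)) (Q \<inter> box_odd) (Q \<inter> box_even - box_right_boundary Q)"
  proof (rule bij_betw_byWitness[where f'="\<lambda>m. m(?f := m ?f + 1)"])
    show "\<forall>m\<in>Q \<inter> box_odd. (m(?f := m ?f - 1))(?f := (m(?f := m ?f - 1)) ?f + 1) = m"
      by (auto simp: box_odd_def fun_eq_iff odd_pos)
    show "\<forall>m\<in>Q \<inter> box_even - box_right_boundary Q. (m(?f := m ?f + 1))(?f := (m(?f := m ?f + 1)) ?f - 1) = m"
      by (auto simp: fun_eq_iff)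
    show "(\<lambda>m. m(?f := m ?f - 1)) ` (Q \<inter> box_odd) \<subseteq> Q \<inter> box_even - box_right_boundary Q"
    proof (rule image_subsetI)
      fix m assume m: "m \<in> Q \<inter> box_odd"
      let ?m = "m(?f := m ?f - 1)"
      have od: "odd (m ?f)" using m by (auto simp: box_odd_def)
      have shift_back: "?m(?f := ?m ?f + 1) = m" using od by (auto simp: fun_eq_iff odd_pos)
      \<comment> \<open>Lowering the first quantum number lowers the eigenvalue, so the left
        neighbour stays in \<open>Q\<close>.\<close>
      have "box_lambda ?m \<le> box_lambda (?m(?f := m ?f))" by (rule box_lambda_mono_first) simp
      then have "?m \<in> Q" using m by (simp add: Q_def box_Q_below_def)
      moreover have "?m \<in> box_even" using od by (simp add: box_even_def)
      moreover have "?m \<notin> box_right_boundary Q"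
        unfolding box_right_boundary_def using shift_back m by simp
      ultimately show "?m \<in> Q \<inter> box_even - box_right_boundary Q" by blast
    qed
    show "(\<lambda>m. m(?f := m ?f + 1)) ` (Q \<inter> box_even - box_right_boundary Q) \<subseteq> Q \<inter> box_odd"
      by (auto simp: box_right_boundary_def box_even_def box_odd_def)
  qed
  then have "card (Q \<inter> box_odd) = card (Q \<inter> box_even - box_right_boundary Q)"
    by (rule bij_betw_same_card)
  moreover have "box_right_boundary Q \<subseteq> Q" by (auto simp: box_right_boundary_def)
  then have "Q \<inter> box_even = (Q \<inter> box_even - box_right_boundary Q) \<union> (box_right_boundary Q \<inter> box_even)" by blast
  then have "card (Q \<inter> box_even) = card (Q \<inter> box_even - box_right_boundary Q) + card (box_right_boundary Q \<inter> box_even)"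
    using fin \<open>box_right_boundary Q \<subseteq> Q\<close>
    by (metis (no_types, lifting) card_Un_disjoint Diff_disjoint Int_commute Int_Diff finite_Diff finite_Int finite_subset inf.cobounded1 Int_left_commute Int_empty_right)
  ultimately show ?thesis by simp
qed

lemma box_card_split:
  "card (box_Q_below l :: ('n::{finite,linorder} \<Rightarrow> nat) set) =
     card (box_Q_below l \<inter> (box_odd :: ('n \<Rightarrow> nat) set)) + card (box_Q_below l \<inter> (box_even :: ('n \<Rightarrow> nat) set))"
proof -
  have "(box_Q_below l :: ('n \<Rightarrow> nat) set) = (box_Q_below l \<inter> box_odd) \<union> (box_Q_below l \<inter> box_even)"
    by (auto simp: box_odd_def box_even_def)
  moreover have "(box_Q_below l \<inter> box_odd) \<inter> (box_Q_below l \<inter> box_even) = ({} :: ('n \<Rightarrow> nat) set)"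
    by (auto simp: box_odd_def box_even_def)
  ultimately show ?thesis
    using card_Un_disjoint[of "box_Q_below l \<inter> (box_odd :: ('n \<Rightarrow> nat) set)" "box_Q_below l \<inter> box_even"] finite_box_Q_below
    by (metis finite_Int)
qed

theorem box_deficiency:
  assumes "l \<in> box_sigma_odd TYPE('n::{finite,linorder})"
  shows "nodal_deficiency (box_domain :: ((real, 'n) vec) set) l
    \<ge> ereal (real (card (box_right_boundary (box_Q_below l) \<inter> (box_even :: ('n \<Rightarrow> nat) set))) - 1)"
proof (rule nodal_deficiency_ge)
  let ?b = "axis first_index 1 :: (real, 'n) vec"
  obtain m0 :: "'n \<Rightarrow> nat" where m0: "l = box_lambda m0" "odd (m0 first_index)"
    using assms by (auto simp: box_sigma_odd_def box_odd_def)
  have l0: "l \<ge> 0" unfolding m0 box_lambda_def by (intro sum_nonneg) auto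
  have odd_l: "odd (k ?b)" if k: "k \<in> bx.Idx" "bx.lam k = l" for k
  proof -
    obtain m where m: "k = axis_fun m"
      using k(1) bij_betw_imp_surj_on[OF bij_axis_fun] by blast
    then have "box_lambda m = box_lambda m0" using k(2) m0 by (simp add: lam_axis_fun)
    from box_lambda_parity[OF this] show ?thesis using m0(2) m by simp
  qed
  have bB: "?b \<in> Basis" by (simp add: axis_in_Basis_iff)
  let ?\<sigma> = "reflect_coords {?b} 0 bx.top_corner :: (real, 'n) vec \<Rightarrow> (real, 'n) vec"
  let ?C = "{k\<in>bx.Idx. bx.lam k < l \<and> odd (k ?b)}"
  have cC: "card ?C = card (box_Q_below l \<inter> (box_odd :: ('n \<Rightarrow> nat) set))"
    unfolding card_axis_fun
    by (rule arg_cong[where f=card]) (auto simp: lam_axis_fun box_Q_below_def box_odd_def)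
  show "spectral_position (box_domain :: ((real, 'n) vec) set) l =
     card (box_Q_below l \<inter> (box_odd :: ('n \<Rightarrow> nat) set)) + card (box_Q_below l \<inter> (box_even :: ('n \<Rightarrow> nat) set)) + 1"
  proof -
    have "card {k\<in>(bx.Idx :: ((real, 'n) vec \<Rightarrow> nat) set). bx.lam k < l} = card (box_Q_below l :: ('n \<Rightarrow> nat) set)"
      unfolding card_axis_fun by (simp add: lam_axis_fun box_Q_below_def)
    then show ?thesis
      unfolding box_domain_eq bx.spectral_position_Box using box_card_split[of l, where 'n='n] by simp
  qed
  show "card (box_Q_below l \<inter> (box_even :: ('n \<Rightarrow> nat) set)) = card (box_Q_below l \<inter> (box_odd :: ('n \<Rightarrow> nat) set))
      + card (box_right_boundary (box_Q_below l) \<inter> (box_even :: ('n \<Rightarrow> nat) set))"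
    by (rule card_box_even)
  fix u assume "u \<in> neumann_eigenfunctions (box_domain :: ((real, 'n) vec) set) l"
  then have "u \<in> fv.span (bx.eBox ` {k\<in>bx.Idx. bx.lam k = l})"
    unfolding neumann_eigenfunctions_def box_domain_eq bx.eigenspace_Box by blast
  then obtain c where c: "\<And>x. u x = (\<Sum>k\<in>{k\<in>bx.Idx. bx.lam k = l}. c k * bx.eBox k x)"
    using span_image_combination[OF bx.finite_lam_eq] by blast
  define \<phi> where "\<phi> x = (\<Sum>k\<in>{k\<in>bx.Idx. bx.lam k = l}. c k * bx.e k x)" for x
  have "finite (nodal_domains bx.Box u) \<and> card (nodal_domains bx.Box u) \<le> 2 * card ?C + 2"
  \<comment> \<open>No unfolding is involved here; the symmetry is the reflection of the first
    coordinate.\<close>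
  proof (rule bx.nodal_domains_odd_bound[where \<rho>="\<lambda>x. x" and \<sigma>="?\<sigma>" and \<phi>=\<phi> and a=c and l=l and K="{k\<in>bx.Idx. bx.lam k = l}"])
    show "interior bx.Box \<noteq> ({} :: ((real, 'n) vec) set)"
      using bx.box_nonempty by (simp add: bx.Box_def interior_cbox)
    show "?\<sigma> x \<in> bx.Box" if "x \<in> bx.Box" for x
      using that unfolding bx.Box_def by (rule reflect_coords_in_cbox)
    show "\<phi> (?\<sigma> x) = - \<phi> x" for x
      unfolding \<phi>_def sum_negf[symmetric]
      by (rule sum.cong) (use odd_l bB in \<open>auto simp: bx.e_reflect\<close>)
    show "finite ?C" by (rule finite_subset[OF _ bx.finite_lam_less[of l]]) auto
    show "bx.ip f (bx.e k) = 0"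
      if "continuous_on bx.Box f" "\<And>x. x \<in> bx.Box \<Longrightarrow> f (?\<sigma> x) = - f x" "\<And>k. k \<in> ?C \<Longrightarrow> bx.ip f (bx.e k) = 0"
        "k \<in> bx.Idx" "bx.lam k < l" for f k
    proof (cases "odd (k ?b)")
      case False
      show ?thesis
        by (rule bx.ip_e_zero_of_odd[OF that(1), of "{?b}"]) (use that(2) bB False in auto)
    qed (use that in auto)
    show "u x = \<phi> x" if "x \<in> bx.Box" for x
      using that by (simp add: c \<phi>_def bx.eBox_def)
  qed (auto simp: bx.convex_Box bx.finite_lam_eq \<phi>_def l0 continuous_on_reflect_coords bx.reflect_coords_involution continuous_on_id)
  then show "finite (nodal_domains box_domain u) \<and> card (nodal_domains box_domain u)
      \<le> 2 * card (box_Q_below l \<inter> (box_odd :: ('n \<Rightarrow> nat) set)) + 2"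
    unfolding box_domain_eq cC .
qed

section \<open>The triangle\<close>

global_interpretation sq: cos_box "(\<lambda>_. 1) :: real \<times> real \<Rightarrow> real"
  by unfold_locales simp

lemma Basis_plane: "(Basis :: (real \<times> real) set) = {(1, 0), (0, 1)}"
  by (auto simp: Basis_prod_def)

lemma mem_Sq: "z \<in> sq.Box \<longleftrightarrow> 0 \<le> fst z \<and> fst z \<le> pi \<and> 0 \<le> snd z \<and> snd z \<le> pi"
  by (cases z) (auto simp: sq.mem_Box Basis_plane)

lemma top_corner_Sq: "sq.top_corner = (pi, pi)"
  by (simp add: sq.top_corner_def Basis_plane)

definition pk :: "nat \<times> nat \<Rightarrow> real \<times> real \<Rightarrow> nat" where
  "pk p b = (if b = (1, 0) then fst p else if b = (0, 1) then snd p else 0)"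

lemma e_pk: "sq.e (pk (m, n)) (x, y) = cos (real m * x) * cos (real n * y)"
  by (simp add: sq.e_def Basis_plane pk_def)

lemma lam_pk: "sq.lam (pk p) = tri_lambda p"
  by (cases p) (simp add: sq.lam_def Basis_plane pk_def tri_lambda_def)

lemma e_pk_swap: "sq.e (pk p) (prod.swap z) = sq.e (pk (prod.swap p)) z"
  by (cases p; cases z) (simp add: e_pk)

lemma tri_lambda_swap: "tri_lambda (prod.swap p) = tri_lambda p"
  by (cases p) (simp add: tri_lambda_def)

lemma bij_pk: "bij_betw pk UNIV sq.Idx"
proof (rule bij_betw_byWitness[where f'="\<lambda>k. (k (1, 0), k (0, 1))"])
  show "\<forall>k\<in>sq.Idx. pk (k (1, 0), k (0, 1)) = k"
    by (auto simp: sq.Idx_def Basis_plane pk_def fun_eq_iff)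
qed (auto simp: sq.Idx_def Basis_plane pk_def)

lemma pk_in_Idx: "pk p \<in> sq.Idx"
  using bij_pk by (auto simp: bij_betw_def)

lemma pk_eq_iff: "pk p = pk r \<longleftrightarrow> p = r"
  by (rule inj_eq[OF bij_betw_imp_inj_on[OF bij_pk]])

lemma Idx_pk: "k \<in> sq.Idx \<Longrightarrow> \<exists>p. k = pk p"
  using bij_betw_imp_surj_on[OF bij_pk] by blast

definition fold_tri :: "real \<times> real \<Rightarrow> real \<times> real" where
  "fold_tri z = (max (fst z) (snd z), min (fst z) (snd z))"

text \<open>Reflection in the line x + y = pi, the symmetry axis of the triangle. It multiplies
  symmetrized cosines by (-1)^(m + n).\<close>

definition flip_tri :: "real \<times> real \<Rightarrow> real \<times> real" where
  "flip_tri z = (pi - snd z, pi - fst z)"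

definition sort_pair :: "nat \<times> nat \<Rightarrow> nat \<times> nat" where
  "sort_pair p = (max (fst p) (snd p), min (fst p) (snd p))"

text \<open>For m = n this is twice a cosine product, still non-zero, so the diagonal quantum
  numbers fit into the same basis.\<close>

definition esym :: "nat \<times> nat \<Rightarrow> real \<times> real \<Rightarrow> real" where
  "esym p z = sq.e (pk p) z + sq.e (pk (prod.swap p)) z"

definition etri :: "nat \<times> nat \<Rightarrow> real \<times> real \<Rightarrow> real" where
  "etri p z = (if z \<in> triangle_domain then esym p z else 0)"

lemma mem_triangle: "z \<in> triangle_domain \<longleftrightarrow> fst z \<le> pi \<and> 0 \<le> snd z \<and> snd z \<le> fst z"
  by (cases z) (auto simp: triangle_domain_def)

lemma triangle_subset: "triangle_domain \<subseteq> sq.Box"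
  by (auto simp: mem_triangle mem_Sq)

lemma fold_tri_cases: "fold_tri z = z \<or> fold_tri z = prod.swap z"
  by (cases z) (auto simp: fold_tri_def max_def min_def)

lemma fold_tri_id: "z \<in> triangle_domain \<Longrightarrow> fold_tri z = z"
  by (cases z) (auto simp: fold_tri_def mem_triangle)

lemma fold_tri_in: "z \<in> sq.Box \<Longrightarrow> fold_tri z \<in> triangle_domain"
  by (auto simp: fold_tri_def mem_triangle mem_Sq)

lemma fold_tri_swap: "fold_tri (prod.swap z) = fold_tri z"
  by (simp add: fold_tri_def max.commute min.commute)

lemma sort_pair_cases: "sort_pair p = p \<or> sort_pair p = prod.swap p"
  by (cases p) (auto simp: sort_pair_def max_def min_def)

lemma sort_pair_Q: "sort_pair p \<in> tri_Q"
  by (auto simp: sort_pair_def tri_Q_def)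

lemma esym_swap: "esym p (prod.swap z) = esym p z"
  unfolding esym_def e_pk_swap by simp

lemma esym_swap': "esym (prod.swap p) z = esym p z"
  unfolding esym_def by simp

lemma esym_sort: "esym (sort_pair p) z = esym p z"
  using sort_pair_cases[of p] esym_swap' by metis

lemma tri_lambda_sort: "tri_lambda (sort_pair p) = tri_lambda p"
  using sort_pair_cases[of p] tri_lambda_swap by metis

lemma esym_fold: "esym p (fold_tri z) = esym p z"
  using fold_tri_cases[of z] esym_swap by metis

lemma continuous_on_esym: "continuous_on S (esym p)"
  unfolding esym_def[abs_def] by (intro continuous_intros)

section \<open>Symmetrized cosines as Neumann eigenfunctions of the triangle\<close>

definition grad_sym :: "nat \<times> nat \<Rightarrow> real \<times> real \<Rightarrow> real \<times> real" where
  "grad_sym p z = sq.grad (pk p) z + sq.grad (pk (prod.swap p)) z"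

definition hess_sym :: "nat \<times> nat \<Rightarrow> real \<times> real \<Rightarrow> real \<times> real \<Rightarrow> real \<times> real" where
  "hess_sym p z h = sq.hess (pk p) z h + sq.hess (pk (prod.swap p)) z h"

lemma esym_has_derivative: "(esym p has_derivative (\<lambda>h. grad_sym p z \<bullet> h)) (at z)"
  unfolding esym_def[abs_def] grad_sym_def inner_add_left
  by (intro has_derivative_add sq.e_has_derivative)

lemma grad_sym_has_derivative: "(grad_sym p has_derivative hess_sym p z) (at z)"
  unfolding grad_sym_def[abs_def] hess_sym_def[abs_def]
  by (intro has_derivative_add sq.grad_has_derivative)

lemma continuous_on_hess_sym: "continuous_on S (\<lambda>z. hess_sym p z h)"
  unfolding hess_sym_def by (intro continuous_intros sq.continuous_on_hess)

lemma trace_hess_sym: "(\<Sum>b\<in>Basis. hess_sym p z b \<bullet> b) = - tri_lambda p * esym p z"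
  unfolding hess_sym_def inner_add_left sum.distrib sq.trace_hess lam_pk tri_lambda_swap esym_def
  by (simp add: distrib_left)

lemma grad_pk: "sq.grad (pk (m, n)) (x, y) = (- (real m * sin (real m * x) * cos (real n * y)), - (real n * sin (real n * y) * cos (real m * x)))"
proof -
  have B: "Basis - {(1::real, 0::real)} = {(0, 1)}" "Basis - {(0::real, 1::real)} = {(1, 0)}"
    by (auto simp: Basis_plane)
  have "sq.grad (pk (m, n)) (x, y) \<bullet> (1, 0) = - (real m * sin (real m * x) * cos (real n * y))"
    by (subst sq.grad_inner) (simp add: Basis_plane, simp only: B, simp add: sq.cc_def sq.cc'_def pk_def)
  moreover have "sq.grad (pk (m, n)) (x, y) \<bullet> (0, 1) = - (real n * sin (real n * y) * cos (real m * x))"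
    by (subst sq.grad_inner) (simp add: Basis_plane, simp only: B, simp add: sq.cc_def sq.cc'_def pk_def)
  ultimately show ?thesis by (simp add: prod_eq_iff inner_prod_def)
qed

lemma grad_sym_faces:
  "fst (grad_sym p (0, y)) = 0" "fst (grad_sym p (pi, y)) = 0"
  "snd (grad_sym p (x, 0)) = 0" "snd (grad_sym p (x, pi)) = 0"
  "fst (grad_sym p (x, x)) = snd (grad_sym p (x, x))"
  by (cases p; simp add: grad_sym_def grad_pk)+

text \<open>The gradient vanishes at the three vertices, normals at interior points are 0, and on an
  open side moving both ways along it shows that a normal is orthogonal to the side, to which the
  gradient is parallel.\<close>

lemma triangle_normal_cone:
  assumes z: "z \<in> triangle_domain" and v: "v \<in> outward_normal_cone triangle_domain z"
  shows "grad_sym p z \<bullet> v = 0"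
proof -
  obtain x y where xy: "z = (x, y)" by (cases z)
  obtain v1 v2 where vv: "v = (v1, v2)" by (cases v)
  have T: "x \<le> pi" "0 \<le> y" "y \<le> x" using z by (auto simp: xy mem_triangle)
  have cone: "v1 * s + v2 * t \<le> 0" if "x + s \<le> pi" "0 \<le> y + t" "y + t \<le> x + s" for s t
  proof -
    have "(x + s, y + t) \<in> triangle_domain" using that by (simp add: mem_triangle)
    then have "v \<bullet> ((x + s, y + t) - z) \<le> 0" using v unfolding outward_normal_cone_def by blast
    then show ?thesis by (simp add: xy vv)
  qed
  have zero: "a * t \<le> 0 \<Longrightarrow> - (a * t) \<le> 0 \<Longrightarrow> t > 0 \<Longrightarrow> a = 0" for a t :: real
  proof -
    assume "a * t \<le> 0" "- (a * t) \<le> 0" "t > 0"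
    then have "a * t = 0" by linarith
    then show "a = 0" using \<open>t > 0\<close> by simp
  qed
  let ?g1 = "fst (grad_sym p z)" and ?g2 = "snd (grad_sym p z)"
  have "?g1 * v1 + ?g2 * v2 = 0"
  proof -
    have t2: "v1 = 0" if "y = 0" "0 < x" "x < pi"
      by (rule zero[of v1 "min x (pi - x)"]) (use that cone[of "min x (pi - x)" 0] cone[of "- min x (pi - x)" 0] in auto)
    have t4: "v2 = 0" if "y > 0" "x = pi" "y < pi"
      by (rule zero[of v2 "min y (pi - y)"]) (use that cone[of 0 "min y (pi - y)"] cone[of 0 "- min y (pi - y)"] in auto)
    have t5: "v1 + v2 = 0" if "y > 0" "x < pi" "x = y"
      by (rule zero[of "v1 + v2" "min x (pi - x)"])
         (use that cone[of "min x (pi - x)" "min x (pi - x)"] cone[of "- min x (pi - x)" "- min x (pi - x)"] in \<open>auto simp: distrib_right\<close>)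
    have t6: "v1 = 0" "v2 = 0" if "y > 0" "x < pi" "y < x"
    proof -
      show "v1 = 0"
        by (rule zero[of v1 "min (x - y) (pi - x)"]) (use that cone[of "min (x - y) (pi - x)" 0] cone[of "- min (x - y) (pi - x)" 0] in auto)
      show "v2 = 0"
        by (rule zero[of v2 "min y (x - y)"]) (use that cone[of 0 "min y (x - y)"] cone[of 0 "- min y (x - y)"] in auto)
    qed
    show ?thesis
    proof (cases "y = 0")
      case True
      then show ?thesis
        using t2 T by (cases "x = 0"; cases "x = pi") (auto simp: xy grad_sym_faces)
    next
      case False
      then have y: "y > 0" using T by simp
      show ?thesis
      proof (cases "x = pi")
        case True
        then show ?thesis using t4 y T by (cases "y = pi") (auto simp: xy grad_sym_faces)
      next
        case False
        then have x: "x < pi" using T by simp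
        show ?thesis
        proof (cases "x = y")
          case True
          then have "?g1 = ?g2" by (simp add: xy grad_sym_faces(5))
          then show ?thesis using t5[OF y x True] by (simp add: distrib_left[symmetric])
        next
          case False
          then show ?thesis using t6[OF y x] T by simp
        qed
      qed
    qed
  qed
  then show ?thesis by (simp add: inner_prod_def vv)
qed

text \<open>The sides x = pi, y = 0 and y = x; the other bounds in \<open>triangle_domain\<close>
  follow from these.\<close>

definition tri_normal :: "nat \<Rightarrow> real \<times> real" where
  "tri_normal i = (if i = 0 then (1, 0) else if i = 1 then (0, - 1) else (- 1, 1))"

definition tri_offset :: "nat \<Rightarrow> real" where
  "tri_offset i = (if i = 0 then pi else 0)"

lemma triangle_polytope: "polytope {0, 1, 2} tri_normal tri_offset (2, 1) triangle_domain"
proof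
  show "triangle_domain = {z. \<forall>i\<in>{0, 1, 2}. tri_normal i \<bullet> z \<le> tri_offset i}"
    by (auto simp: mem_triangle tri_normal_def tri_offset_def)
  show "bounded triangle_domain"
    using sq.compact_Box compact_imp_bounded bounded_subset triangle_subset by blast
  show "tri_normal i \<bullet> (2, 1) < tri_offset i" if "i \<in> {0, 1, 2}" for i
    using that pi_gt3 by (auto simp: tri_normal_def tri_offset_def)
qed auto

lemma etri_eigenfunction: "etri p \<in> neumann_eigenspace triangle_domain (tri_lambda p)"
  unfolding neumann_eigenspace_def
proof (intro CollectI conjI exI[of _ "grad_sym p"] exI[of _ "hess_sym p"])
  interpret T: polytope "{0, 1, 2}" tri_normal tri_offset "(2, 1)" triangle_domain by (rule triangle_polytope)
  show "\<forall>x\<in>triangle_domain. (etri p has_derivative (\<lambda>h. grad_sym p x \<bullet> h)) (at x within triangle_domain)"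
  proof
    fix x :: "real \<times> real" assume x: "x \<in> triangle_domain"
    show "(etri p has_derivative (\<lambda>h. grad_sym p x \<bullet> h)) (at x within triangle_domain)"
      by (rule has_derivative_transform[OF x _ has_derivative_at_withinI[OF esym_has_derivative]]) (simp add: etri_def)
  qed
  show "continuous_on triangle_domain (grad_sym p)"
    by (intro continuous_at_imp_continuous_on ballI has_derivative_continuous[OF grad_sym_has_derivative])
  show "\<forall>x\<in>interior triangle_domain. - (\<Sum>b\<in>Basis. hess_sym p x b \<bullet> b) = tri_lambda p * etri p x"
    using interior_subset[of triangle_domain] by (auto simp: trace_hess_sym etri_def)
  show "\<forall>x\<in>frontier triangle_domain. \<forall>v\<in>outward_normal_cone triangle_domain x. grad_sym p x \<bullet> v = 0"
    by (intro ballI triangle_normal_cone subsetD[OF frontier_subset_closed[OF T.closed_Omega]])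
qed (auto simp: etri_def continuous_on_hess_sym intro: grad_sym_has_derivative)

section \<open>Unfolding the triangle to the square\<close>

lemma has_integral_swap_Sq:
  fixes f :: "real \<times> real \<Rightarrow> real"
  assumes "(f has_integral i) sq.Box"
  shows "((\<lambda>z. f (prod.swap z)) has_integral i) sq.Box"
proof -
  have B: "sq.Box = cbox (0, 0) (pi, pi)" by (simp add: sq.Box_def top_corner_Sq zero_prod_def)
  have "((\<lambda>z. f (prod.swap z)) has_integral (1 / 1) *\<^sub>R i) (prod.swap ` cbox (0, 0) (pi, pi))"
  proof (rule has_integral_twiddle)
    show "measure lborel (prod.swap ` cbox u v) = 1 * measure lborel (cbox u v)" for u v :: "real \<times> real"
      by (metis content_Pair mult.commute mult_1 old.prod.exhaust swap_cbox_Pair)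
    show "continuous (at x) prod.swap" for x :: "real \<times> real"
      using isCont_swap by blast
    show "\<exists>w z. prod.swap ` cbox u v = cbox w z" for u v :: "real \<times> real"
      by (metis old.prod.exhaust swap_cbox_Pair)
    then show "\<exists>w z. prod.swap ` cbox u v = cbox w z" for u v :: "real \<times> real" .
    show "(f has_integral i) (cbox (0, 0) (pi, pi))" using assms B by simp
  qed auto
  then show ?thesis by (simp add: B)
qed

lemma ip_swap:
  assumes "continuous_on sq.Box f" "continuous_on sq.Box g"
  shows "sq.ip (\<lambda>z. f (prod.swap z)) (\<lambda>z. g (prod.swap z)) = sq.ip f g"
proof -
  have "((\<lambda>z. f z * g z) has_integral sq.ip f g) sq.Box"
    unfolding sq.ip_def by (intro integrable_integral sq.integrable_Box continuous_intros assms)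
  from has_integral_swap_Sq[OF this] show ?thesis
    unfolding sq.ip_def by (rule integral_unique)
qed

text \<open>The square is the triangle and its mirror image, which overlap in the negligible
  diagonal.\<close>

lemma integral_Sq_symmetric:
  fixes G :: "real \<times> real \<Rightarrow> real"
  assumes c: "continuous_on sq.Box G" and s: "\<And>z. z \<in> sq.Box \<Longrightarrow> G (prod.swap z) = G z"
  shows "integral sq.Box G = 2 * integral triangle_domain G"
proof -
  interpret T: polytope "{0, 1, 2}" tri_normal tri_offset "(2, 1)" triangle_domain by (rule triangle_polytope)
  let ?f = "\<lambda>z. if z \<in> triangle_domain then G z else 0"
  have "G integrable_on triangle_domain"
  proof -
    have "set_integrable lborel triangle_domain G"
      unfolding set_integrable_def
      by (rule borel_integrable_compact[OF T.compact_Omega continuous_on_subset[OF c triangle_subset]])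
    then show ?thesis by (rule set_borel_integral_eq_integral(1))
  qed
  then have "(?f has_integral integral triangle_domain G) sq.Box"
    unfolding has_integral_restrict[OF triangle_subset] by (rule integrable_integral)
  from has_integral_add[OF this has_integral_swap_Sq[OF this]]
  have "((\<lambda>z. ?f z + ?f (prod.swap z)) has_integral 2 * integral triangle_domain G) sq.Box" by simp
  then have "(G has_integral 2 * integral triangle_domain G) sq.Box"
  proof (rule has_integral_spike[rotated 2])
    show "negligible {z :: real \<times> real. (1, - 1) \<bullet> z = 0}"
      by (rule negligible_hyperplane) (simp add: zero_prod_def)
    fix z :: "real \<times> real" assume z: "z \<in> sq.Box - {z. (1, - 1) \<bullet> z = 0}"
    then have "fst z \<noteq> snd z" by (cases z) auto
    then show "G z = ?f z + ?f (prod.swap z)"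
      using z s[of z] by (cases z) (auto simp: mem_triangle mem_Sq)
  qed
  then show ?thesis by (rule integral_unique)
qed

lemma tri_fold_continuous: "continuous_on S fold_tri"
  unfolding fold_tri_def[abs_def] by (intro continuous_intros)

text \<open>The unfolded function is only known to be continuous across the diagonal, so Green's
  identity is applied on the triangle with symmetrized cosines. By symmetry the resulting integrals
  over the triangle are the cosine coefficients over the square.\<close>

lemma tri_fold_expansion:
  assumes u: "u \<in> neumann_eigenspace triangle_domain \<mu>"
  shows "\<exists>c. \<forall>z\<in>sq.Box. u (fold_tri z) = (\<Sum>k\<in>{k\<in>sq.Idx. sq.lam k = \<mu>}. c k * sq.e k z)"
proof -
  interpret T: polytope "{0, 1, 2}" tri_normal tri_offset "(2, 1)" triangle_domain by (rule triangle_polytope)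
  have face: "tri_normal i \<bullet> grad_sym p z = 0"
    if "z \<in> triangle_domain" "i \<in> {0, 1, 2}" "tri_normal i \<bullet> z = tri_offset i" for z i p
  proof -
    obtain x y where z: "z = (x, y)" by (cases z)
    show ?thesis
      using that(2,3) grad_sym_faces[of p] unfolding z
      by (auto simp: tri_normal_def tri_offset_def inner_prod_def)
  qed
  note green = T.neumann_green[OF u esym_has_derivative grad_sym_has_derivative continuous_on_hess_sym trace_hess_sym face]
  have uc: "continuous_on triangle_domain u" by (rule green(2))
  define w where "w z = u (fold_tri z)" for z
  have wc: "continuous_on sq.Box w"
    unfolding w_def[abs_def] by (rule continuous_on_compose2[OF uc tri_fold_continuous]) (use fold_tri_in in auto)
  have ws: "w (prod.swap z) = w z" for z by (simp add: w_def fold_tri_swap)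
  have coef: "sq.ip w (sq.e k) = 0" if k: "k \<in> sq.Idx" "k \<notin> {k\<in>sq.Idx. sq.lam k = \<mu>}" for k
  proof -
    obtain p where p: "k = pk p" using Idx_pk[OF k(1)] by blast
    have "sq.ip w (sq.e (pk p)) = sq.ip (\<lambda>z. w (prod.swap z)) (\<lambda>z. sq.e (pk p) (prod.swap z))"
      by (rule ip_swap[symmetric]) (intro wc sq.continuous_on_e)+
    then have "sq.ip w (sq.e (pk p)) = sq.ip w (sq.e (pk (prod.swap p)))"
      by (simp add: ws e_pk_swap)
    moreover have "sq.ip w (esym p) = sq.ip w (sq.e (pk p)) + sq.ip w (sq.e (pk (prod.swap p)))"
      unfolding esym_def[abs_def] by (intro sq.ip_add_right wc sq.continuous_on_e)
    ultimately have "2 * sq.ip w (sq.e k) = sq.ip w (esym p)" using p by simp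
    also have "\<dots> = 2 * integral triangle_domain (\<lambda>z. w z * esym p z)"
      unfolding sq.ip_def
      by (rule integral_Sq_symmetric) (auto intro!: continuous_intros wc continuous_on_esym simp: ws esym_swap)
    also have "integral triangle_domain (\<lambda>z. w z * esym p z) = integral triangle_domain (\<lambda>z. u z * esym p z)"
      by (rule integral_cong) (simp add: w_def fold_tri_id)
    also have "\<dots> = 0"
    proof -
      have "tri_lambda p \<noteq> \<mu>" using k p by (simp add: lam_pk)
      moreover have "(tri_lambda p - \<mu>) * integral triangle_domain (\<lambda>z. u z * esym p z) = 0" by (rule green(1))
      ultimately show ?thesis by simp
    qed
    finally show ?thesis by simp
  qed
  have "u (fold_tri z) = (\<Sum>k\<in>{k\<in>sq.Idx. sq.lam k = \<mu>}. sq.ip w (sq.e k) / sq.ip (sq.e k) (sq.e k) * sq.e k z)"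
    if "z \<in> sq.Box" for z
    using sq.eq_trig_of_coeffs[OF wc sq.finite_lam_eq _ coef that] by (simp add: w_def)
  then show ?thesis
    by (intro exI[of _ "\<lambda>k. sq.ip w (sq.e k) / sq.ip (sq.e k) (sq.e k)"]) blast
qed

theorem eigenspace_triangle:
  "neumann_eigenspace triangle_domain \<mu> = fv.span (etri ` {p\<in>tri_Q. tri_lambda p = \<mu>})"
proof
  show "fv.span (etri ` {p\<in>tri_Q. tri_lambda p = \<mu>}) \<subseteq> neumann_eigenspace triangle_domain \<mu>"
    by (rule fv.span_minimal[OF _ subspace_neumann_eigenspace]) (use etri_eigenfunction in auto)
  show "neumann_eigenspace triangle_domain \<mu> \<subseteq> fv.span (etri ` {p\<in>tri_Q. tri_lambda p = \<mu>})"
  proof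
    fix u assume u: "u \<in> neumann_eigenspace triangle_domain \<mu>"
    obtain c where c: "\<And>z. z \<in> sq.Box \<Longrightarrow> u (fold_tri z) = (\<Sum>k\<in>{k\<in>sq.Idx. sq.lam k = \<mu>}. c k * sq.e k z)"
      using tri_fold_expansion[OF u] by blast
    let ?A = "{p. tri_lambda p = \<mu>}"
    have reindex: "(\<Sum>k\<in>{k\<in>sq.Idx. sq.lam k = \<mu>}. g k) = (\<Sum>p\<in>?A. g (pk p))" for g :: "_ \<Rightarrow> real"
    proof (rule sum.reindex_bij_betw[symmetric])
      show "bij_betw pk ?A {k\<in>sq.Idx. sq.lam k = \<mu>}"
        using bij_pk unfolding bij_betw_def by (auto simp: lam_pk[symmetric] intro: inj_on_subset)
    qed
    have "u = (\<lambda>z. \<Sum>p\<in>?A. (c (pk p) / 2) * etri (sort_pair p) z)"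
    proof
      fix z
      show "u z = (\<Sum>p\<in>?A. (c (pk p) / 2) * etri (sort_pair p) z)"
      proof (cases "z \<in> triangle_domain")
        case True
        have zB: "z \<in> sq.Box" "prod.swap z \<in> sq.Box" using True triangle_subset by (auto simp: mem_Sq)
        \<comment> \<open>Averaging the expansion over \<open>z\<close> and its mirror image turns
          cosine products into symmetrized ones; this is the origin of the factor 1/2.\<close>
        have "2 * u z = u (fold_tri z) + u (fold_tri (prod.swap z))"
          unfolding fold_tri_swap fold_tri_id[OF True] by simp
        also have "\<dots> = (\<Sum>p\<in>?A. c (pk p) * sq.e (pk p) z) + (\<Sum>p\<in>?A. c (pk p) * sq.e (pk (prod.swap p)) z)"
          unfolding c[OF zB(1)] c[OF zB(2)] reindex e_pk_swap ..
        also have "\<dots> = (\<Sum>p\<in>?A. c (pk p) * esym (sort_pair p) z)"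
          unfolding esym_sort by (simp add: esym_def sum.distrib[symmetric] distrib_left)
        finally have "u z = (\<Sum>p\<in>?A. c (pk p) * esym (sort_pair p) z) / 2" by simp
        then show ?thesis using True by (simp add: etri_def sum_divide_distrib)
      next
        case False
        then have "u z = 0" using u unfolding neumann_eigenspace_def by blast
        then show ?thesis using False by (simp add: etri_def)
      qed
    qed
    moreover have "(\<Sum>p\<in>?A. (\<lambda>z. (c (pk p) / 2) * etri (sort_pair p) z)) \<in> fv.span (etri ` {p\<in>tri_Q. tri_lambda p = \<mu>})"
      by (intro fv.span_sum fv.span_scale fv.span_base) (auto simp: sort_pair_Q tri_lambda_sort)
    moreover have "(\<Sum>p\<in>?A. (\<lambda>z. (c (pk p) / 2) * etri (sort_pair p) z)) = (\<lambda>z. \<Sum>p\<in>?A. (c (pk p) / 2) * etri (sort_pair p) z)"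
      by (simp add: fun_eq_iff sum_apply)
    ultimately show "u \<in> fv.span (etri ` {p\<in>tri_Q. tri_lambda p = \<mu>})" by simp
  qed
qed

section \<open>Counting the quantum numbers of the triangle\<close>

lemma finite_tri_lambda_less: "finite {p. tri_lambda p < l}"
proof -
  have "pk ` {p. tri_lambda p < l} \<subseteq> {k\<in>sq.Idx. sq.lam k < l}"
    by (auto simp: lam_pk pk_in_Idx)
  then have "finite (pk ` {p. tri_lambda p < l})" using sq.finite_lam_less finite_subset by blast
  then show ?thesis by (rule finite_imageD) (auto simp: inj_on_def pk_eq_iff)
qed

lemma tri_Q_swap: "p \<in> tri_Q \<Longrightarrow> r \<in> tri_Q \<Longrightarrow> p = prod.swap r \<Longrightarrow> p = r"
  by (auto simp: tri_Q_def)

lemma spectral_position_triangle: "spectral_position triangle_domain l = card (tri_Q_below l) + 1"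
  unfolding tri_Q_below_def
proof (rule spectral_position_eq[OF eigenspace_triangle])
  show "finite {p\<in>tri_Q. tri_lambda p < l}" by (rule finite_subset[OF _ finite_tri_lambda_less[of l]]) auto
  fix F c p assume F: "finite F" "F \<subseteq> tri_Q" "p \<in> F" and z: "\<And>x. (\<Sum>p\<in>F. c p * etri p x) = 0"
  have zero: "(\<Sum>r\<in>F. c r * esym r x) = 0" if "x \<in> sq.Box" for x
    using z[of "fold_tri x"] fold_tri_in[OF that] by (simp add: etri_def esym_fold)
  define N where "N = sq.ip (sq.e (pk p)) (sq.e (pk p))"
  \<comment> \<open>Testing with a single product isolates \<open>c p\<close>: for sorted pairs
    \<open>p\<close> and \<open>r\<close> it meets only the symmetrization of \<open>p\<close>
    itself, twice if m = n.\<close>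
  have ip: "sq.ip (sq.e (pk p)) (esym r) = (if r = p then (if prod.swap p = p then 2 * N else N) else 0)"
    if "r \<in> F" for r
  proof -
    have orth: "sq.ip (sq.e (pk p)) (sq.e (pk r)) = (if r = p then N else 0)" for r
      using sq.ip_e_orthogonal[OF pk_in_Idx pk_in_Idx, of p r] by (auto simp: N_def pk_eq_iff)
    have split: "sq.ip (sq.e (pk p)) (esym r) = sq.ip (sq.e (pk p)) (sq.e (pk r)) + sq.ip (sq.e (pk p)) (sq.e (pk (prod.swap r)))"
      unfolding esym_def[abs_def] by (intro sq.ip_add_right sq.continuous_on_e)
    have "r = p" if "prod.swap r = p"
      using tri_Q_swap[OF subsetD[OF F(2,3)] subsetD[OF F(2) \<open>r \<in> F\<close>] that[symmetric]] by (rule sym)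
    then show ?thesis
      unfolding split orth by (cases "r = p"; cases "prod.swap r = p") simp_all
  qed
  have "0 = sq.ip (sq.e (pk p)) (\<lambda>x. \<Sum>r\<in>F. c r * esym r x)"
    unfolding sq.ip_def using zero by (simp cong: integral_cong)
  also have "\<dots> = (\<Sum>r\<in>F. c r * sq.ip (sq.e (pk p)) (esym r))"
    by (rule sq.ip_sum_right[OF F(1) sq.continuous_on_e continuous_on_esym])
  also have "\<dots> = (\<Sum>r\<in>F. if r = p then c p * (if prod.swap p = p then 2 * N else N) else 0)"
    by (rule sum.cong) (auto simp: ip)
  also have "\<dots> = c p * (if prod.swap p = p then 2 * N else N)" using F by simp
  finally show "c p = 0" using sq.ip_e_self_pos[of "pk p"] by (auto simp: N_def split: if_splits)
qed

text \<open>A square has the parity of its base.\<close>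

lemma tri_lambda_parity:
  assumes "tri_lambda p = tri_lambda r"
  shows "even (fst p + snd p) \<longleftrightarrow> even (fst r + snd r)"
proof -
  have "real (fst p ^ 2 + snd p ^ 2) = real (fst r ^ 2 + snd r ^ 2)"
    using assms by (cases p; cases r) (simp add: tri_lambda_def)
  then have "fst p ^ 2 + snd p ^ 2 = fst r ^ 2 + snd r ^ 2" by (simp only: of_nat_eq_iff)
  then have "even (fst p ^ 2 + snd p ^ 2) \<longleftrightarrow> even (fst r ^ 2 + snd r ^ 2)" by simp
  then show ?thesis by simp
qed

lemma mod_2_eq_iff: "(m mod 2 = n mod (2::nat)) \<longleftrightarrow> even (m + n)"
  by presburger

lemma card_tri_even:
  fixes l :: real
  defines "Q \<equiv> tri_Q_below l"
  shows "card (Q \<inter> tri_even) = card (Q \<inter> tri_odd) + card (tri_right_boundary Q \<inter> tri_even)"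
proof -
  have fin: "finite Q" unfolding Q_def tri_Q_below_def
    by (rule finite_subset[OF _ finite_tri_lambda_less[of l]]) auto
  have "bij_betw (\<lambda>(m, n). (m - 1, n)) (Q \<inter> tri_odd) (Q \<inter> tri_even - tri_right_boundary Q)"
  proof (rule bij_betw_byWitness[where f'="\<lambda>(m, n). (m + 1, n)"])
    \<comment> \<open>Odd points lie strictly off the diagonal, so their left neighbours still
      satisfy m \<ge> n.\<close>
    have pos: "m > n" if "(m, n) \<in> tri_odd" for m n
      using that by (cases "m = n") (auto simp: tri_odd_def tri_Q_def)
    show "\<forall>p\<in>Q \<inter> tri_odd. (case (case p of (m, n) \<Rightarrow> (m - 1, n)) of (m, n) \<Rightarrow> (m + 1, n)) = p"
      using pos by fastforce
    show "\<forall>p\<in>Q \<inter> tri_even - tri_right_boundary Q. (case (case p of (m, n) \<Rightarrow> (m + 1, n)) of (m, n) \<Rightarrow> (m - 1, n)) = p"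
      by auto
    show "(\<lambda>(m, n). (m - 1, n)) ` (Q \<inter> tri_odd) \<subseteq> Q \<inter> tri_even - tri_right_boundary Q"
    proof clarify
      fix m n assume mn: "(m, n) \<in> Q" "(m, n) \<in> tri_odd"
      have "m > n" using pos[OF mn(2)] .
      then obtain m' where m': "m = Suc m'" "n \<le> m'" by (cases m) auto
      have "tri_lambda (m', n) \<le> tri_lambda (m, n)"
        unfolding tri_lambda_def m' by (simp add: power_mono)
      then have "(m', n) \<in> Q"
        using mn(1) m'(2) by (simp add: Q_def tri_Q_below_def tri_Q_def)
      then have "(m - 1, n) \<in> Q" by (simp add: m')
      moreover have "(m - 1, n) \<in> tri_even"
        using mn(2) m' by (simp add: tri_odd_def tri_even_def tri_Q_def mod_2_eq_iff)
      moreover have "(m - 1, n) \<notin> tri_right_boundary Q"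
        using mn(1) \<open>m > n\<close> by (simp add: tri_right_boundary_def)
      ultimately show "(m - 1, n) \<in> Q \<inter> tri_even - tri_right_boundary Q" by blast
    qed
    show "(\<lambda>(m, n). (m + 1, n)) ` (Q \<inter> tri_even - tri_right_boundary Q) \<subseteq> Q \<inter> tri_odd"
      by (auto simp: tri_right_boundary_def tri_even_def tri_odd_def tri_Q_def mod_2_eq_iff)
  qed
  then have "card (Q \<inter> tri_odd) = card (Q \<inter> tri_even - tri_right_boundary Q)"
    by (rule bij_betw_same_card)
  moreover have "card (Q \<inter> tri_even) = card (Q \<inter> tri_even - tri_right_boundary Q) + card (tri_right_boundary Q \<inter> tri_even)"
  proof -
    have "tri_right_boundary Q \<subseteq> Q" by (auto simp: tri_right_boundary_def)
    then have "Q \<inter> tri_even = (Q \<inter> tri_even - tri_right_boundary Q) \<union> (tri_right_boundary Q \<inter> tri_even)" by blast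
    moreover have "finite (tri_right_boundary Q \<inter> tri_even)"
      using fin \<open>tri_right_boundary Q \<subseteq> Q\<close> by (meson finite_Int finite_subset)
    ultimately show ?thesis
      using fin card_Un_disjoint[of "Q \<inter> tri_even - tri_right_boundary Q" "tri_right_boundary Q \<inter> tri_even"] by auto
  qed
  ultimately show ?thesis by simp
qed

lemma e_flip: "sq.e (pk p) (flip_tri z) = (- 1) ^ (fst p + snd p) * sq.e (pk (prod.swap p)) z"
proof -
  \<comment> \<open>The axis reflection is the swap followed by the point reflection of the square,
    which reverses both coordinates.\<close>
  have "flip_tri z = reflect_coords Basis 0 sq.top_corner (prod.swap z)"
    by (cases z) (simp add: flip_tri_def reflect_coords_def Basis_plane top_corner_Sq)
  then have "sq.e (pk p) (flip_tri z) = (- 1) ^ (\<Sum>b\<in>Basis. pk p b) * sq.e (pk p) (prod.swap z)"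
    by (simp only: sq.e_reflect[OF subset_refl])
  then show ?thesis unfolding e_pk_swap by (simp add: Basis_plane pk_def)
qed

theorem triangle_deficiency:
  assumes "l \<in> tri_sigma_odd"
  shows "nodal_deficiency triangle_domain l
    \<ge> ereal (real (card (tri_right_boundary (tri_Q_below l) \<inter> tri_even)) - 1)"
proof (rule nodal_deficiency_ge)
  interpret T: polytope "{0, 1, 2}" tri_normal tri_offset "(2, 1)" triangle_domain by (rule triangle_polytope)
  obtain p0 where p0: "l = tri_lambda p0" "p0 \<in> tri_odd"
    using assms by (auto simp: tri_sigma_odd_def)
  have odd_p0: "odd (fst p0 + snd p0)"
    using p0(2) by (cases p0) (simp add: tri_odd_def mod_2_eq_iff)
  have l0: "l \<ge> 0" unfolding p0 tri_lambda_def by (cases p0) simp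
  have fin: "finite (tri_Q_below l)" unfolding tri_Q_below_def
    by (rule finite_subset[OF _ finite_tri_lambda_less[of l]]) auto
  \<comment> \<open>Only the representatives with m \<ge> n: a function symmetric under the swap has
    equal coefficients at (m, n) and (n, m). This keeps the number of conditions at the number of
    odd quantum numbers of the triangle.\<close>
  let ?C = "pk ` (tri_Q_below l \<inter> tri_odd)"
  have cC: "card ?C = card (tri_Q_below l \<inter> tri_odd)"
    by (rule card_image) (auto simp: inj_on_def pk_eq_iff)
  show "spectral_position triangle_domain l = card (tri_Q_below l \<inter> tri_odd) + card (tri_Q_below l \<inter> tri_even) + 1"
  proof -
    have "tri_Q_below l = (tri_Q_below l \<inter> tri_odd) \<union> (tri_Q_below l \<inter> tri_even)"
      by (auto simp: tri_Q_below_def tri_odd_def tri_even_def)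
    moreover have "(tri_Q_below l \<inter> tri_odd) \<inter> (tri_Q_below l \<inter> tri_even) = {}"
      by (auto simp: tri_odd_def tri_even_def)
    ultimately have "card (tri_Q_below l) = card (tri_Q_below l \<inter> tri_odd) + card (tri_Q_below l \<inter> tri_even)"
      using card_Un_disjoint[of "tri_Q_below l \<inter> tri_odd" "tri_Q_below l \<inter> tri_even"] fin by auto
    then show ?thesis by (simp add: spectral_position_triangle)
  qed
  show "card (tri_Q_below l \<inter> tri_even) = card (tri_Q_below l \<inter> tri_odd)
      + card (tri_right_boundary (tri_Q_below l) \<inter> tri_even)"
    by (rule card_tri_even)
  fix u assume "u \<in> neumann_eigenfunctions triangle_domain l"
  then obtain c where c: "\<And>z. z \<in> sq.Box \<Longrightarrow> u (fold_tri z) = (\<Sum>k\<in>{k\<in>sq.Idx. sq.lam k = l}. c k * sq.e k z)"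
    using tri_fold_expansion[of u l] by (auto simp: neumann_eigenfunctions_def)
  define \<phi> where "\<phi> x = (\<Sum>k\<in>{k\<in>sq.Idx. sq.lam k = l}. c k * sq.e k x)" for x
  have \<phi>u: "\<phi> z = u (fold_tri z)" if "z \<in> sq.Box" for z using c[OF that] by (simp add: \<phi>_def)
  have swapB: "prod.swap z \<in> sq.Box" if "z \<in> sq.Box" for z using that by (auto simp: mem_Sq)
  have "finite (nodal_domains triangle_domain u) \<and> card (nodal_domains triangle_domain u) \<le> 2 * card ?C + 2"
  proof (rule sq.nodal_domains_odd_bound[where \<rho>=fold_tri and \<sigma>=flip_tri and \<phi>=\<phi> and a=c and l=l and K="{k\<in>sq.Idx. sq.lam k = l}"])
    show "convex triangle_domain" by (rule T.convex_Omega)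
    show "interior triangle_domain \<noteq> {}" by (rule T.interior_nonempty)
    show "continuous_on UNIV flip_tri"
      unfolding flip_tri_def[abs_def] by (intro continuous_intros)
    show "\<phi> (fold_tri z) = \<phi> z" if "z \<in> sq.Box" for z
      using \<phi>u[OF that] \<phi>u[of "fold_tri z"] fold_tri_in[OF that] fold_tri_id triangle_subset by auto
    show "\<phi> (flip_tri z) = - \<phi> z" if "z \<in> sq.Box" for z
    proof -
      have "\<phi> (flip_tri z) = - \<phi> (prod.swap z)"
        unfolding \<phi>_def sum_negf[symmetric]
      proof (rule sum.cong[OF refl])
        fix k assume k: "k \<in> {k\<in>sq.Idx. sq.lam k = l}"
        then obtain p where p: "k = pk p" using Idx_pk by blast
        then have "tri_lambda p = tri_lambda p0" using k p0 by (simp add: lam_pk)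
        from tri_lambda_parity[OF this] odd_p0 have "odd (fst p + snd p)" by simp
        then show "c k * sq.e k (flip_tri z) = - (c k * sq.e k (prod.swap z))"
          unfolding p e_flip e_pk_swap by simp
      qed
      \<comment> \<open>The swap left over from the axis reflection disappears, since \<phi> is
        unfolded and thus symmetric.\<close>
      then show ?thesis using \<phi>u[OF that] \<phi>u[OF swapB[OF that]] by (simp add: fold_tri_swap)
    qed
    show "sq.ip f (sq.e k) = 0"
      if f: "continuous_on sq.Box f" "\<And>z. z \<in> sq.Box \<Longrightarrow> f (fold_tri z) = f z" "\<And>z. z \<in> sq.Box \<Longrightarrow> f (flip_tri z) = - f z"
        and C: "\<And>k. k \<in> ?C \<Longrightarrow> sq.ip f (sq.e k) = 0" and k: "k \<in> sq.Idx" "sq.lam k < l" for f k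
    proof -
      obtain p where p: "k = pk p" using Idx_pk[OF k(1)] by blast
      have fs: "f (prod.swap z) = f z" if "z \<in> sq.Box" for z
        using f(2)[OF that] f(2)[OF swapB[OF that]] by (simp add: fold_tri_swap)
      have ips: "sq.ip f (sq.e (pk (prod.swap r))) = sq.ip f (sq.e (pk r))" for r
      proof -
        have "sq.ip f (sq.e (pk r)) = sq.ip (\<lambda>z. f (prod.swap z)) (\<lambda>z. sq.e (pk r) (prod.swap z))"
          by (rule ip_swap[symmetric]) (intro f(1) sq.continuous_on_e)+
        also have "\<dots> = sq.ip f (sq.e (pk (prod.swap r)))"
          by (rule sq.ip_cong) (simp_all add: fs e_pk_swap)
        finally show ?thesis by simp
      qed
      show ?thesis
      proof (cases "even (fst p + snd p)")
        case True
        show ?thesis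
        proof (rule sq.ip_e_zero_of_odd[OF f(1) subset_refl])
          show "even (\<Sum>b\<in>Basis. k b)" using True by (simp add: p Basis_plane pk_def)
          fix z assume z: "z \<in> sq.Box"
          \<comment> \<open>Even under the swap and odd under the axis reflection, \<open>f\<close>
            is odd under the point reflection, which preserves the modes with m + n even.\<close>
          have "reflect_coords Basis 0 sq.top_corner z = flip_tri (prod.swap z)"
            by (cases z) (simp add: flip_tri_def reflect_coords_def Basis_plane top_corner_Sq)
          then show "f (reflect_coords Basis 0 sq.top_corner z) = - f z"
            using f(3)[OF swapB[OF z]] fs[OF z] by simp
        qed
      next
        case False
        have "sort_pair p \<in> tri_Q_below l \<inter> tri_odd"
        proof -
          have "odd (fst (sort_pair p) + snd (sort_pair p))"
            using False sort_pair_cases[of p] by (elim disjE) (simp_all add: add.commute)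
          moreover have "tri_lambda (sort_pair p) < l" using k(2) by (simp add: p lam_pk tri_lambda_sort)
          ultimately show ?thesis
            using sort_pair_Q[of p] by (cases "sort_pair p") (auto simp: tri_Q_below_def tri_odd_def mod_2_eq_iff)
        qed
        then have "sq.ip f (sq.e (pk (sort_pair p))) = 0" by (intro C) auto
        then show ?thesis using sort_pair_cases[of p] ips[of p] p by auto
      qed
    qed
    show "u z = \<phi> z" if "z \<in> triangle_domain" for z
      using \<phi>u[of z] that triangle_subset by (auto simp: fold_tri_id)
    show "flip_tri (flip_tri z) = z" for z by (simp add: flip_tri_def)
    show "flip_tri z \<in> triangle_domain" if "z \<in> triangle_domain" for z
      using that by (simp add: flip_tri_def mem_triangle)
    show "fold_tri (flip_tri z) = flip_tri (fold_tri z)" for z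
      by (cases z) (auto simp: fold_tri_def flip_tri_def max_def min_def)
  qed (use fin in \<open>auto simp: triangle_subset tri_fold_continuous fold_tri_in fold_tri_id sq.finite_lam_eq \<phi>_def l0\<close>)
  then show "finite (nodal_domains triangle_domain u) \<and> card (nodal_domains triangle_domain u)
      \<le> 2 * card (tri_Q_below l \<inter> tri_odd) + 2"
    unfolding cC .
qed

section \<open>The main result\<close>

theorem lemmaB2:
  shows "(\<forall>l0 \<in> tri_sigma_odd.
            nodal_deficiency triangle_domain l0
              \<ge> ereal (real (card (tri_right_boundary (tri_Q_below l0) \<inter> tri_even)) - 1)) \<and>
         (CARD('n) \<ge> 2 \<longrightarrow>
           (\<forall>l0 \<in> box_sigma_odd TYPE('n).
              nodal_deficiency (box_domain :: (real ^ 'n::{finite,linorder}) set) l0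
                \<ge> ereal (real (card (box_right_boundary (box_Q_below l0)
                                       \<inter> (box_even :: ('n \<Rightarrow> nat) set))) - 1)))"
  using triangle_deficiency box_deficiency by blast

end
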